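(* Let $(X,\|\cdot\|)$ be a complex Banach space, let $n,m\in\mathbb{N}$, and let $iA_j$, $1\le j\le n$, be commuting generators of bounded $C_0$-groups on $X$. Suppose $\alpha>0$, $d\in\mathbb{N}$ and $P_i(x)=\sum_{|\eta|\le d}P_{\eta,i}x^\eta$ ($P_{\eta,i}\in\mathbb{C}^{m,m}$, $x\in\mathbb{R}^n$, $i=1,2$) are two given polynomial matrices. Suppose that for each $x\in\mathbb{R}^n$ the matrix $P_2(x)$ is regular (invertible). Then there exists a dense subset $X_{\alpha,m}$ of $X^m$ such that, for every $\vec{x}\in X_{\alpha,m}$, there exists a unique solution $\vec{u}:[0,\infty)\to X^m$ of the abstract Cauchy problem $$\begin{cases}\mathbf{D}_t^\alpha\overline{P_2(A)}\vec{u}(t)=\overline{P_2(A)}\mathbf{D}_t^\alpha\vec{u}(t)=\overline{P_1(A)}\vec{u}(t),\quad t\ge0,\\ \vec{u}(0)=\vec{x};\quad \vec{u}^{(j)}(0)=0,\ 1\le j\le\lceil\alpha\rceil-1.\end{cases}$$ Furthermore, for every $\vec{x}\in X_{\alpha,m}$, the mapping $t\mapsto\vec{u}(t)$, $t\ge0$, can be extended to the whole complex plane (the extension being denoted by the same symbol), and the following holds: (i) The mapping $z\mapsto\vec{u}(z)$, $z\in\mathbb{C}\setminus(-\infty,0]$, is analytic. (ii) The mapping $z\mapsto\vec{u}(z)$, $z\in\mathbb{C}$, is entire provided that $\alpha\in\mathbb{N}$.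
   Context: $\mathbb{C}^{m,m}$ is the ring of $m\times m$ complex matrices. For $\eta=(\eta_1,\dots,\eta_n)\in\mathbb{N}_0^n$, $A=(A_1,\dots,A_n)$ and $A^\eta:=A_1^{\eta_1}\cdots A_n^{\eta_n}$. For a polynomial matrix $P(x)=\sum_{|\eta|\le d}P_\eta x^\eta$, $P_\eta\in\mathbb{C}^{m,m}$, the operator $P(A):=\sum_{|\eta|\le d}P_\eta A^\eta$ acts on $X^m$ (with its natural domain); it is closable and $\overline{P(A)}$ denotes its closure. Caputo derivative: $g_\beta(t):=t^{\beta-1}/\Gamma(\beta)$ for $\beta>0$, $t>0$; $g_0$ is the Dirac delta; $(f*g)(t)=\int_0^tf(t-s)g(s)\,ds$. For $\alpha>0$ and a Banach space $Y$, $\mathbf{D}_t^\alpha u$ is defined for those $u\in C^{\lceil\alpha\rceil-1}([0,\infty):Y)$ for which $g_{\lceil\alpha\rceil-\alpha}*\bigl(u-\sum_{j=0}^{\lceil\alpha\rceil-1}u^{(j)}(0)g_{j+1}\bigr)\in C^{\lceil\alpha\rceil}([0,\infty):Y)$, by $$\mathbf{D}_t^\alpha u(t):=\frac{d^{\lceil\alpha\rceil}}{dt^{\lceil\alpha\rceil}}\Bigl[g_{\lceil\alpha\rceil-\alpha}*\Bigl(u-\sum_{j=0}^{\lceil\alpha\rceil-1}u^{(j)}(0)g_{j+1}\Bigr)\Bigr].$$ A solution of the Cauchy problem is a function $\vec{u}\in C([0,\infty):X^m)$ such that $\mathbf{D}_t^\alpha\vec{u}$ is well defined, $\vec{u}(t)\in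 D(\overline{P_1(A)})\cap D(\overline{P_2(A)})$ and $\mathbf{D}_t^\alpha\vec{u}(t)\in D(\overline{P_2(A)})$ for all $t\ge0$, $\mathbf{D}_t^\alpha\overline{P_2(A)}\vec{u}(t)$ is well defined, and the stated equalities and initial conditions hold. *)

theory Defs
  imports "HOL-Analysis.Analysis"
begin

section \<open>Complex Banach spaces\<close>

text \<open>The norm and the real structure are those of the class \<^class>\<open>banach\<close>; the complex scalar
  multiplication extends the real one. Taking \<open>r = 1\<close> in \<open>scaleC_of_real\<close> gives \<open>1 \<cdot> x = x\<close>.\<close>

class complex_banach = banach +
  fixes scaleC :: "complex \<Rightarrow> 'a \<Rightarrow> 'a"  (infixr "*\<^sub>C" 75)
  assumes scaleC_add_right: "c *\<^sub>C (x + y) = c *\<^sub>C x + c *\<^sub>C y"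
    and scaleC_add_left: "(b + c) *\<^sub>C x = b *\<^sub>C x + c *\<^sub>C x"
    and scaleC_scaleC: "b *\<^sub>C c *\<^sub>C x = (b * c) *\<^sub>C x"
    and scaleC_of_real: "complex_of_real r *\<^sub>C x = r *\<^sub>R x"
    and norm_scaleC: "norm (c *\<^sub>C x) = cmod c * norm x"

text \<open>\<open>X\<^sup>m\<close> is the type \<open>'a ^ 'm\<close>, with the library's (Euclidean) product norm.\<close>

instantiation vec :: (complex_banach, finite) complex_banach
begin

definition scaleC_vec :: "complex \<Rightarrow> 'a ^ 'b \<Rightarrow> 'a ^ 'b" where
  "scaleC_vec c v = (\<chi> i. c *\<^sub>C (v $ i))"

instance
proof
  fix b c :: complex and r :: real and x y :: "'a ^ 'b"
  show "c *\<^sub>C (x + y) = c *\<^sub>C x + c *\<^sub>C y"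
    by (simp add: scaleC_vec_def vec_eq_iff scaleC_add_right)
  show "(b + c) *\<^sub>C x = b *\<^sub>C x + c *\<^sub>C x"
    by (simp add: scaleC_vec_def vec_eq_iff scaleC_add_left)
  show "b *\<^sub>C c *\<^sub>C x = (b * c) *\<^sub>C x"
    by (simp add: scaleC_vec_def vec_eq_iff scaleC_scaleC)
  show "complex_of_real r *\<^sub>C x = r *\<^sub>R x"
    by (simp add: scaleC_vec_def vec_eq_iff scaleC_of_real)
  show "norm (c *\<^sub>C x) = cmod c * norm x"
    by (simp add: scaleC_vec_def norm_vec_def norm_scaleC L2_set_right_distrib)
qed

end

text \<open>This is \<^const>\<open>holomorphic_on\<close> for Banach space valued functions: on an open set it is
  analyticity.\<close>

definition vec_holomorphic_on :: "(complex \<Rightarrow> 'a::complex_banach) \<Rightarrow> complex set \<Rightarrow> bool" where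
  "vec_holomorphic_on f S \<longleftrightarrow>
     (\<forall>z\<in>S. \<exists>D. (f has_derivative (\<lambda>h. h *\<^sub>C D)) (at z within S))"

section \<open>Unbounded operators\<close>

text \<open>An unbounded operator is identified with its graph. Its domain is \<^const>\<open>Domain\<close>, the closure
  of a closable operator is the topological \<^const>\<open>closure\<close> of its graph, and the product \<open>A B\<close>
  (\<open>B\<close> is applied first) is the relational composition \<open>B O A\<close>.\<close>

definition op_app :: "('a \<times> 'b) set \<Rightarrow> 'a \<Rightarrow> 'b" where
  "op_app T x = (THE y. (x, y) \<in> T)"

definition op_scaleC :: "complex \<Rightarrow> ('a \<times> 'b::complex_banach) set \<Rightarrow> ('a \<times> 'b) set" where
  "op_scaleC c T = {(x, c *\<^sub>C y) | x y. (x, y) \<in> T}"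

definition bounded_C0_group :: "(real \<Rightarrow> 'a::complex_banach \<Rightarrow> 'a) \<Rightarrow> bool" where
  "bounded_C0_group T \<longleftrightarrow>
     (\<forall>t. bounded_linear (T t)) \<and>
     (\<forall>t c x. T t (c *\<^sub>C x) = c *\<^sub>C T t x) \<and>
     (\<forall>x. T 0 x = x) \<and>
     (\<forall>s t x. T (s + t) x = T s (T t x)) \<and>
     (\<forall>x. ((\<lambda>t. T t x) \<longlongrightarrow> x) (at 0)) \<and>
     (\<exists>M. \<forall>t x. norm (T t x) \<le> M * norm x)"

definition group_generator :: "(real \<Rightarrow> 'a::complex_banach \<Rightarrow> 'a) \<Rightarrow> ('a \<times> 'a) set" where
  "group_generator T = {(x, y). ((\<lambda>h. (T h x - x) /\<^sub>R h) \<longlongrightarrow> y) (at 0)}"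

text \<open>Generators commute when the groups they generate commute (equivalently, their resolvents
  commute).\<close>

definition commuting_bounded_group_generators :: "('n \<Rightarrow> ('a::complex_banach \<times> 'a) set) \<Rightarrow> bool" where
  "commuting_bounded_group_generators B \<longleftrightarrow>
     (\<exists>T. (\<forall>j. bounded_C0_group (T j) \<and> B j = group_generator (T j)) \<and>
          (\<forall>j k s t x. T j s (T k t x) = T k t (T j s x)))"

section \<open>Polynomial matrices\<close>

text \<open>The coordinates \<open>1, \<dots>, n\<close> are the elements of a finite linearly ordered type \<open>'n\<close>. A polynomial
  matrix of degree at most \<open>d\<close> is given by its coefficients \<open>P \<eta>\<close>; those with \<open>\<bar>\<eta>\<bar> > d\<close> are not used.\<close>

definition multi_indices :: "nat \<Rightarrow> ('n::finite \<Rightarrow> nat) set" where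
  "multi_indices d = {\<eta>. (\<Sum>j\<in>UNIV. \<eta> j) \<le> d}"

definition poly_matrix ::
    "nat \<Rightarrow> (('n::finite \<Rightarrow> nat) \<Rightarrow> complex ^ 'm ^ 'm) \<Rightarrow> real ^ 'n \<Rightarrow> complex ^ 'm ^ 'm" where
  "poly_matrix d P x = (\<Sum>\<eta>\<in>multi_indices d. (\<Prod>j\<in>UNIV. (x $ j) ^ \<eta> j) *\<^sub>R P \<eta>)"

definition matrix_app :: "complex ^ 'm ^ 'm \<Rightarrow> 'a::complex_banach ^ 'm \<Rightarrow> 'a ^ 'm" where
  "matrix_app M v = (\<chi> i. \<Sum>k\<in>UNIV. (M $ i $ k) *\<^sub>C (v $ k))"

text \<open>\<open>A\<^sub>1\<^bsup>\<eta> 1\<^esup> \<cdots> A\<^sub>n\<^bsup>\<eta> n\<^esup>\<close>, the factor with the largest index being applied first: the fold builds the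
  graph \<open>A\<^sub>n\<^bsup>\<eta> n\<^esup> O \<cdots> O A\<^sub>1\<^bsup>\<eta> 1\<^esup>\<close>.\<close>

definition op_monomial ::
    "('n::{finite,linorder} \<Rightarrow> ('a \<times> 'a) set) \<Rightarrow> ('n \<Rightarrow> nat) \<Rightarrow> ('a \<times> 'a) set" where
  "op_monomial A \<eta> = fold (\<lambda>j R. (A j ^^ \<eta> j) O R) (sorted_list_of_set UNIV) Id"

text \<open>The sum of the operators \<open>P\<^sub>\<eta> A\<^sup>\<eta>\<close> on \<open>X\<^sup>m\<close>, on the intersection of the domains \<open>D(A\<^sup>\<eta>)\<^sup>m\<close>;
  \<open>w \<eta>\<close> is the value of \<open>A\<^sup>\<eta>\<close>, acting componentwise, at \<open>v\<close>.\<close>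

definition op_poly ::
    "nat \<Rightarrow> (('n::{finite,linorder} \<Rightarrow> nat) \<Rightarrow> complex ^ 'm ^ 'm) \<Rightarrow>
     ('n \<Rightarrow> ('a::complex_banach \<times> 'a) set) \<Rightarrow> (('a ^ 'm) \<times> ('a ^ 'm)) set" where
  "op_poly d P A =
     {(v, \<Sum>\<eta>\<in>multi_indices d. matrix_app (P \<eta>) (w \<eta>)) | v w.
        \<forall>\<eta>\<in>multi_indices d. \<forall>k. (v $ k, w \<eta> $ k) \<in> op_monomial A \<eta>}"

section \<open>The Caputo derivative\<close>

text \<open>Derivatives of functions on \<open>[0,\<infinity>)\<close>, one-sided at \<open>0\<close>; only values at nonnegative arguments
  matter.\<close>

primrec nderiv :: "nat \<Rightarrow> (real \<Rightarrow> 'b::real_normed_vector) \<Rightarrow> real \<Rightarrow> 'b" where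
  "nderiv 0 u = u"
| "nderiv (Suc k) u = (\<lambda>t. vector_derivative (nderiv k u) (at t within {0..}))"

definition C_k :: "nat \<Rightarrow> (real \<Rightarrow> 'b::real_normed_vector) \<Rightarrow> bool" where
  "C_k k u \<longleftrightarrow>
     (\<forall>j<k. \<forall>t\<ge>0. nderiv j u differentiable (at t within {0..})) \<and>
     continuous_on {0..} (nderiv k u)"

text \<open>For \<open>\<beta> = 1\<close> the value \<open>1\<close> is given separately, because \<open>0 powr 0 = 0\<close> in the library, whereas
  \<open>g\<^sub>1\<close> has to be continuous at \<open>0\<close>.\<close>

definition g_fun :: "real \<Rightarrow> real \<Rightarrow> real" where
  "g_fun \<beta> t = (if \<beta> = 1 then 1 else t powr (\<beta> - 1) / Gamma \<beta>)"

text \<open>\<open>g\<^sub>\<beta> * f\<close>, where \<open>g\<^sub>0\<close> is the Dirac delta. The Henstock--Kurzweil integral is used since the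
  library's Bochner integral is restricted to separable spaces.\<close>

definition g_conv :: "real \<Rightarrow> (real \<Rightarrow> 'b::banach) \<Rightarrow> real \<Rightarrow> 'b" where
  "g_conv \<beta> f t = (if \<beta> = 0 then f t else integral {0..t} (\<lambda>s. g_fun \<beta> (t - s) *\<^sub>R f s))"

definition caputo_primitive :: "real \<Rightarrow> (real \<Rightarrow> 'b::banach) \<Rightarrow> real \<Rightarrow> 'b" where
  "caputo_primitive \<alpha> u =
     g_conv (of_int \<lceil>\<alpha>\<rceil> - \<alpha>) (\<lambda>t. u t - (\<Sum>j<nat \<lceil>\<alpha>\<rceil>. g_fun (real j + 1) t *\<^sub>R nderiv j u 0))"

definition caputo_defined :: "real \<Rightarrow> (real \<Rightarrow> 'b::banach) \<Rightarrow> bool" where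
  "caputo_defined \<alpha> u \<longleftrightarrow> C_k (nat \<lceil>\<alpha>\<rceil> - 1) u \<and> C_k (nat \<lceil>\<alpha>\<rceil>) (caputo_primitive \<alpha> u)"

definition caputo :: "real \<Rightarrow> (real \<Rightarrow> 'b::banach) \<Rightarrow> real \<Rightarrow> 'b" where
  "caputo \<alpha> u = nderiv (nat \<lceil>\<alpha>\<rceil>) (caputo_primitive \<alpha> u)"

section \<open>The Cauchy problem\<close>

text \<open>Here \<open>Q\<^sub>1\<close> and \<open>Q\<^sub>2\<close> are the closures of \<open>P\<^sub>1(A)\<close> and \<open>P\<^sub>2(A)\<close>.\<close>

definition cauchy_solution ::
    "real \<Rightarrow> ('b::banach \<times> 'b) set \<Rightarrow> ('b \<times> 'b) set \<Rightarrow> 'b \<Rightarrow> (real \<Rightarrow> 'b) \<Rightarrow> bool" where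
  "cauchy_solution \<alpha> Q\<^sub>1 Q\<^sub>2 x u \<longleftrightarrow>
     continuous_on {0..} u \<and>
     caputo_defined \<alpha> u \<and>
     (\<forall>t\<ge>0. u t \<in> Domain Q\<^sub>1 \<inter> Domain Q\<^sub>2 \<and> caputo \<alpha> u t \<in> Domain Q\<^sub>2) \<and>
     caputo_defined \<alpha> (\<lambda>t. op_app Q\<^sub>2 (u t)) \<and>
     (\<forall>t\<ge>0. caputo \<alpha> (\<lambda>s. op_app Q\<^sub>2 (u s)) t = op_app Q\<^sub>2 (caputo \<alpha> u t) \<and>
            op_app Q\<^sub>2 (caputo \<alpha> u t) = op_app Q\<^sub>1 (u t)) \<and>
     u 0 = x \<and>
     (\<forall>j\<in>{1..nat \<lceil>\<alpha>\<rceil> - 1}. nderiv j u 0 = 0)"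

end

theory Submission
  imports Defs "HOL-Probability.Discrete_Topology"
begin

text \<open>
Formally the solution is \<open>u(t) = E\<^sub>\<alpha>(t\<^sup>\<alpha> B) v\<close> with the Mittag-Leffler function \<open>E\<^sub>\<alpha>\<close> and
\<open>B = P\<^sub>2(A)\<^sup>-\<^sup>1 P\<^sub>1(A)\<close>. The operator \<open>B\<close> is unbounded, and nothing is known about the growth of
\<open>P\<^sub>2(x)\<^sup>-\<^sup>1\<close> for large \<open>x \<in> \<real>\<^sup>n\<close>. On the part of the space where \<open>A\<close> takes its values in a bounded set,
however, \<open>B\<close> acts as a bounded operator, the series converges, and such vectors are dense.

The cutoffs are explicit. For one group \<open>T \<xi> = exp (\<i> \<xi> A)\<close> the hat function on \<open>[a, a + 2 r]\<close> times
\<open>((x - a) / r)\<^sup>N\<close> has an integrable Fourier transform \<open>hat_kernel\<close>, and averaging the group against it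
gives a bounded operator \<open>band a r N\<close> with \<open>A (band a r N) = a (band a r N) + r (band a r (N + 1))\<close>.
The products over the \<open>n\<close> groups (\<open>band_product\<close>) cut out boxes in \<open>\<real>\<^sup>n\<close>. The family of all these
products applied to a vector, with weights that make it bounded (\<open>moments\<close>), turns the unbounded
operator \<open>A\<^sub>j\<close> into a bounded shift on a Banach space of families, and over a small box near \<open>b\<close> the
shift differs little from the number \<open>b\<^sub>j\<close>. There \<open>P\<^sub>2(A)\<close> is a small perturbation of the invertible
matrix \<open>P\<^sub>2(b)\<close>, so \<open>P\<^sub>2(A) z = P\<^sub>1(A) y\<close> is solvable with a bound (\<open>shift_poly_invertible\<close>). A component
\<open>v\<close> in a small box is therefore a chain vector: there are \<open>X 0 = v\<close>, \<open>X 1\<close>, \<open>X 2\<close>, \<open>\<dots>\<close> of geometric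
growth with \<open>P\<^sub>2(A) (X (k + 1)) = P\<^sub>1(A) (X k)\<close>.

A hat function is a combination of three hat functions of half the width. By bisection
(\<open>band_product_local_to_global\<close>), a linear condition that the components of a vector satisfy in all small
boxes around each point holds for its components in all boxes. Hence all components in boxes are chain
vectors, and since the components in growing boxes, normalised, converge to the vector itself, chain
vectors are dense.

For a chain vector the series with the terms \<open>g\<^bsub>\<alpha>k+1\<^esub>(t) X k\<close> is a solution, because the Caputo
derivative shifts its coefficients (\<open>caputo_mittag_leffler\<close>) and closed operators act on it term by
term. It is a power series in \<open>t\<^sup>\<alpha>\<close> of infinite radius, which gives the analytic extension. As to
uniqueness, the difference of two solutions satisfies a fractional integral equation
(\<open>caputo_integral_equation\<close>). In a small box its moments satisfy an equation with bounded operators and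
vanish by a Gronwall argument (\<open>fractional_Gronwall\<close>), bisection extends this to all boxes, and wide boxes show
that the difference is zero. The matrix case is the scalar one on the space \<open>X\<^sup>m\<close>, the
coefficients being bounded operators that commute with the groups.
\<close>

section \<open>Fractional integrals of continuous Banach space valued functions\<close>

lemma Gamma_real_nonzero: "(x::real) > 0 \<Longrightarrow> Gamma x \<noteq> 0"
  by (drule Gamma_real_pos) simp

text \<open>Substituting \<open>s = t (1 - p powr (1/\<beta>))\<close> removes the singularity of the kernel: the fractional
  integral becomes an integral of a continuous function over a fixed interval.\<close>

lemma g_conv_has_integral:
  fixes f :: "real \<Rightarrow> 'b::banach"
  assumes \<beta>: "\<beta> > 0" and t: "t \<ge> 0" and f: "continuous_on {0..t} f"
  shows "((\<lambda>s. g_fun \<beta> (t - s) *\<^sub>R f s) has_integral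
          (t powr \<beta> / Gamma (\<beta> + 1)) *\<^sub>R integral {0..1} (\<lambda>p. f (t * (1 - p powr (1/\<beta>))))) {0..t}"
proof (cases "t = 0")
  case True
  then show ?thesis using \<beta> by (auto simp: has_integral_refl)
next
  case False
  with t have t: "t > 0" by simp
  define \<phi> where "\<phi> = (\<lambda>p. f (t * (1 - p powr (1/\<beta>))))"
  have cont_p: "continuous_on {0..1} (\<lambda>p::real. t * (1 - p powr (1/\<beta>)))"
    using \<beta> by (intro continuous_intros continuous_on_powr') auto
  have range: "t * (1 - p powr (1/\<beta>)) \<in> {0..t}" if "p \<in> {0..1}" for p
  proof -
    have "p powr (1/\<beta>) \<le> 1" using that \<beta> by (intro powr_le1) auto
    then show ?thesis using t by (auto simp: mult_le_cancel_left1)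
  qed
  have \<phi>: "continuous_on {0..1} \<phi>" unfolding \<phi>_def
    by (rule continuous_on_compose2[OF f cont_p]) (use range in auto)
  define I where "I q = integral {0..q} \<phi>" for q
  have I': "(I has_vector_derivative \<phi> q) (at q within {0..1})" if "q \<in> {0..1}" for q
    unfolding I_def by (rule integral_has_vector_derivative[OF \<phi> that])
  define q where "q s = ((t - s) / t) powr \<beta>" for s
  define c where "c = t powr \<beta> / Gamma (\<beta> + 1)"
  define H where "H s = - (c *\<^sub>R I (q s))" for s
  have q01: "q s \<in> {0..1}" if "s \<in> {0..t}" for s
    using that t \<beta> by (auto simp: q_def intro!: powr_le1)
  have contI: "continuous_on {0..1} I"
    using I' by (meson has_vector_derivative_continuous continuous_on_eq_continuous_within)
  have "continuous_on {0..t} q" unfolding q_def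
    using \<beta> t by (intro continuous_intros continuous_on_powr') auto
  then have contH: "continuous_on {0..t} H" unfolding H_def
    by (intro continuous_intros continuous_on_compose2[OF contI]) (use q01 in auto)
  have derH: "(H has_vector_derivative g_fun \<beta> (t - s) *\<^sub>R f s) (at s)" if s: "s \<in> {0<..<t}" for s
  proof -
    have qs: "q s \<in> {0<..<1}"
      using s t \<beta> powr_less_mono2[of \<beta> "(t - s) / t" 1] by (auto simp: q_def)
    have "at (q s) within {0..1} = at (q s)"
      using qs by (intro at_within_interior) auto
    then have I1: "(I has_vector_derivative \<phi> (q s)) (at (q s))"
      using I'[of "q s"] qs by auto
    have q1: "(q has_real_derivative - \<beta> / t * ((t - s) / t) powr (\<beta> - 1)) (at s)"
      unfolding q_def using s t by (auto intro!: derivative_eq_intros simp: field_simps)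
    have "(I \<circ> q has_vector_derivative (- \<beta> / t * ((t - s) / t) powr (\<beta> - 1)) *\<^sub>R \<phi> (q s)) (at s)"
      by (rule vector_diff_chain_at[where f = q and g = I, rotated, OF I1])
         (use q1 in \<open>simp add: has_real_derivative_iff_has_vector_derivative\<close>)
    then have H1: "(H has_vector_derivative - (c *\<^sub>R (- \<beta> / t * ((t - s) / t) powr (\<beta> - 1)) *\<^sub>R \<phi> (q s))) (at s)"
      unfolding H_def o_def by (intro derivative_eq_intros) auto
    have "q s powr (1/\<beta>) = (t - s) / t"
      using \<beta> s t by (simp add: q_def powr_powr)
    then have \<phi>q: "\<phi> (q s) = f s" using t by (simp add: \<phi>_def diff_divide_distrib)
    have "Gamma (\<beta> + 1) = \<beta> * Gamma \<beta>"
      using \<beta> by (intro Gamma_plus1) auto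
    moreover have "t powr \<beta> = t * t powr (\<beta> - 1)" using t by (simp add: powr_diff)
    moreover have "Gamma \<beta> > 0" using \<beta> by (rule Gamma_real_pos)
    ultimately have "c * (\<beta> / t * ((t - s) / t) powr (\<beta> - 1)) = (t - s) powr (\<beta> - 1) / Gamma \<beta>"
      using \<beta> s t by (simp add: c_def powr_divide field_simps)
    also have "\<dots> = g_fun \<beta> (t - s)"
      using s by (auto simp: g_fun_def)
    finally show ?thesis using H1 \<phi>q by simp
  qed
  have "((\<lambda>s. g_fun \<beta> (t - s) *\<^sub>R f s) has_integral (H t - H 0)) {0..t}"
    using t by (intro fundamental_theorem_of_calculus_interior contH derH) auto
  moreover have "H t = 0" "H 0 = - (c *\<^sub>R I 1)"
    using t \<beta> by (auto simp: H_def q_def I_def)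
  ultimately show ?thesis by (simp add: c_def I_def \<phi>_def)
qed

lemma g_conv_eq:
  fixes f :: "real \<Rightarrow> 'b::banach"
  assumes "\<beta> > 0" "t \<ge> 0" "continuous_on {0..t} f"
  shows "g_conv \<beta> f t =
    (t powr \<beta> / Gamma (\<beta> + 1)) *\<^sub>R integral {0..1} (\<lambda>p. f (t * (1 - p powr (1/\<beta>))))"
  using g_conv_has_integral[OF assms] assms(1) by (auto simp: g_conv_def intro: integral_unique)

lemma substitution_in_interval:
  fixes \<beta> :: real
  assumes "\<beta> > 0" "t \<ge> 0" "p \<in> {0..1}"
  shows "t * (1 - p powr (1/\<beta>)) \<in> {0..t}"
proof -
  have "p powr (1/\<beta>) \<le> 1" using assms(1,3) powr_le1[of "1/\<beta>" p] by simp
  then show ?thesis using assms by (auto intro: mult_left_le mult_nonneg_nonneg)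
qed

lemma continuous_on_substitution:
  fixes f :: "real \<Rightarrow> 'b::banach"
  assumes "\<beta> > 0" "t \<ge> 0" "continuous_on {0..t} f"
  shows "continuous_on {0..1} (\<lambda>p. f (t * (1 - p powr (1/\<beta>))))"
  by (rule continuous_on_compose2[OF assms(3)])
     (use assms substitution_in_interval[OF assms(1,2)] in
       \<open>auto intro!: continuous_intros continuous_on_powr'\<close>)

lemma g_conv_cong:
  assumes "\<And>s. 0 \<le> s \<Longrightarrow> s \<le> t \<Longrightarrow> f s = h s" "t \<ge> 0"
  shows "g_conv \<beta> f t = g_conv \<beta> h t"
  using assms by (auto simp: g_conv_def intro!: integral_cong)

lemma g_conv_bounded_linear:
  fixes f :: "real \<Rightarrow> 'b::banach" and L :: "'b \<Rightarrow> 'c::banach"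
  assumes "\<beta> \<ge> 0" "t \<ge> 0" "continuous_on {0..t} f" "bounded_linear L"
  shows "g_conv \<beta> (\<lambda>s. L (f s)) t = L (g_conv \<beta> f t)"
proof (cases "\<beta> = 0")
  case False
  interpret L: bounded_linear L by fact
  from False assms have \<beta>: "\<beta> > 0" by simp
  have "L \<circ> (\<lambda>s. g_fun \<beta> (t - s) *\<^sub>R f s) = (\<lambda>s. g_fun \<beta> (t - s) *\<^sub>R L (f s))"
    by (auto simp: L.scaleR)
  then show ?thesis
    using integral_linear[OF has_integral_integrable[OF g_conv_has_integral[OF \<beta> assms(2,3)]] assms(4)] False
    by (simp add: g_conv_def)
qed (simp add: g_conv_def)

lemma g_conv_diff:
  fixes f h :: "real \<Rightarrow> 'b::banach"
  assumes "\<beta> > 0" "t \<ge> 0" "continuous_on {0..t} f" "continuous_on {0..t} h"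
  shows "g_conv \<beta> (\<lambda>s. f s - h s) t = g_conv \<beta> f t - g_conv \<beta> h t"
  using assms
  by (simp add: g_conv_eq continuous_on_diff integral_diff integrable_continuous_interval
      continuous_on_substitution scaleR_diff_right)

lemma g_conv_sum:
  fixes f :: "'i \<Rightarrow> real \<Rightarrow> 'b::banach"
  assumes "\<beta> > 0" "t \<ge> 0" "finite I" "\<And>i. i \<in> I \<Longrightarrow> continuous_on {0..t} (f i)"
  shows "g_conv \<beta> (\<lambda>s. \<Sum>i\<in>I. f i s) t = (\<Sum>i\<in>I. g_conv \<beta> (f i) t)"
  using assms
  by (simp add: g_conv_eq continuous_on_sum integral_sum integrable_continuous_interval
      continuous_on_substitution scaleR_sum_right)

lemma norm_g_conv_le_g_conv:
  fixes f :: "real \<Rightarrow> 'b::banach"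
  assumes "\<beta> > 0" "t \<ge> 0" "continuous_on {0..t} f" "continuous_on {0..t} h"
    and "\<And>s. 0 \<le> s \<Longrightarrow> s \<le> t \<Longrightarrow> norm (f s) \<le> h s"
  shows "norm (g_conv \<beta> f t) \<le> g_conv \<beta> h t"
proof -
  have "norm (integral {0..1} (\<lambda>p. f (t * (1 - p powr (1/\<beta>)))))
     \<le> integral {0..1} (\<lambda>p. h (t * (1 - p powr (1/\<beta>))))"
    using assms substitution_in_interval[OF assms(1,2)]
    by (intro integral_norm_bound_integral integrable_continuous_interval continuous_on_substitution) auto
  moreover have "t powr \<beta> / Gamma (\<beta> + 1) \<ge> 0" using assms(1) by (simp add: Gamma_real_nonneg)
  ultimately show ?thesis using assms
    by (simp add: g_conv_eq mult_left_mono abs_mult del: times_divide_eq_left)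
qed

lemma norm_g_conv_le:
  fixes f :: "real \<Rightarrow> 'b::banach"
  assumes "\<beta> > 0" "t \<ge> 0" "continuous_on {0..t} f"
    and "\<And>s. 0 \<le> s \<Longrightarrow> s \<le> t \<Longrightarrow> norm (f s) \<le> B"
  shows "norm (g_conv \<beta> f t) \<le> t powr \<beta> / Gamma (\<beta> + 1) * B"
  using norm_g_conv_le_g_conv[of \<beta> t f "\<lambda>_. B"] assms by (simp add: g_conv_eq)

lemma continuous_on_g_conv:
  fixes f :: "real \<Rightarrow> 'b::banach"
  assumes "\<beta> > 0" and f: "continuous_on {0..} f"
  shows "continuous_on {0..} (g_conv \<beta> f)"
proof -
  have sub: "continuous_on ({0..} \<times> cbox 0 1) (\<lambda>(t,p). f (t * (1 - p powr (1/\<beta>))))"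
    unfolding case_prod_unfold
    by (rule continuous_on_compose2[OF f])
       (use assms substitution_in_interval[OF assms(1)] in
       \<open>auto intro!: continuous_intros continuous_on_powr'\<close>)
  have "Gamma (\<beta> + 1) \<noteq> 0" using assms by (intro Gamma_real_nonzero) auto
  then have "continuous_on {0..} (\<lambda>t. (t powr \<beta> / Gamma (\<beta> + 1)) *\<^sub>R
      integral (cbox 0 1) (\<lambda>p. f (t * (1 - p powr (1/\<beta>)))))"
    using assms(1)
    by (intro continuous_intros continuous_on_powr' integral_continuous_on_param[OF sub]) auto
  then show ?thesis
    by (rule continuous_on_eq) (use assms(1) continuous_on_subset[OF f] in \<open>auto simp: g_conv_eq\<close>)
qed

lemma g_fun_pos: "\<lbrakk>\<gamma> \<ge> 0; t \<ge> 0\<rbrakk> \<Longrightarrow> g_fun (\<gamma> + 1) t \<ge> 0"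
  by (auto simp: g_fun_def Gamma_real_nonneg)

lemma continuous_on_g_fun: "\<gamma> \<ge> 0 \<Longrightarrow> continuous_on {0..} (g_fun (\<gamma> + 1))"
proof -
  assume "\<gamma> \<ge> 0"
  then have "Gamma (\<gamma> + 1) \<noteq> 0" by (intro Gamma_real_nonzero) auto
  then show ?thesis unfolding g_fun_def using \<open>\<gamma> \<ge> 0\<close>
    by (cases "\<gamma> = 0") (auto intro!: continuous_intros continuous_on_powr')
qed

text \<open>The semigroup law on powers is the Beta integral; only \<open>t = 1\<close> needs it, because both sides
  are homogeneous in \<open>t\<close>.\<close>

lemma g_conv_g_fun_real:
  assumes \<beta>: "\<beta> > 0" and \<gamma>: "\<gamma> \<ge> 0" and t: "t \<ge> 0"
  shows "g_conv \<beta> (g_fun (\<gamma> + 1)) t = g_fun (\<gamma> + \<beta> + 1) t"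
proof -
  define J where "J = integral {0..1} (\<lambda>p. (if \<gamma> = 0 then 1 else (1 - p powr (1/\<beta>)) powr \<gamma>))"
  have *: "g_conv \<beta> (g_fun (\<gamma> + 1)) t = J / (Gamma (\<beta> + 1) * Gamma (\<gamma> + 1)) * t powr (\<gamma> + \<beta>)"
    if t: "t \<ge> 0" for t
  proof -
    have "integral {0..1} (\<lambda>p. g_fun (\<gamma> + 1) (t * (1 - p powr (1/\<beta>))))
      = integral {0..1} (\<lambda>p. (if \<gamma> = 0 then 1 else t powr \<gamma>) / Gamma (\<gamma> + 1) *
            (if \<gamma> = 0 then 1 else (1 - p powr (1/\<beta>)) powr \<gamma>))"
      using t \<beta> powr_le1[of "1/\<beta>"] by (intro integral_cong) (auto simp: g_fun_def powr_mult)
    also have "\<dots> = (if \<gamma> = 0 then 1 else t powr \<gamma>) / Gamma (\<gamma> + 1) * J"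
      unfolding J_def by (rule integral_mult_right)
    finally show ?thesis using t \<beta> \<gamma>
      by (subst g_conv_eq) (auto simp: powr_add intro: continuous_on_subset[OF continuous_on_g_fun])
  qed
  have "((\<lambda>s. 1 / (Gamma (\<gamma> + 1) * Gamma \<beta>) * (s powr (\<gamma> + 1 - 1) * (1 - s) powr (\<beta> - 1))) has_integral
          1 / (Gamma (\<gamma> + 1) * Gamma \<beta>) * Beta (\<gamma> + 1) \<beta>) {0..1}"
    using \<beta> \<gamma> by (intro has_integral_mult_right has_integral_Beta_real) auto
  then have "((\<lambda>s. g_fun \<beta> (1 - s) *\<^sub>R g_fun (\<gamma> + 1) s) has_integral
      1 / (Gamma (\<gamma> + 1) * Gamma \<beta>) * Beta (\<gamma> + 1) \<beta>) {0..1}"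
    by (rule has_integral_spike_finite[of "{0,1}", rotated 2]) (auto simp: g_fun_def mult.commute)
  moreover have "1 / (Gamma (\<gamma> + 1) * Gamma \<beta>) * Beta (\<gamma> + 1) \<beta> = 1 / Gamma (\<gamma> + \<beta> + 1)"
    using \<beta> \<gamma> Gamma_real_nonzero[of "\<gamma> + 1"] Gamma_real_nonzero[of \<beta>]
    by (simp add: Beta_def add_ac)
  ultimately have "((\<lambda>s. g_fun \<beta> (1 - s) *\<^sub>R g_fun (\<gamma> + 1) s) has_integral
      1 / Gamma (\<gamma> + \<beta> + 1)) {0..1}" by simp
  then have "g_conv \<beta> (g_fun (\<gamma> + 1)) 1 = 1 / Gamma (\<gamma> + \<beta> + 1)"
    using \<beta> by (auto simp: g_conv_def intro: integral_unique)
  with *[of 1] have "J / (Gamma (\<beta> + 1) * Gamma (\<gamma> + 1)) = 1 / Gamma (\<gamma> + \<beta> + 1)"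
    by simp
  with *[OF t] show ?thesis using \<beta> \<gamma> by (simp add: g_fun_def)
qed

lemma g_conv_g_fun:
  fixes v :: "'b::banach"
  assumes "\<beta> > 0" "\<gamma> \<ge> 0" "t \<ge> 0"
  shows "g_conv \<beta> (\<lambda>s. g_fun (\<gamma> + 1) s *\<^sub>R v) t = g_fun (\<gamma> + \<beta> + 1) t *\<^sub>R v"
  using g_conv_bounded_linear[OF _ _ _ bounded_linear_scaleR_left, of \<beta> t "g_fun (\<gamma> + 1)" v]
    assms g_conv_g_fun_real[OF assms] continuous_on_subset[OF continuous_on_g_fun, of \<gamma> "{0..t}"]
  by simp

lemma power_eq_g_fun: "s \<ge> 0 \<Longrightarrow> s ^ i = fact i * g_fun (real i + 1) s"
proof -
  assume "s \<ge> 0"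
  have "Gamma (1 + real i) = fact i" by (rule Gamma_fact)
  then show ?thesis using \<open>s \<ge> 0\<close>
    by (cases "i = 0"; cases "s = 0") (auto simp: g_fun_def powr_realpow add.commute)
qed

section \<open>The semigroup law of the fractional integrals\<close>

text \<open>Bernstein's proof carries over to values in any normed space: the variance \<open>x (1 - x) / n\<close> of the
  binomial distribution controls the contribution of the nodes far from \<open>x\<close>.\<close>

lemma Bernstein_Weierstrass_banach:
  fixes f :: "real \<Rightarrow> 'b::real_normed_vector"
  assumes f: "continuous_on {0..1} f" and e: "e > 0"
  obtains n where "\<And>x. x \<in> {0..1} \<Longrightarrow> norm (f x - (\<Sum>k\<le>n. Bernstein n k x *\<^sub>R f (real k / real n))) \<le> e"
proof -
  have "bounded (f ` {0..1})"
    using compact_continuous_image[OF f] compact_imp_bounded by blast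
  then obtain M where M: "M > 0" "\<And>x. x \<in> {0..1} \<Longrightarrow> norm (f x) \<le> M"
    by (auto simp: bounded_pos)
  have "uniformly_continuous_on {0..1} f"
    using compact_uniformly_continuous[OF f] by blast
  then obtain d where d: "d > 0" "\<And>x y. \<lbrakk>x \<in> {0..1}; y \<in> {0..1}; dist y x < d\<rbrakk> \<Longrightarrow> dist (f y) (f x) < e / 2"
    using e unfolding uniformly_continuous_on_def by (meson half_gt_zero)
  obtain n where n: "real n > 4 * M / (d\<^sup>2 * e)" using reals_Archimedean2 by blast
  have "4 * M / (d\<^sup>2 * e) > 0" using M d e by simp
  with n have n0: "real n > 0" by linarith
  have "norm (f x - (\<Sum>k\<le>n. Bernstein n k x *\<^sub>R f (real k / real n))) \<le> e" if x: "x \<in> {0..1}" for x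
  proof -
    have B: "Bernstein n k x \<ge> 0" for k using x by (auto intro: Bernstein_nonneg)
    have var: "(\<Sum>k\<le>n. (x - k / n)\<^sup>2 * Bernstein n k x) \<le> 1 / n"
    proof -
      have "(x - k / n)\<^sup>2 * Bernstein n k x =
          (1 / n\<^sup>2) * (real k * (real k - 1) * Bernstein n k x)
          + ((1 - 2 * n * x) / n\<^sup>2) * (real k * Bernstein n k x) + x\<^sup>2 * Bernstein n k x" for k
        using n0 by (simp add: field_simps power2_eq_square)
      then have "(\<Sum>k\<le>n. (x - k / n)\<^sup>2 * Bernstein n k x) =
          (1 / n\<^sup>2) * (real n * (real n - 1) * x\<^sup>2) + ((1 - 2 * n * x) / n\<^sup>2) * (real n * x) + x\<^sup>2"
        by (simp add: sum.distrib del: times_divide_eq_left flip: sum_distrib_left)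
      also have "\<dots> = x * (1 - x) / n"
        using n0 by (simp add: field_simps power2_eq_square)
      also have "\<dots> \<le> 1 / n"
        using x n0 by (intro divide_right_mono) (auto intro: mult_le_one)
      finally show ?thesis .
    qed
    have close: "norm (f x - f (k / n)) \<le> e / 2 + 2 * M / d\<^sup>2 * (x - k / n)\<^sup>2" if "k \<le> n" for k
    proof -
      have kn: "real k / real n \<in> {0..1}" using that n0 by auto
      show ?thesis
      proof (cases "\<bar>x - k / n\<bar> < d")
        case True
        then have "norm (f x - f (k / n)) < e / 2"
          using d(2)[OF kn x] by (simp add: dist_norm)
        moreover have "2 * M / d\<^sup>2 * (x - k / n)\<^sup>2 \<ge> 0" using M by simp
        ultimately show ?thesis by linarith
      next
        case False
        then have "d\<^sup>2 \<le> (x - k / n)\<^sup>2"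
          using d(1) by (metis abs_le_square_iff abs_of_pos not_less)
        then have "1 \<le> (x - k / n)\<^sup>2 / d\<^sup>2" using d(1) by simp
        then have "2 * M * 1 \<le> 2 * M * ((x - k / n)\<^sup>2 / d\<^sup>2)" using M by (intro mult_left_mono) auto
        moreover have "norm (f x - f (k / n)) \<le> M + M"
          by (rule norm_triangle_le_diff) (use M(2)[OF x] M(2)[OF kn] in auto)
        ultimately show ?thesis using e by simp
      qed
    qed
    have "f x - (\<Sum>k\<le>n. Bernstein n k x *\<^sub>R f (k / n)) = (\<Sum>k\<le>n. Bernstein n k x *\<^sub>R (f x - f (k / n)))"
      by (simp add: scaleR_diff_right sum_subtractf flip: scaleR_left.sum)
    also have "norm \<dots> \<le> (\<Sum>k\<le>n. Bernstein n k x * (e / 2 + 2 * M / d\<^sup>2 * (x - k / n)\<^sup>2))"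
      by (intro sum_norm_le) (use B close in \<open>auto intro!: mult_left_mono\<close>)
    also have "\<dots> = (\<Sum>k\<le>n. (e / 2) * Bernstein n k x + 2 * M / d\<^sup>2 * ((x - k / n)\<^sup>2 * Bernstein n k x))"
      by (intro sum.cong) (auto simp: algebra_simps)
    also have "\<dots> = e / 2 + 2 * M / d\<^sup>2 * (\<Sum>k\<le>n. (x - k / n)\<^sup>2 * Bernstein n k x)"
      by (simp only: sum.distrib sum_Bernstein mult_1_right flip: sum_distrib_left)
    also have "\<dots> \<le> e / 2 + 2 * M / d\<^sup>2 * (1 / n)"
      using var M by (intro add_left_mono mult_left_mono) auto
    also have "\<dots> \<le> e"
      using n n0 d e by (simp add: field_simps)
    finally show ?thesis .
  qed
  then show ?thesis by (rule that)
qed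

lemma g_conv_g_conv_polynomial:
  fixes v :: "'b::banach"
  assumes "a > 0" "b > 0" "t \<ge> 0" "real_polynomial_function q"
  shows "g_conv a (g_conv b (\<lambda>s. q s *\<^sub>R v)) t = g_conv (a + b) (\<lambda>s. q s *\<^sub>R v) t"
proof -
  obtain c N where q: "q = (\<lambda>x. \<Sum>i\<le>N. c i * x ^ i)"
    using assms(4) real_polynomial_function_iff_sum by blast
  let ?m = "\<lambda>i s. g_fun (real i + 1) s *\<^sub>R ((c i * fact i) *\<^sub>R v)"
  have q_eq: "q s *\<^sub>R v = (\<Sum>i\<le>N. ?m i s)" if "s \<ge> 0" for s
    using that by (auto simp: q power_eq_g_fun[OF that] scaleR_left.sum mult_ac intro!: sum.cong)
  have m: "continuous_on {0..s} (?m i)" for i s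
    by (intro continuous_intros continuous_on_subset[OF continuous_on_g_fun]) auto
  have conv: "g_conv \<beta> (\<lambda>s. q s *\<^sub>R v) s = (\<Sum>i\<le>N. g_fun (real i + \<beta> + 1) s *\<^sub>R ((c i * fact i) *\<^sub>R v))"
    if "\<beta> > 0" "s \<ge> 0" for \<beta> s
  proof -
    have "g_conv \<beta> (\<lambda>s. q s *\<^sub>R v) s = g_conv \<beta> (\<lambda>s. \<Sum>i\<le>N. ?m i s) s"
      using that q_eq by (intro g_conv_cong) auto
    also have "\<dots> = (\<Sum>i\<le>N. g_conv \<beta> (?m i) s)"
      by (rule g_conv_sum) (use that m in auto)
    finally show ?thesis using that by (simp add: g_conv_g_fun del: scaleR_scaleR)
  qed
  have "g_conv a (g_conv b (\<lambda>s. q s *\<^sub>R v)) t =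
      g_conv a (\<lambda>s. \<Sum>i\<le>N. g_fun (real i + b + 1) s *\<^sub>R ((c i * fact i) *\<^sub>R v)) t"
    using assms conv by (intro g_conv_cong) auto
  also have "\<dots> = (\<Sum>i\<le>N. g_conv a (\<lambda>s. g_fun (real i + b + 1) s *\<^sub>R ((c i * fact i) *\<^sub>R v)) t)"
    using assms
    by (intro g_conv_sum) (auto intro!: continuous_intros continuous_on_subset[OF continuous_on_g_fun])
  also have "\<dots> = (\<Sum>i\<le>N. g_fun (real i + b + a + 1) t *\<^sub>R ((c i * fact i) *\<^sub>R v))"
    using assms by (intro sum.cong g_conv_g_fun) auto
  also have "\<dots> = g_conv (a + b) (\<lambda>s. q s *\<^sub>R v) t"
    using assms by (simp add: conv add_ac)
  finally show ?thesis .
qed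

text \<open>Both sides depend continuously on \<open>f\<close> in the uniform norm, and on polynomials they agree by the
  Beta integral. This replaces Fubini's theorem for a singular vector valued integrand.\<close>

theorem g_conv_g_conv:
  fixes f :: "real \<Rightarrow> 'b::banach"
  assumes a: "a > 0" and b: "b > 0" and t: "t \<ge> 0" and f: "continuous_on {0..} f"
  shows "g_conv a (g_conv b f) t = g_conv (a + b) f t"
proof (cases "t = 0")
  case True
  have "continuous_on {0..0} g" for g :: "real \<Rightarrow> 'b" by simp
  then show ?thesis using True a b by (simp add: g_conv_eq del: atLeastAtMost_singleton)
next
  case False
  with t have t: "t > 0" by simp
  define K where "K = t powr a / Gamma (a + 1) * (t powr b / Gamma (b + 1)) + t powr (a + b) / Gamma (a + b + 1)"
  have f': "continuous_on {0..s} f" for s by (rule continuous_on_subset[OF f]) auto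
  have bound: "norm (g_conv a (g_conv b f) t - g_conv (a + b) f t) \<le> K * e" if e: "e > 0" for e
  proof -
    have "continuous_on {0..1} (\<lambda>x. f (t * x))"
      by (rule continuous_on_compose2[OF f]) (use t in \<open>auto intro!: continuous_intros\<close>)
    from Bernstein_Weierstrass_banach[OF this e] obtain n where
      n: "\<And>x. x \<in> {0..1} \<Longrightarrow>
          norm (f (t * x) - (\<Sum>k\<le>n. Bernstein n k x *\<^sub>R f (t * (real k / real n)))) \<le> e" by blast
    define p where "p s = (\<Sum>k\<le>n. Bernstein n k (s / t) *\<^sub>R f (t * (real k / real n)))" for s
    have poly: "real_polynomial_function (\<lambda>s. Bernstein n k (s / t))" for k
      unfolding Bernstein_def by (simp add: divide_inverse real_polynomial_function_power
          real_polynomial_function_diff real_polynomial_function.intros bounded_linear_mult_left)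
    have contB: "continuous_on S (\<lambda>s. Bernstein n k (s / t))" for S k
      using t unfolding Bernstein_def by (intro continuous_intros) auto
    have contp: "continuous_on S p" for S
      unfolding p_def by (intro continuous_intros contB)
    have fp: "norm (f s - p s) \<le> e" if "0 \<le> s" "s \<le> t" for s
      using n[of "s / t"] that t by (simp add: p_def)
    have law_p: "g_conv a (g_conv b p) t = g_conv (a + b) p t"
    proof -
      have "g_conv a (g_conv b p) t =
          g_conv a (\<lambda>s. \<Sum>k\<le>n. g_conv b (\<lambda>s. Bernstein n k (s / t) *\<^sub>R f (t * (real k / real n))) s) t"
        using b t unfolding p_def
        by (intro g_conv_cong g_conv_sum) (auto intro!: continuous_intros contB)
      also have "\<dots> = (\<Sum>k\<le>n. g_conv a (g_conv b (\<lambda>s. Bernstein n k (s / t) *\<^sub>R f (t * (real k / real n)))) t)"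
        using a b t by (intro g_conv_sum)
          (auto intro!: continuous_on_subset[OF continuous_on_g_conv] continuous_intros contB)
      also have "\<dots> = (\<Sum>k\<le>n. g_conv (a + b) (\<lambda>s. Bernstein n k (s / t) *\<^sub>R f (t * (real k / real n))) t)"
        using a b t by (intro sum.cong g_conv_g_conv_polynomial poly) auto
      also have "\<dots> = g_conv (a + b) p t"
        unfolding p_def using a b t
        by (intro g_conv_sum[symmetric]) (auto intro!: continuous_intros contB)
      finally show ?thesis .
    qed
    have inner: "norm (g_conv b f s - g_conv b p s) \<le> t powr b / Gamma (b + 1) * e" if s: "0 \<le> s" "s \<le> t" for s
    proof -
      have "norm (g_conv b f s - g_conv b p s) = norm (g_conv b (\<lambda>s. f s - p s) s)"
        using s b f' contp by (simp add: g_conv_diff)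
      also have "\<dots> \<le> s powr b / Gamma (b + 1) * e"
        using s b f' contp fp by (intro norm_g_conv_le continuous_intros) auto
      also have "\<dots> \<le> t powr b / Gamma (b + 1) * e"
        using s b e by (intro mult_right_mono divide_right_mono powr_mono2) (auto simp: Gamma_real_nonneg)
      finally show ?thesis .
    qed
    have cf: "continuous_on {0..t} (g_conv b f)" and cp: "continuous_on {0..t} (g_conv b p)"
      by (auto intro!: continuous_on_subset[OF continuous_on_g_conv] b f contp)
    have "norm (g_conv a (g_conv b f) t - g_conv a (g_conv b p) t)
        = norm (g_conv a (\<lambda>s. g_conv b f s - g_conv b p s) t)"
      using a t cf cp by (simp add: g_conv_diff)
    also have "\<dots> \<le> t powr a / Gamma (a + 1) * (t powr b / Gamma (b + 1) * e)"
      using a t cf cp inner by (intro norm_g_conv_le continuous_intros) auto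
    finally have 1: "norm (g_conv a (g_conv b f) t - g_conv a (g_conv b p) t)
      \<le> t powr a / Gamma (a + 1) * (t powr b / Gamma (b + 1) * e)" .
    have "norm (g_conv (a + b) p t - g_conv (a + b) f t) = norm (g_conv (a + b) (\<lambda>s. f s - p s) t)"
      using a b t f' contp by (simp add: g_conv_diff norm_minus_commute)
    also have "\<dots> \<le> t powr (a + b) / Gamma (a + b + 1) * e"
      using a b t f' contp fp by (intro norm_g_conv_le continuous_intros) auto
    finally have 2: "norm (g_conv (a + b) p t - g_conv (a + b) f t) \<le> t powr (a + b) / Gamma (a + b + 1) * e" .
    have "norm (g_conv a (g_conv b f) t - g_conv (a + b) f t) \<le>
      norm (g_conv a (g_conv b f) t - g_conv a (g_conv b p) t) + norm (g_conv (a + b) p t - g_conv (a + b) f t)"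
      using norm_triangle_ineq[of "g_conv a (g_conv b f) t - g_conv a (g_conv b p) t"
          "g_conv (a + b) p t - g_conv (a + b) f t"] by (simp add: law_p)
    then show ?thesis using 1 2 by (simp add: K_def algebra_simps)
  qed
  have K: "K \<ge> 0" unfolding K_def using a b by (auto intro!: add_nonneg_nonneg mult_nonneg_nonneg simp: Gamma_real_nonneg)
  have "norm (g_conv a (g_conv b f) t - g_conv (a + b) f t) \<le> 0"
  proof (rule field_le_epsilon)
    fix e :: real assume e: "e > 0"
    have "K * (e / (K + 1)) \<le> e" using K e by (simp add: field_simps)
    then show "norm (g_conv a (g_conv b f) t - g_conv (a + b) f t) \<le> 0 + e"
      using bound[of "e / (K + 1)"] K e by (simp add: add_pos_nonneg)
  qed
  then show ?thesis by simp
qed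

section \<open>Derivatives on the half-line\<close>

lemma at_within_atLeast_nontrivial: "t \<ge> (0::real) \<Longrightarrow> at t within {0..} \<noteq> bot"
  by (metis at_le atLeast_subset_iff greaterThan_subset_iff bot.extremum_uniqueI Ioi_le_Ico
      order_trans trivial_limit_at_right_real)

lemma C_k_has_vector_derivative:
  assumes "C_k k u" "j < k" "t \<ge> 0"
  shows "(nderiv j u has_vector_derivative nderiv (Suc j) u t) (at t within {0..})"
  using assms by (auto simp: C_k_def vector_derivative_works)

lemma C_k_continuous: "C_k k u \<Longrightarrow> j \<le> k \<Longrightarrow> continuous_on {0..} (nderiv j u)"
  by (cases "j = k")
     (auto simp: C_k_def continuous_on_eq_continuous_within intro!: differentiable_imp_continuous_within)

text \<open>The values of the iterated derivatives and the class \<open>C\<^sup>k\<close> are read off from any candidate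
  sequence of derivatives.\<close>

lemma nderiv_eqI:
  assumes D0: "\<And>t. t \<ge> 0 \<Longrightarrow> D 0 t = u t"
    and D: "\<And>j t. j < k \<Longrightarrow> t \<ge> 0 \<Longrightarrow> (D j has_vector_derivative D (Suc j) t) (at t within {0..})"
    and "j \<le> k" "t \<ge> 0"
  shows "nderiv j u t = D j t"
  using assms(3,4)
proof (induction j arbitrary: t)
  case 0
  then show ?case by (simp add: D0)
next
  case (Suc j)
  have "(nderiv j u has_vector_derivative D (Suc j) t) (at t within {0..})"
  proof (rule has_vector_derivative_transform[where f = "D j"])
    show "(D j has_vector_derivative D (Suc j) t) (at t within {0..})"
      using D Suc.prems by simp
  qed (use Suc in auto)
  then show ?case using Suc.prems
    by (simp add: vector_derivative_within[OF at_within_atLeast_nontrivial])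
qed

lemma C_kI:
  assumes D0: "\<And>t. t \<ge> 0 \<Longrightarrow> D 0 t = u t"
    and D: "\<And>j t. j < k \<Longrightarrow> t \<ge> 0 \<Longrightarrow> (D j has_vector_derivative D (Suc j) t) (at t within {0..})"
    and cont: "continuous_on {0..} (D k)"
  shows "C_k k u"
proof -
  have eq: "nderiv j u t = D j t" if "j \<le> k" "t \<ge> 0" for j t
    using D0 D that by (rule nderiv_eqI)
  have "nderiv j u differentiable at t within {0..}" if "j < k" "t \<ge> 0" for j t
  proof -
    have "(nderiv j u has_vector_derivative D (Suc j) t) (at t within {0..})"
      by (rule has_vector_derivative_transform[where f = "D j"]) (use that in \<open>simp_all add: eq D\<close>)
    then show ?thesis by (rule differentiableI_vector)
  qed
  moreover have "continuous_on {0..} (nderiv k u)"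
    by (rule continuous_on_eq[OF cont]) (simp add: eq)
  ultimately show ?thesis unfolding C_k_def by blast
qed

lemma nderiv_cong:
  assumes "\<And>t. t \<ge> 0 \<Longrightarrow> u t = v t" "t \<ge> 0"
  shows "nderiv j u t = nderiv j v t"
  using assms(2)
proof (induction j arbitrary: t)
  case (Suc j)
  have "eventually (\<lambda>s. s \<in> {0..} \<longrightarrow> nderiv j u s = nderiv j v s) (nhds t)"
    by (rule always_eventually) (use Suc.IH in auto)
  then show ?case using Suc.prems by (auto intro!: vector_derivative_cong_eq)
qed (use assms in auto)

lemma C_k_cong:
  assumes "\<And>t. t \<ge> 0 \<Longrightarrow> u t = v t" "C_k k u"
  shows "C_k k v"
proof (rule C_kI[where D = "\<lambda>j. nderiv j u"])
  show "nderiv 0 u t = v t" if "t \<ge> 0" for t using assms(1) that by simp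
  show "(nderiv j u has_vector_derivative nderiv (Suc j) u t) (at t within {0..})"
    if "j < k" "t \<ge> 0" for j t by (rule C_k_has_vector_derivative[OF assms(2) that])
  show "continuous_on {0..} (nderiv k u)" by (rule C_k_continuous[OF assms(2) order.refl])
qed

lemma nderiv_diff_const:
  assumes u: "C_k k u" and "1 \<le> j" "j \<le> k" "t \<ge> 0"
  shows "nderiv j (\<lambda>t. u t - c) t = nderiv j u t"
proof -
  define D where "D j t = (if j = 0 then u t - c else nderiv j u t)" for j t
  have "nderiv j (\<lambda>t. u t - c) t = D j t"
  proof (rule nderiv_eqI[where k = k])
    fix i and t :: real assume "i < k" "0 \<le> t"
    note * = C_k_has_vector_derivative[OF u this]
    show "(D i has_vector_derivative D (Suc i) t) (at t within {0..})"
    proof (cases "i = 0")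
      case True
      then have "D i = (\<lambda>t. u t - c)" "D (Suc i) t = nderiv (Suc 0) u t - 0" by (auto simp: D_def)
      then show ?thesis using * True
        by (simp only: nderiv.simps(1)) (rule has_vector_derivative_diff[OF _ has_vector_derivative_const])
    next
      case False
      then have "D i = nderiv i u" "D (Suc i) t = nderiv (Suc i) u t" by (auto simp: D_def)
      then show ?thesis using * by simp
    qed
  qed (use assms in \<open>auto simp: D_def\<close>)
  then show ?thesis using assms by (simp add: D_def)
qed

lemma Taylor_g_conv:
  fixes u :: "real \<Rightarrow> 'b::banach"
  assumes "C_k k u" "k \<ge> 1" "t \<ge> 0"
  shows "u t = (\<Sum>i<k. (t ^ i / fact i) *\<^sub>R nderiv i u 0) + g_conv (real k) (nderiv k u) t"
proof -
  have "(nderiv i u has_vector_derivative nderiv (Suc i) u s) (at s within {0..t})"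
    if "i < k" "0 \<le> s" for i s
    by (rule has_vector_derivative_within_subset[OF C_k_has_vector_derivative[OF assms(1) that]]) auto
  then have "u t = (\<Sum>i<k. ((t - 0) ^ i / fact i) *\<^sub>R nderiv i u 0)
      + integral {0..t} (\<lambda>x. ((t - x) ^ (k - 1) / fact (k - 1)) *\<^sub>R nderiv k u x)"
    using assms by (intro Taylor_integral) auto
  also have "integral {0..t} (\<lambda>x. ((t - x) ^ (k - 1) / fact (k - 1)) *\<^sub>R nderiv k u x) = g_conv (real k) (nderiv k u) t"
    unfolding g_conv_def using assms power_eq_g_fun[of _ "k - 1"]
    by (auto intro!: integral_cong simp: of_nat_diff)
  finally show ?thesis by simp
qed

text \<open>Otherwise the nonzero coefficient of lowest index would dominate as \<open>t\<close> tends to \<open>0\<close>.\<close>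

lemma polynomial_zero_of_small:
  fixes c :: "nat \<Rightarrow> 'b::real_normed_vector"
  assumes small: "\<And>t. 0 < t \<Longrightarrow> t \<le> 1 \<Longrightarrow> norm (\<Sum>i<n. t ^ i *\<^sub>R c i) \<le> K * t ^ (n - 1) * t powr \<beta>"
    and \<beta>: "\<beta> > 0" and "i < n"
  shows "c i = 0"
  using \<open>i < n\<close>
proof (induction i rule: less_induct)
  case (less i)
  define R where "R t = K * t ^ (n - 1 - i) * t powr \<beta> + (\<Sum>l\<in>{i<..<n}. t ^ (l - i) * norm (c l))" for t
  have le: "norm (c i) \<le> R t" if t: "0 < t" "t \<le> 1" for t
  proof -
    have split: "{..<n} = {..<i} \<union> ({i} \<union> {i<..<n})" using less.prems by auto
    have "(\<Sum>l<n. t ^ l *\<^sub>R c l) = t ^ i *\<^sub>R c i + (\<Sum>l\<in>{i<..<n}. t ^ l *\<^sub>R c l)"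
      unfolding split by (subst sum.union_disjoint) (use less in \<open>auto simp: sum.insert\<close>)
    then have "t ^ i *\<^sub>R c i = (\<Sum>l<n. t ^ l *\<^sub>R c l) - (\<Sum>l\<in>{i<..<n}. t ^ l *\<^sub>R c l)" by simp
    then have "norm (t ^ i *\<^sub>R c i) \<le> norm (\<Sum>l<n. t ^ l *\<^sub>R c l) + norm (\<Sum>l\<in>{i<..<n}. t ^ l *\<^sub>R c l)"
      by (simp only: norm_triangle_ineq4)
    also have "\<dots> \<le> K * t ^ (n - 1) * t powr \<beta> + (\<Sum>l\<in>{i<..<n}. t ^ l * norm (c l))"
      using small[OF t] t by (intro add_mono sum_norm_le) auto
    also have "\<dots> = t ^ i * R t"
    proof -
      have "t ^ (n - 1) = t ^ i * t ^ (n - 1 - i)" using less.prems by (simp flip: power_add)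
      moreover have "t ^ l = t ^ i * t ^ (l - i)" if "l \<in> {i<..<n}" for l
        using that by (simp flip: power_add)
      ultimately show ?thesis
        unfolding R_def distrib_left sum_distrib_left
        by (intro arg_cong2[where f = "(+)"] sum.cong) (auto simp: mult.assoc mult.left_commute)
    qed
    finally show ?thesis using t by simp
  qed
  have "((\<lambda>t. K * t ^ (n - 1 - i) * t powr \<beta>) \<longlongrightarrow> K * 0 ^ (n - 1 - i) * 0 powr \<beta>) (at_right 0)"
    using \<beta> by (intro tendsto_intros tendsto_powr') (auto simp: eventually_at_filter)
  moreover have "((\<lambda>t. \<Sum>l\<in>{i<..<n}. t ^ (l - i) * norm (c l)) \<longlongrightarrow>
      (\<Sum>l\<in>{i<..<n}. 0 ^ (l - i) * norm (c l))) (at_right 0)"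
    by (intro tendsto_intros)
  ultimately have "(R \<longlongrightarrow> K * 0 ^ (n - 1 - i) * 0 powr \<beta> + (\<Sum>l\<in>{i<..<n}. 0 ^ (l - i) * norm (c l))) (at_right 0)"
    unfolding R_def by (rule tendsto_add)
  moreover have "(\<Sum>l\<in>{i<..<n}. 0 ^ (l - i) * norm (c l)) = 0" by (intro sum.neutral) auto
  ultimately have "(R \<longlongrightarrow> 0) (at_right 0)" by simp
  moreover have "eventually (\<lambda>t. norm (c i) \<le> R t) (at_right 0)"
    using eventually_at_right_less[of "0::real"] le
    unfolding eventually_at_right_field by (intro exI[of _ 1]) auto
  ultimately have "norm (c i) \<le> 0"
    using tendsto_lowerbound trivial_limit_at_right_real by blast
  then show ?case by simp
qed

section \<open>The Caputo derivative and its integral equation\<close>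

lemma g_conv_1: "g_conv 1 f t = integral {0..t} f"
  by (simp add: g_conv_def g_fun_def)

lemma eq_if_integrals_eq:
  fixes f h :: "real \<Rightarrow> 'b::banach"
  assumes "continuous_on {0..} f" "continuous_on {0..} h"
    and "\<And>t. t \<ge> 0 \<Longrightarrow> integral {0..t} f = integral {0..t} h" and t: "t \<ge> 0"
  shows "f t = h t"
proof -
  have "((\<lambda>s. integral {0..s} f) has_vector_derivative f t) (at t within {0..t+1})"
    "((\<lambda>s. integral {0..s} h) has_vector_derivative h t) (at t within {0..t+1})"
    using t by (auto intro!: integral_has_vector_derivative continuous_on_subset[OF assms(1)]
        continuous_on_subset[OF assms(2)])
  moreover have "((\<lambda>s. integral {0..s} h) has_vector_derivative f t) (at t within {0..t+1})"
    using calculation(1) by (rule has_vector_derivative_transform[rotated 2]) (use assms t in auto)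
  ultimately show ?thesis
    using vector_derivative_unique_within[of t "{0..t+1}"] t
    by (auto simp: trivial_limit_within islimpt_Icc)
qed

text \<open>If the initial derivatives of order \<open>\<ge> 1\<close> vanish, then the Caputo derivative is inverted by the
  fractional integral of order \<open>\<alpha>\<close>. The primitive \<open>F\<close> in the definition of the Caputo derivative is
  \<open>O(t\<^bsup>n - 1 + \<beta>\<^esup>)\<close> with \<open>\<beta> = n - \<alpha>\<close>, hence its Taylor polynomial of degree \<open>n - 1\<close> is zero and
  \<open>g\<^sub>\<beta> * (u - u 0) = F = g\<^sub>n * F\<^bsup>(n)\<^esup>\<close>; a convolution with \<open>g\<^bsub>1 - \<beta>\<^esub>\<close> removes \<open>g\<^sub>\<beta>\<close>.\<close>

theorem caputo_integral_equation:
  fixes u :: "real \<Rightarrow> 'b::banach"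
  assumes u: "caputo_defined \<alpha> u" and \<alpha>: "\<alpha> > 0"
    and u0: "\<And>j. 1 \<le> j \<Longrightarrow> j < nat \<lceil>\<alpha>\<rceil> \<Longrightarrow> nderiv j u 0 = 0" and t: "t \<ge> 0"
  shows "u t - u 0 = g_conv \<alpha> (caputo \<alpha> u) t"
proof -
  define n where "n = nat \<lceil>\<alpha>\<rceil>"
  define \<beta> where "\<beta> = of_int \<lceil>\<alpha>\<rceil> - \<alpha>"
  define F where "F = caputo_primitive \<alpha> u"
  define \<phi> where "\<phi> = caputo \<alpha> u"
  define w where "w t = u t - u 0" for t
  have n: "n \<ge> 1" using \<alpha> unfolding n_def by linarith
  have u0': "nderiv j u 0 = 0" if "0 < j" "j < n" for j using u0 that by (simp add: n_def)
  have \<beta>: "0 \<le> \<beta>" "\<beta> < 1" "real n = \<alpha> + \<beta>" using \<alpha> unfolding n_def \<beta>_def by linarith+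
  have Cu: "C_k (n - 1) u" and CF: "C_k n F" using u by (auto simp: caputo_defined_def n_def F_def)
  have \<phi>: "\<phi> = nderiv n F" by (simp add: \<phi>_def caputo_def n_def F_def)
  have cont\<phi>: "continuous_on {0..} \<phi>" unfolding \<phi> by (rule C_k_continuous[OF CF]) simp
  have contu: "continuous_on {0..} u" using C_k_continuous[OF Cu, of 0] by simp
  then have contw: "continuous_on {0..} w" unfolding w_def by (intro continuous_intros)
  have F_eq: "F t = g_conv \<beta> w t" if "t \<ge> 0" for t
  proof -
    have "(\<Sum>j<n. g_fun (real j + 1) s *\<^sub>R nderiv j u 0) = u 0" for s
    proof -
      have "(\<Sum>j<n. g_fun (real j + 1) s *\<^sub>R nderiv j u 0) = (\<Sum>j\<in>{0}. g_fun (real j + 1) s *\<^sub>R nderiv j u 0)"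
        by (rule sum.mono_neutral_right) (use n u0' in auto)
      then show ?thesis by (simp add: g_fun_def)
    qed
    then show ?thesis by (simp add: F_def caputo_primitive_def w_def[abs_def] n_def \<beta>_def)
  qed
  have w_nderiv: "nderiv j w 0 = 0" if "j < n" for j
  proof (cases "j = 0")
    case False
    then show ?thesis
      using nderiv_diff_const[OF Cu, of j 0 "u 0"] u0' that by (simp add: w_def[abs_def])
  qed (simp add: w_def)
  have Taylor: "F t = (\<Sum>i<n. (t ^ i / fact i) *\<^sub>R nderiv i F 0) + g_conv (real n) \<phi> t" if "t \<ge> 0" for t
    unfolding \<phi> by (rule Taylor_g_conv[OF CF n that])
  have F0: "nderiv i F 0 = 0" if "i < n" for i
  proof (cases "\<beta> = 0")
    case True
    then have "nderiv i F 0 = nderiv i w 0"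
      using F_eq by (intro nderiv_cong) (auto simp: g_conv_def)
    then show ?thesis using w_nderiv that by simp
  next
    case False
    with \<beta> have \<beta>0: "\<beta> > 0" by simp
    have contd: "continuous_on {0..1} (nderiv (n - 1) u)" "continuous_on {0..1} w" "continuous_on {0..1} \<phi>"
      using C_k_continuous[OF Cu order.refl] contw cont\<phi> by (auto intro: continuous_on_subset)
    have "\<exists>B. \<forall>t\<in>{0..1}. norm (f t) \<le> B" if "continuous_on {0..1} f" for f :: "real \<Rightarrow> 'b"
      using compact_imp_bounded[OF compact_continuous_image[OF that]] by (auto simp: bounded_iff)
    from this[OF contd(1)] this[OF contd(2)] this[OF contd(3)] obtain B1 B2 B3 where
      B: "\<And>t. t \<in> {0..1} \<Longrightarrow> norm (nderiv (n - 1) u t) \<le> B1" "\<And>t. t \<in> {0..1} \<Longrightarrow> norm (w t) \<le> B2"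
      "\<And>t. t \<in> {0..1} \<Longrightarrow> norm (\<phi> t) \<le> B3" by metis
    have B3: "B3 \<ge> 0" using B(3)[of 0] norm_ge_zero[of "\<phi> 0"] by (simp del: norm_ge_zero)
    obtain B where wB: "\<And>t. t \<in> {0..1} \<Longrightarrow> norm (w t) \<le> B * t ^ (n - 1)" and B0: "B \<ge> 0"
    proof (cases "n = 1")
      case True
      moreover have "B2 \<ge> 0" using B(2)[of 0] by (simp add: w_def)
      ultimately show ?thesis using that[of B2] B(2) by simp
    next
      case False
      have B1: "B1 \<ge> 0" using B(1)[of 0] norm_ge_zero[of "nderiv (n - 1) u 0"] by (simp del: norm_ge_zero)
      have bound: "norm (w t) \<le> B1 / Gamma (real n) * t ^ (n - 1)" if t: "t \<in> {0..1}" for t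
      proof -
        have "(\<Sum>i<n - 1. (t ^ i / fact i) *\<^sub>R nderiv i u 0) = (\<Sum>i\<in>{0}. (t ^ i / fact i) *\<^sub>R nderiv i u 0)"
        proof (rule sum.mono_neutral_right)
          have "nderiv i u 0 = 0" if "i \<in> {..<n - 1} - {0}" for i using that by (intro u0') auto
          then show "\<forall>i\<in>{..<n - 1} - {0}. (t ^ i / fact i) *\<^sub>R nderiv i u 0 = 0" by simp
        qed (use n False in auto)
        also have "\<dots> = u 0" by simp
        finally have "w t = g_conv (real (n - 1)) (nderiv (n - 1) u) t"
          using Taylor_g_conv[OF Cu, of t] n False t unfolding w_def by simp
        also have "norm \<dots> \<le> t powr real (n - 1) / Gamma (real (n - 1) + 1) * B1"
        proof (rule norm_g_conv_le)
          show "continuous_on {0..t} (nderiv (n - 1) u)" using t by (intro continuous_on_subset[OF contd(1)]) auto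
        qed (use n False t B(1) in auto)
        also have "\<dots> = B1 / Gamma (real n) * t ^ (n - 1)"
        proof -
          have "real (n - 1) + 1 = real n" using n by simp
          moreover have "t powr real (n - 1) = t ^ (n - 1)"
            using n False t powr_realpow[of t "n - 1"] by (cases "t = 0") auto
          ultimately show ?thesis by simp
        qed
        finally show ?thesis .
      qed
      show ?thesis
        by (rule that[OF bound]) (use B1 n in \<open>auto intro!: divide_nonneg_nonneg Gamma_real_nonneg\<close>)
    qed
    define K where "K = B / Gamma (\<beta> + 1) + B3 / Gamma (real n + 1)"
    have "(1 / fact i) *\<^sub>R nderiv i F 0 = 0"
    proof (rule polynomial_zero_of_small[OF _ \<beta>0 that])
      fix t :: real assume t: "0 < t" "t \<le> 1"
      have 1: "norm (F t) \<le> t powr \<beta> / Gamma (\<beta> + 1) * (B * t ^ (n - 1))"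
        unfolding F_eq[OF less_imp_le[OF t(1)]]
      proof (rule norm_g_conv_le[OF \<beta>0])
        fix s assume "0 \<le> s" "s \<le> t"
        then have "norm (w s) \<le> B * s ^ (n - 1)" "B * s ^ (n - 1) \<le> B * t ^ (n - 1)"
          using t wB B0 by (auto intro!: mult_left_mono power_mono)
        then show "norm (w s) \<le> B * t ^ (n - 1)" by linarith
      qed (use t in \<open>auto intro: continuous_on_subset[OF contw]\<close>)
      have 2: "norm (g_conv (real n) \<phi> t) \<le> t powr real n / Gamma (real n + 1) * B3"
        using t n B(3) by (intro norm_g_conv_le continuous_on_subset[OF cont\<phi>]) auto
      have 3: "t powr real n / Gamma (real n + 1) * B3 \<le> t ^ (n - 1) * t powr \<beta> / Gamma (real n + 1) * B3"
      proof -
        have "t powr real n = t ^ (n - 1) * t powr 1"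
          using t n by (simp add: powr_realpow of_nat_diff flip: power_Suc2)
        also have "\<dots> \<le> t ^ (n - 1) * t powr \<beta>"
          using t \<beta> by (intro mult_left_mono powr_mono') auto
        finally show ?thesis using B3 by (intro mult_right_mono divide_right_mono) (auto simp: Gamma_real_nonneg)
      qed
      have "(\<Sum>i<n. (t ^ i) *\<^sub>R (1 / fact i) *\<^sub>R nderiv i F 0) = F t - g_conv (real n) \<phi> t"
        using Taylor[of t] t by simp
      also have "norm \<dots> \<le> norm (F t) + norm (g_conv (real n) \<phi> t)"
        by (rule norm_triangle_ineq4)
      also have "\<dots> \<le> t powr \<beta> / Gamma (\<beta> + 1) * (B * t ^ (n - 1)) +
          t ^ (n - 1) * t powr \<beta> / Gamma (real n + 1) * B3"
        by (rule add_mono[OF 1 order_trans[OF 2 3]])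
      also have "\<dots> = K * t ^ (n - 1) * t powr \<beta>"
        by (simp add: K_def algebra_simps)
      finally show "norm (\<Sum>i<n. (t ^ i) *\<^sub>R (1 / fact i) *\<^sub>R nderiv i F 0) \<le> K * t ^ (n - 1) * t powr \<beta>" .
    qed
    then show ?thesis by simp
  qed
  have "F t = g_conv (real n) \<phi> t" if "t \<ge> 0" for t
    using Taylor[OF that] F0 by simp
  then have eq: "g_conv \<beta> w t = g_conv (real n) \<phi> t" if "t \<ge> 0" for t
    using F_eq that by simp
  have "w t = g_conv \<alpha> \<phi> t"
  proof (cases "\<beta> = 0")
    case True
    then show ?thesis using eq[OF t] \<beta> by (simp add: g_conv_def)
  next
    case False
    with \<beta> have \<beta>0: "\<beta> > 0" by simp
    show ?thesis
    proof (rule eq_if_integrals_eq[OF contw continuous_on_g_conv[OF \<alpha> cont\<phi>] _ t])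
      fix t :: real assume t: "t \<ge> 0"
      have "g_conv 1 w t = g_conv (1 - \<beta>) (g_conv \<beta> w) t"
        using g_conv_g_conv[of "1 - \<beta>" \<beta> t w] \<beta> \<beta>0 t contw by simp
      also have "\<dots> = g_conv (1 - \<beta>) (g_conv (real n) \<phi>) t"
        using t eq by (intro g_conv_cong) auto
      also have "\<dots> = g_conv (1 + \<alpha>) \<phi> t"
        using g_conv_g_conv[of "1 - \<beta>" "real n" t \<phi>] \<beta> n t cont\<phi> by simp
      also have "\<dots> = g_conv 1 (g_conv \<alpha> \<phi>) t"
        using \<alpha> t cont\<phi> by (simp add: g_conv_g_conv)
      finally show "integral {0..t} w = integral {0..t} (g_conv \<alpha> \<phi>)"
        by (simp only: g_conv_1)
    qed
  qed
  then show ?thesis by (simp add: w_def \<phi>_def)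
qed

section \<open>Mittag-Leffler series with vector coefficients\<close>

lemma has_derivative_suminf:
  fixes f :: "nat \<Rightarrow> 'v::real_normed_vector \<Rightarrow> 'b::banach"
  assumes S: "convex S"
    and f': "\<And>n x. x \<in> S \<Longrightarrow> (f n has_derivative f' n x) (at x within S)"
    and M: "\<And>n x h. x \<in> S \<Longrightarrow> norm (f' n x h) \<le> M n * norm h" "summable M"
    and f: "\<And>x. x \<in> S \<Longrightarrow> summable (\<lambda>n. f n x)" and x: "x \<in> S"
  shows "((\<lambda>x. \<Sum>n. f n x) has_derivative (\<lambda>h. \<Sum>n. f' n x h)) (at x within S)"
proof -
  have sf': "summable (\<lambda>n. f' n x h)" if "x \<in> S" for x h
    by (rule summable_comparison_test'[where N = 0 and g = "\<lambda>n. M n * norm h"])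
       (use M that in \<open>auto intro: summable_mult2\<close>)
  have "\<forall>\<^sub>F n in sequentially. \<forall>x\<in>S. \<forall>h. norm ((\<Sum>i<n. f' i x h) - (\<Sum>i. f' i x h)) \<le> e * norm h"
    if e: "e > 0" for e
  proof -
    obtain N where N: "\<And>n. n \<ge> N \<Longrightarrow> norm (\<Sum>i. M (i + n)) < e"
      using suminf_exist_split[OF e M(2)] by blast
    have "norm ((\<Sum>i<n. f' i x h) - (\<Sum>i. f' i x h)) \<le> e * norm h" if "n \<ge> N" "x \<in> S" for n x h
    proof -
      have sM: "summable (\<lambda>i. M (i + n) * norm h)"
        by (intro summable_mult2) (use M(2) in simp)
      have "norm ((\<Sum>i<n. f' i x h) - (\<Sum>i. f' i x h)) = norm (\<Sum>i. f' (i + n) x h)"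
        using suminf_minus_initial_segment[OF sf'[OF that(2)], of n h] by (simp add: norm_minus_commute)
      also have "\<dots> \<le> (\<Sum>i. M (i + n) * norm h)"
        by (rule norm_suminf_le) (use M(1)[OF that(2)] sM in auto)
      also have "\<dots> = (\<Sum>i. M (i + n)) * norm h"
        by (rule suminf_mult2[symmetric]) (use M(2) in simp)
      also have "\<dots> \<le> e * norm h"
        using N[OF that(1)] by (intro mult_right_mono) auto
      finally show ?thesis .
    qed
    then show ?thesis unfolding eventually_sequentially by blast
  qed
  from has_derivative_series[OF S f' this x summable_sums[OF f[OF x]]]
  obtain g where g: "\<And>y. y \<in> S \<Longrightarrow> (\<lambda>n. f n y) sums g y"
    "\<And>y. y \<in> S \<Longrightarrow> (g has_derivative (\<lambda>h. \<Sum>n. f' n y h)) (at y within S)" by blast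
  show ?thesis
    by (rule has_derivative_transform[OF x _ g(2)[OF x]]) (use g(1) in \<open>simp add: sums_iff\<close>)
qed

text \<open>The part of the Gamma integral over \<open>[L, L + 1]\<close> already grows like \<open>L\<^sup>x\<close>. As \<open>L\<close> is arbitrary, the
  Mittag-Leffler series converge everywhere.\<close>

lemma Gamma_real_lower_bound:
  fixes x L :: real
  assumes x: "x \<ge> 0" and L: "L > 0"
  shows "L powr x / exp (L + 1) \<le> Gamma (x + 1)"
proof -
  let ?f = "\<lambda>t. t powr (x + 1 - 1) / exp t"
  have int: "(?f has_integral Gamma (x + 1)) {0..}" using x by (intro Gamma_integral_real) auto
  have sub: "?f integrable_on {L..L+1}"
    using L by (intro integrable_continuous_interval continuous_intros) auto
  have "L powr x / exp (L + 1) = integral {L..L+1} (\<lambda>_. L powr x / exp (L + 1))" by simp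
  also have "\<dots> \<le> integral {L..L+1} ?f"
    using L x sub by (intro integral_le) (auto intro!: frac_le powr_mono2)
  also have "\<dots> \<le> integral {0..} ?f"
    using L int sub by (intro integral_subset_le) (auto simp: has_integral_integrable)
  also have "\<dots> = Gamma (x + 1)" using int by (rule integral_unique)
  finally show ?thesis .
qed

lemma summable_mittag_leffler:
  fixes r :: real
  assumes \<alpha>: "\<alpha> > 0" and \<beta>: "\<beta> \<ge> 0" and r: "r \<ge> 0"
  shows "summable (\<lambda>k. r ^ k / Gamma (\<alpha> * real k + \<beta> + 1))"
proof -
  \<comment> \<open>With \<open>L\<^sup>\<alpha> = 2 r + 1\<close> the terms are dominated by a geometric series of ratio \<open>r / (2 r + 1) \<le> 1/2\<close>.\<close>
  define L where "L = (2 * r + 1) powr (1 / \<alpha>)"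
  have L1: "L \<ge> 1" unfolding L_def using r \<alpha> by (intro ge_one_powr_ge_zero) auto
  have L\<alpha>: "L powr \<alpha> = 2 * r + 1" unfolding L_def using r \<alpha> by (simp add: powr_powr)
  show ?thesis
  proof (rule summable_comparison_test'[where N = 0])
    show "summable (\<lambda>k. exp (L + 1) * (1 / 2) ^ k)" by (intro summable_mult summable_geometric) auto
    fix k :: nat
    have pos: "L powr (\<alpha> * real k + \<beta>) > 0" using L1 by simp
    have "(2 * r + 1) ^ k = L powr (\<alpha> * real k)"
      using L1 r by (simp add: L\<alpha> powr_powr[symmetric] powr_realpow)
    also have "\<dots> \<le> L powr (\<alpha> * real k + \<beta>)" using L1 \<beta> by (intro powr_mono) auto
    finally have "(2 * r + 1) ^ k / exp (L + 1) \<le> L powr (\<alpha> * real k + \<beta>) / exp (L + 1)"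
      by (intro divide_right_mono) auto
    also have "\<dots> \<le> Gamma (\<alpha> * real k + \<beta> + 1)"
      using \<alpha> \<beta> L1 by (intro Gamma_real_lower_bound) auto
    finally have G: "(2 * r + 1) ^ k / exp (L + 1) \<le> Gamma (\<alpha> * real k + \<beta> + 1)" .
    have A: "(2 * r + 1) ^ k / exp (L + 1) > 0" using r by simp
    have \<Gamma>: "Gamma (\<alpha> * real k + \<beta> + 1) > 0" using A G by linarith
    then have "norm (r ^ k / Gamma (\<alpha> * real k + \<beta> + 1)) = r ^ k / Gamma (\<alpha> * real k + \<beta> + 1)"
      using r by simp
    also have "\<dots> \<le> r ^ k / ((2 * r + 1) ^ k / exp (L + 1))"
      by (rule divide_left_mono[OF G]) (use r A \<Gamma> in auto)
    also have "\<dots> = exp (L + 1) * (r / (2 * r + 1)) ^ k" by (simp add: power_divide)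
    also have "\<dots> \<le> exp (L + 1) * (1 / 2) ^ k"
      using r by (intro mult_left_mono power_mono) (auto simp: field_simps)
    finally show "norm (r ^ k / Gamma (\<alpha> * real k + \<beta> + 1)) \<le> exp (L + 1) * (1 / 2) ^ k" .
  qed
qed

definition geometrically_bounded :: "(nat \<Rightarrow> 'b::real_normed_vector) \<Rightarrow> bool" where
  "geometrically_bounded x \<longleftrightarrow> (\<exists>D\<ge>0. \<exists>C\<ge>0. \<forall>k. norm (x k) \<le> D * C ^ k)"

lemma geometrically_bounded_Suc:
  assumes "geometrically_bounded x" shows "geometrically_bounded (\<lambda>k. x (Suc k))"
proof -
  from assms obtain D C where *: "D \<ge> 0" "C \<ge> 0" "\<And>k. norm (x k) \<le> D * C ^ k"
    by (auto simp: geometrically_bounded_def)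
  have "norm (x (Suc k)) \<le> (D * C) * C ^ k" for k using *(3)[of "Suc k"] by (simp add: mult_ac)
  then show ?thesis unfolding geometrically_bounded_def
    using * by (intro exI[of _ "D * C"] exI[of _ C] conjI) auto
qed

text \<open>For \<open>x k = B\<^sup>k v\<close> with a bounded operator \<open>B\<close> this is \<open>t\<^sup>\<beta> E\<^bsub>\<alpha>,\<beta>+1\<^esub>(t\<^sup>\<alpha> B) v\<close>. Keeping only the sequence
  \<open>x\<close> allows \<open>B\<close> to be unbounded and defined implicitly.\<close>

definition mittag_leffler :: "real \<Rightarrow> real \<Rightarrow> (nat \<Rightarrow> 'b::banach) \<Rightarrow> real \<Rightarrow> 'b" where
  "mittag_leffler \<alpha> \<beta> x t = (\<Sum>k. g_fun (\<alpha> * real k + \<beta> + 1) t *\<^sub>R x k)"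

context
  fixes \<alpha> :: real and x :: "nat \<Rightarrow> 'b::banach"
  assumes \<alpha>: "\<alpha> > 0" and x: "geometrically_bounded x"
begin

lemma mittag_leffler_majorant:
  assumes \<beta>: "\<beta> \<ge> 0"
  obtains M where "summable M" "\<And>k t. 0 \<le> t \<Longrightarrow> t \<le> \<tau> \<Longrightarrow> norm (g_fun (\<alpha> * real k + \<beta> + 1) t *\<^sub>R x k) \<le> M k"
proof -
  from x obtain D C where DC: "D \<ge> 0" "C \<ge> 0" "\<And>k. norm (x k) \<le> D * C ^ k"
    by (auto simp: geometrically_bounded_def)
  define T where "T = max 1 \<tau>"
  define M where "M k = T powr \<beta> * D * ((T powr \<alpha> * C) ^ k / Gamma (\<alpha> * real k + \<beta> + 1))" for k
  have "summable M" unfolding M_def using \<alpha> \<beta> DC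
    by (intro summable_mult summable_mittag_leffler) auto
  moreover have "norm (g_fun (\<alpha> * real k + \<beta> + 1) t *\<^sub>R x k) \<le> M k" if t: "0 \<le> t" "t \<le> \<tau>" for k t
  proof -
    let ?\<gamma> = "\<alpha> * real k + \<beta>"
    have \<gamma>: "?\<gamma> \<ge> 0" using \<alpha> \<beta> by simp
    have T: "T \<ge> 1" "t \<le> T" using t by (auto simp: T_def)
    have "g_fun (?\<gamma> + 1) t \<le> T powr ?\<gamma> / Gamma (?\<gamma> + 1)"
    proof (cases "?\<gamma> = 0")
      case False
      then have "t powr ?\<gamma> \<le> T powr ?\<gamma>" using t T \<gamma> by (intro powr_mono2) auto
      then show ?thesis using False \<gamma>
        by (auto simp: g_fun_def intro!: divide_right_mono Gamma_real_nonneg)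
    qed (use T in \<open>auto simp: g_fun_def\<close>)
    also have "T powr ?\<gamma> = (T powr \<alpha>) ^ k * T powr \<beta>"
      using T by (simp add: powr_add powr_powr[symmetric] powr_realpow)
    finally have "norm (g_fun (?\<gamma> + 1) t *\<^sub>R x k) \<le> ((T powr \<alpha>) ^ k * T powr \<beta> / Gamma (?\<gamma> + 1)) * (D * C ^ k)"
      unfolding norm_scaleR using DC g_fun_pos[OF \<gamma> t(1)]
      by (intro mult_mono) auto
    also have "\<dots> = M k" by (simp add: M_def power_mult_distrib)
    finally show ?thesis .
  qed
  ultimately show ?thesis by (rule that)
qed

lemma summable_mittag_leffler_terms:
  assumes "\<beta> \<ge> 0" "t \<ge> 0"
  shows "summable (\<lambda>k. g_fun (\<alpha> * real k + \<beta> + 1) t *\<^sub>R x k)"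
  by (rule mittag_leffler_majorant[OF assms(1), of t])
     (rule summable_comparison_test'[where N = 0], use assms in auto)

lemma uniform_limit_mittag_leffler:
  assumes "\<beta> \<ge> 0"
  shows "uniform_limit {0..\<tau>} (\<lambda>N t. \<Sum>k<N. g_fun (\<alpha> * real k + \<beta> + 1) t *\<^sub>R x k)
           (mittag_leffler \<alpha> \<beta> x) sequentially"
  unfolding mittag_leffler_def
  by (rule mittag_leffler_majorant[OF assms, of \<tau>]) (rule Weierstrass_m_test, auto)

lemma continuous_on_mittag_leffler_interval:
  assumes "\<beta> \<ge> 0" shows "continuous_on {0..\<tau>} (mittag_leffler \<alpha> \<beta> x)"
  by (rule uniform_limit_theorem[OF _ uniform_limit_mittag_leffler[OF assms]])
     (use assms \<alpha> in \<open>auto intro!: always_eventually continuous_intros continuous_on_subset[OF continuous_on_g_fun]\<close>)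

lemma at_within_atLeast_eq: "0 \<le> t \<Longrightarrow> at t within {0..} = at t within {0..t + (1::real)}"
  by (rule at_within_nhd[of _ "{..<t+1}"]) auto

lemma continuous_on_mittag_leffler:
  assumes "\<beta> \<ge> 0" shows "continuous_on {0..} (mittag_leffler \<alpha> \<beta> x)"
  using continuous_on_mittag_leffler_interval[OF assms]
  by (auto simp: continuous_on_eq_continuous_within at_within_atLeast_eq continuous_within)

lemma g_fun_has_vector_derivative:
  assumes \<gamma>: "\<gamma> \<ge> 0" and t: "t \<in> {0..\<tau>}"
  shows "(g_fun (\<gamma> + 1 + 1) has_vector_derivative g_fun (\<gamma> + 1) t) (at t within {0..\<tau>})"
proof (rule has_vector_derivative_transform[OF t])
  show "((\<lambda>s. integral {0..s} (g_fun (\<gamma> + 1))) has_vector_derivative g_fun (\<gamma> + 1) t) (at t within {0..\<tau>})"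
    by (rule integral_has_vector_derivative[OF continuous_on_subset[OF continuous_on_g_fun[OF \<gamma>]] t]) auto
  show "g_fun (\<gamma> + 1 + 1) s = integral {0..s} (g_fun (\<gamma> + 1))" if "s \<in> {0..\<tau>}" for s
    using g_conv_g_fun_real[of 1 \<gamma> s] \<gamma> that by (simp add: g_conv_def g_fun_def[of 1])
qed

lemma mittag_leffler_has_vector_derivative:
  assumes \<beta>: "\<beta> \<ge> 0" and t: "t \<ge> 0"
  shows "(mittag_leffler \<alpha> (\<beta> + 1) x has_vector_derivative mittag_leffler \<alpha> \<beta> x t) (at t within {0..})"
proof -
  obtain M where M: "summable M"
    "\<And>k s. 0 \<le> s \<Longrightarrow> s \<le> t + 1 \<Longrightarrow> norm (g_fun (\<alpha> * real k + \<beta> + 1) s *\<^sub>R x k) \<le> M k"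
    by (rule mittag_leffler_majorant[OF \<beta>, of "t + 1"]) blast
  have "((\<lambda>s. \<Sum>k. g_fun (\<alpha> * real k + (\<beta> + 1) + 1) s *\<^sub>R x k) has_derivative
      (\<lambda>h. \<Sum>k. h *\<^sub>R (g_fun (\<alpha> * real k + \<beta> + 1) t *\<^sub>R x k))) (at t within {0..t+1})"
  proof (rule has_derivative_suminf[where M = M])
    fix k s assume s: "s \<in> {0..t+1}"
    have "((\<lambda>s. g_fun (\<alpha> * real k + \<beta> + 1 + 1) s *\<^sub>R x k) has_vector_derivative
        g_fun (\<alpha> * real k + \<beta> + 1) s *\<^sub>R x k) (at s within {0..t+1})"
      using g_fun_has_vector_derivative[OF _ s, of "\<alpha> * real k + \<beta>"] \<alpha> \<beta>
      by (intro bounded_linear.has_vector_derivative[OF bounded_linear_scaleR_left]) auto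
    then show "((\<lambda>s. g_fun (\<alpha> * real k + (\<beta> + 1) + 1) s *\<^sub>R x k) has_derivative
        (\<lambda>h. h *\<^sub>R (g_fun (\<alpha> * real k + \<beta> + 1) s *\<^sub>R x k))) (at s within {0..t+1})"
      by (simp add: has_vector_derivative_def add.assoc)
    show "norm (h *\<^sub>R (g_fun (\<alpha> * real k + \<beta> + 1) s *\<^sub>R x k)) \<le> M k * norm h" for h
      unfolding norm_scaleR[of h] real_norm_def mult.commute[of "M k"] using M(2)[of s k] s by (intro mult_left_mono) auto
  qed (use t \<beta> M(1) summable_mittag_leffler_terms[of "\<beta> + 1"] in auto)
  moreover have "(\<lambda>h. \<Sum>k. h *\<^sub>R (g_fun (\<alpha> * real k + \<beta> + 1) t *\<^sub>R x k)) = (\<lambda>h. h *\<^sub>R mittag_leffler \<alpha> \<beta> x t)"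
    unfolding mittag_leffler_def
    by (intro ext suminf_scaleR_right[symmetric] summable_mittag_leffler_terms assms)
  ultimately show ?thesis
    unfolding has_vector_derivative_def at_within_atLeast_eq[OF t] mittag_leffler_def[abs_def] by simp
qed

lemma g_conv_mittag_leffler:
  assumes \<beta>: "\<beta> \<ge> 0" and b: "b > 0" and t: "t \<ge> 0"
  shows "g_conv b (mittag_leffler \<alpha> \<beta> x) t = mittag_leffler \<alpha> (\<beta> + b) x t"
proof (rule LIMSEQ_unique)
  let ?S = "\<lambda>N s. \<Sum>k<N. g_fun (\<alpha> * real k + \<beta> + 1) s *\<^sub>R x k"
  have contS: "continuous_on {0..t} (?S N)" for N
    using \<alpha> \<beta> by (intro continuous_intros continuous_on_subset[OF continuous_on_g_fun]) auto
  note contE = continuous_on_mittag_leffler_interval[OF \<beta>, of t]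
  define K where "K = t powr b / Gamma (b + 1)"
  have K: "K \<ge> 0" using b by (simp add: K_def Gamma_real_nonneg)
  show "(\<lambda>N. g_conv b (?S N) t) \<longlonglongrightarrow> g_conv b (mittag_leffler \<alpha> \<beta> x) t"
  proof (rule LIMSEQ_I)
    fix e :: real assume e: "e > 0"
    then have "e / (K + 1) > 0" using K by simp
    from uniform_limitD[OF uniform_limit_mittag_leffler[OF \<beta>, of t] this]
    obtain N where "\<forall>n\<ge>N. \<forall>s\<in>{0..t}. dist (?S n s) (mittag_leffler \<alpha> \<beta> x s) < e / (K + 1)"
      unfolding eventually_sequentially by blast
    then have N: "norm (?S n s - mittag_leffler \<alpha> \<beta> x s) < e / (K + 1)" if "n \<ge> N" "0 \<le> s" "s \<le> t" for n s
      using that by (simp add: dist_norm)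
    have "norm (g_conv b (?S n) t - g_conv b (mittag_leffler \<alpha> \<beta> x) t) < e" if n: "n \<ge> N" for n
    proof -
      have "norm (g_conv b (?S n) t - g_conv b (mittag_leffler \<alpha> \<beta> x) t)
          = norm (g_conv b (\<lambda>s. ?S n s - mittag_leffler \<alpha> \<beta> x s) t)"
        using b t contS contE by (simp add: g_conv_diff)
      also have "\<dots> \<le> K * (e / (K + 1))"
        unfolding K_def[symmetric]
        using norm_g_conv_le[OF b t continuous_on_diff[OF contS[of n] contE], of "e / (K + 1)"] N[OF n]
        by (auto simp: K_def less_imp_le)
      also have "\<dots> < e" using e K by (simp add: field_simps)
      finally show ?thesis .
    qed
    then show "\<exists>N. \<forall>n\<ge>N. norm (g_conv b (?S n) t - g_conv b (mittag_leffler \<alpha> \<beta> x) t) < e" by blast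
  qed
  have "g_conv b (?S N) t = (\<Sum>k<N. g_fun (\<alpha> * real k + (\<beta> + b) + 1) t *\<^sub>R x k)" for N
  proof -
    have "g_conv b (?S N) t = (\<Sum>k<N. g_conv b (\<lambda>s. g_fun (\<alpha> * real k + \<beta> + 1) s *\<^sub>R x k) t)"
      using \<alpha> \<beta> b t by (intro g_conv_sum) (auto intro!: continuous_intros continuous_on_subset[OF continuous_on_g_fun])
    also have "\<dots> = (\<Sum>k<N. g_fun (\<alpha> * real k + \<beta> + b + 1) t *\<^sub>R x k)"
      using \<alpha> \<beta> b t by (intro sum.cong g_conv_g_fun) auto
    finally show ?thesis by (simp add: add.assoc)
  qed
  moreover have "(\<lambda>N. \<Sum>k<N. g_fun (\<alpha> * real k + (\<beta> + b) + 1) t *\<^sub>R x k) \<longlonglongrightarrow> mittag_leffler \<alpha> (\<beta> + b) x t"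
    unfolding mittag_leffler_def using \<beta> b t
    by (intro summable_LIMSEQ summable_mittag_leffler_terms) auto
  ultimately show "(\<lambda>N. g_conv b (?S N) t) \<longlonglongrightarrow> mittag_leffler \<alpha> (\<beta> + b) x t" by simp
qed

lemma mittag_leffler_at_0: "\<beta> > 0 \<Longrightarrow> mittag_leffler \<alpha> \<beta> x 0 = 0"
  using \<alpha> by (simp add: mittag_leffler_def g_fun_def add_nonneg_eq_0_iff)

end

text \<open>Splitting off the first term shifts the coefficients and raises the order by \<open>\<alpha>\<close>; the remainder
  vanishes at \<open>0\<close> together with its derivatives of order \<open>< \<alpha>\<close>, so the fractional integral and the
  \<open>n\<close>-th derivative in the Caputo derivative act on it term by term.\<close>

theorem
  fixes x :: "nat \<Rightarrow> 'b::banach"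
  assumes \<alpha>: "\<alpha> > 0" and x: "geometrically_bounded x"
  shows caputo_defined_mittag_leffler: "caputo_defined \<alpha> (mittag_leffler \<alpha> 0 x)"
    and caputo_mittag_leffler:
      "t \<ge> 0 \<Longrightarrow> caputo \<alpha> (mittag_leffler \<alpha> 0 x) t = mittag_leffler \<alpha> 0 (\<lambda>k. x (Suc k)) t"
    and nderiv_mittag_leffler_at_0:
      "1 \<le> j \<Longrightarrow> j < nat \<lceil>\<alpha>\<rceil> \<Longrightarrow> nderiv j (mittag_leffler \<alpha> 0 x) 0 = 0"
    and mittag_leffler_0_at_0: "mittag_leffler \<alpha> 0 x 0 = x 0"
proof -
  define n where "n = nat \<lceil>\<alpha>\<rceil>"
  have n: "n \<ge> 1" "real n - 1 < \<alpha>" "\<alpha> \<le> real n" "real_of_int \<lceil>\<alpha>\<rceil> = real n"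
    using \<alpha> unfolding n_def by linarith+
  define y where "y k = x (Suc k)" for k
  have y: "geometrically_bounded y" unfolding y_def by (rule geometrically_bounded_Suc[OF x])
  let ?u = "mittag_leffler \<alpha> 0 x" and ?E = "\<lambda>\<beta>. mittag_leffler \<alpha> \<beta> y"
  note der = mittag_leffler_has_vector_derivative[OF \<alpha> y]
  note cont = continuous_on_mittag_leffler[OF \<alpha> y]
  have u: "?u t = x 0 + ?E \<alpha> t" if "t \<ge> 0" for t
    using suminf_split_head[OF summable_mittag_leffler_terms[OF \<alpha> x order.refl that]]
    by (simp add: mittag_leffler_def y_def g_fun_def[of 1] algebra_simps)
  show "?u 0 = x 0" using u[of 0] mittag_leffler_at_0[OF \<alpha> y \<alpha>] by simp
  define D where "D j t = (if j = 0 then x 0 + ?E \<alpha> t else ?E (\<alpha> - real j) t)" for j t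
  have D: "(D j has_vector_derivative D (Suc j) t) (at t within {0..})" if "j < n - 1" "t \<ge> 0" for j t
  proof -
    have "\<alpha> - real (Suc j) \<ge> 0" using that n by linarith
    note * = der[OF this that(2)]
    show ?thesis
    proof (cases "j = 0")
      case True
      have "((\<lambda>t. x 0 + ?E \<alpha> t) has_vector_derivative 0 + ?E (\<alpha> - 1) t) (at t within {0..})"
        using * True by (intro has_vector_derivative_add has_vector_derivative_const) simp
      then show ?thesis using True by (simp add: D_def[abs_def])
    next
      case False
      then show ?thesis using * by (simp add: D_def[abs_def] add.commute)
    qed
  qed
  have contD: "continuous_on {0..} (D j)" if "j \<le> n - 1" for j
    using that n \<alpha> by (cases "j = 0") (auto simp: D_def[abs_def] intro!: continuous_intros cont)
  have D0: "D 0 t = ?u t" if "t \<ge> 0" for t using u[OF that] by (simp add: D_def)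
  have Cu: "C_k (n - 1) ?u" by (rule C_kI[OF D0 D contD]) auto
  have nd: "nderiv j ?u t = D j t" if "j \<le> n - 1" "t \<ge> 0" for j t
    using D0 D that by (rule nderiv_eqI)
  have nd0: "nderiv j ?u 0 = 0" if "1 \<le> j" "j < n" for j
    using that n nd[of j 0] mittag_leffler_at_0[OF \<alpha> y, of "\<alpha> - real j"] by (simp add: D_def)
  then show "1 \<le> j \<Longrightarrow> j < nat \<lceil>\<alpha>\<rceil> \<Longrightarrow> nderiv j ?u 0 = 0" by (simp add: n_def)
  have prim: "caputo_primitive \<alpha> ?u t = ?E (real n) t" if t: "t \<ge> 0" for t
  proof -
    have "(\<Sum>j<n. g_fun (real j + 1) s *\<^sub>R nderiv j ?u 0) = x 0" for s
    proof -
      have "(\<Sum>j<n. g_fun (real j + 1) s *\<^sub>R nderiv j ?u 0) = (\<Sum>j\<in>{0}. g_fun (real j + 1) s *\<^sub>R nderiv j ?u 0)"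
      proof (rule sum.mono_neutral_right)
        have "nderiv j ?u 0 = 0" if "j \<in> {..<n} - {0}" for j using that by (intro nd0) auto
        then show "\<forall>j\<in>{..<n} - {0}. g_fun (real j + 1) s *\<^sub>R nderiv j ?u 0 = 0" by simp
      qed (use n in auto)
      then show ?thesis using \<open>?u 0 = x 0\<close> by (simp add: g_fun_def)
    qed
    then have "caputo_primitive \<alpha> ?u t = g_conv (real n - \<alpha>) (\<lambda>s. ?u s - x 0) t"
      by (simp add: caputo_primitive_def n(4) flip: n_def)
    also have "\<dots> = g_conv (real n - \<alpha>) (?E \<alpha>) t"
      using t u by (intro g_conv_cong) auto
    also have "\<dots> = ?E (real n) t"
    proof (cases "real n = \<alpha>")
      case False
      then show ?thesis using g_conv_mittag_leffler[OF \<alpha> y, of \<alpha> "real n - \<alpha>" t] \<alpha> n t by simp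
    qed (simp add: g_conv_def)
    finally show ?thesis .
  qed
  have E: "(?E (real n - real j) has_vector_derivative ?E (real n - real (Suc j)) t) (at t within {0..})"
    if "j < n" "t \<ge> 0" for j t
    using der[of "real n - real (Suc j)" t] that by simp
  have "C_k n (caputo_primitive \<alpha> ?u)"
    by (rule C_kI[where D = "\<lambda>j. ?E (real n - real j)"]) (use prim E cont in auto)
  then show "caputo_defined \<alpha> ?u" using Cu by (simp add: caputo_defined_def n_def)
  show "caputo \<alpha> ?u t = mittag_leffler \<alpha> 0 (\<lambda>k. x (Suc k)) t" if "t \<ge> 0"
    using nderiv_eqI[where D = "\<lambda>j. ?E (real n - real j)" and k = n and j = n and t = t and u = "caputo_primitive \<alpha> ?u"]
      prim E that by (simp add: caputo_def y_def[abs_def] flip: n_def)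
qed

section \<open>Uniqueness for the fractional integral equation\<close>

text \<open>Iterating \<open>h = g\<^sub>\<alpha> * \<phi>\<close> with \<open>\<parallel>\<phi>\<parallel> \<le> C \<parallel>h\<parallel>\<close> bounds \<open>h\<close> by the general term of a convergent
  Mittag-Leffler series.\<close>

theorem fractional_Gronwall:
  fixes h \<phi> :: "real \<Rightarrow> 'b::banach"
  assumes \<alpha>: "\<alpha> > 0" and h: "continuous_on {0..} h" and \<phi>: "continuous_on {0..} \<phi>"
    and eq: "\<And>t. t \<ge> 0 \<Longrightarrow> h t = g_conv \<alpha> \<phi> t"
    and C: "C \<ge> 0" "\<And>t. t \<ge> 0 \<Longrightarrow> norm (\<phi> t) \<le> C * norm (h t)" and t: "t \<ge> 0"
  shows "h t = 0"
proof -
  have "compact (h ` {0..t})"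
    by (intro compact_continuous_image continuous_on_subset[OF h]) auto
  then obtain B where "\<forall>y\<in>h ` {0..t}. norm y \<le> B"
    using compact_imp_bounded bounded_iff by metis
  then have B: "norm (h s) \<le> B" if "0 \<le> s" "s \<le> t" for s using that by auto
  have B0: "B \<ge> 0" using B[of 0] t norm_ge_zero[of "h 0"] by linarith
  have bound: "norm (h s) \<le> B * C ^ k * g_fun (\<alpha> * real k + 1) s" if "0 \<le> s" "s \<le> t" for s k
    using that
  proof (induction k arbitrary: s)
    case 0
    then show ?case using B by (simp add: g_fun_def)
  next
    case (Suc k)
    have cont: "continuous_on {0..s} (\<lambda>r. g_fun (\<alpha> * real k + 1) r *\<^sub>R (B * C ^ Suc k))"
      using \<alpha> by (intro continuous_intros continuous_on_subset[OF continuous_on_g_fun]) auto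
    have "norm (g_conv \<alpha> \<phi> s) \<le> g_conv \<alpha> (\<lambda>r. g_fun (\<alpha> * real k + 1) r *\<^sub>R (B * C ^ Suc k)) s"
    proof (rule norm_g_conv_le_g_conv[OF \<alpha> Suc.prems(1) _ cont])
      show "continuous_on {0..s} \<phi>" by (rule continuous_on_subset[OF \<phi>]) auto
      fix r assume r: "0 \<le> r" "r \<le> s"
      have "norm (\<phi> r) \<le> C * norm (h r)" using C(2) r by simp
      also have "\<dots> \<le> C * (B * C ^ k * g_fun (\<alpha> * real k + 1) r)"
        using Suc.IH[of r] Suc.prems r C(1) by (intro mult_left_mono) auto
      finally show "norm (\<phi> r) \<le> g_fun (\<alpha> * real k + 1) r *\<^sub>R (B * C ^ Suc k)"
        by (simp add: mult_ac)
    qed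
    also have "\<dots> = g_fun (\<alpha> * real k + \<alpha> + 1) s *\<^sub>R (B * C ^ Suc k)"
      using \<alpha> Suc.prems by (intro g_conv_g_fun) auto
    finally show ?case using eq[OF Suc.prems(1)] by (simp add: algebra_simps)
  qed
  have "geometrically_bounded (\<lambda>k. B * C ^ k)"
    unfolding geometrically_bounded_def using B0 C(1)
    by (intro exI[of _ B] exI[of _ C]) (auto simp: abs_mult)
  from summable_mittag_leffler_terms[OF \<alpha> this order.refl t]
  have "(\<lambda>k. B * C ^ k * g_fun (\<alpha> * real k + 1) t) \<longlonglongrightarrow> 0"
    by (auto dest!: summable_LIMSEQ_zero simp: mult.commute[of "g_fun _ _"] simp del: mult_cancel_right)
  then have "norm (h t) \<le> 0"
    by (rule LIMSEQ_le_const) (use bound[OF t order.refl] in auto)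
  then show ?thesis by simp
qed

section \<open>Analytic continuation of Mittag-Leffler series\<close>

lemma bounded_bilinear_scaleC:
  "bounded_bilinear (scaleC :: complex \<Rightarrow> 'a::complex_banach \<Rightarrow> 'a)"
proof
  fix a b :: complex and x y :: 'a and r :: real
  show "(a + b) *\<^sub>C x = a *\<^sub>C x + b *\<^sub>C x" by (rule scaleC_add_left)
  show "a *\<^sub>C (x + y) = a *\<^sub>C x + a *\<^sub>C y" by (rule scaleC_add_right)
  show "(r *\<^sub>R a) *\<^sub>C x = r *\<^sub>R (a *\<^sub>C x)"
    by (simp add: scaleC_scaleC scaleR_conv_of_real flip: scaleC_of_real)
  show "a *\<^sub>C (r *\<^sub>R x) = r *\<^sub>R (a *\<^sub>C x)"
    by (simp add: scaleC_scaleC mult.commute flip: scaleC_of_real)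
  show "\<exists>K. \<forall>a (x::'a). norm (a *\<^sub>C x) \<le> norm a * norm x * K"
    by (rule exI[of _ 1]) (simp add: norm_scaleC)
qed

interpretation scaleC: bounded_bilinear "scaleC :: complex \<Rightarrow> 'a::complex_banach \<Rightarrow> 'a"
  by (rule bounded_bilinear_scaleC)

lemma vec_power_series_has_derivative:
  fixes y :: "nat \<Rightarrow> 'a::complex_banach"
  assumes y: "\<And>r. r \<ge> 0 \<Longrightarrow> summable (\<lambda>k. r ^ k * norm (y k))"
  shows "\<exists>D. ((\<lambda>z. \<Sum>k. z ^ k *\<^sub>C y k) has_derivative (\<lambda>h. h *\<^sub>C D)) (at z)"
proof -
  define r where "r = norm z + 1"
  have z: "z \<in> ball 0 r" by (simp add: r_def)
  have r: "r \<ge> 1" by (simp add: r_def)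
  let ?d = "\<lambda>k z. (of_nat k * z ^ (k - 1)) *\<^sub>C y k"
  \<comment> \<open>The factor \<open>k \<le> 2\<^sup>k\<close> of the derivative is absorbed by doubling the radius.\<close>
  have dbound: "norm (?d k w) \<le> (2 * r) ^ k * norm (y k)" if "w \<in> ball 0 r" for k w
  proof -
    have "real k * norm w ^ (k - 1) \<le> 2 ^ k * r ^ k"
    proof (intro mult_mono)
      have "real k < 2 ^ k" by (metis of_nat_less_two_power)
      then show "real k \<le> 2 ^ k" by simp
      have "norm w ^ (k - 1) \<le> r ^ (k - 1)" using that by (intro power_mono) auto
      also have "\<dots> \<le> r ^ k" using r by (intro power_increasing) auto
      finally show "norm w ^ (k - 1) \<le> r ^ k" .
    qed (use r in auto)
    then show ?thesis
      by (auto simp: norm_scaleC norm_mult norm_power power_mult_distrib intro!: mult_right_mono)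
  qed
  have sd: "summable (\<lambda>k. ?d k w)" if "w \<in> ball 0 r" for w
    by (rule summable_comparison_test'[where N = 0, OF y[of "2 * r"]]) (use dbound[OF that] r in auto)
  have sy: "summable (\<lambda>k. w ^ k *\<^sub>C y k)" for w
    by (rule summable_comparison_test'[where N = 0, OF y[of "norm w"]]) (auto simp: norm_scaleC norm_power)
  have "((\<lambda>z. \<Sum>k. z ^ k *\<^sub>C y k) has_derivative (\<lambda>h. \<Sum>k. h *\<^sub>C ?d k z)) (at z within ball 0 r)"
  proof (rule has_derivative_suminf[where M = "\<lambda>k. (2 * r) ^ k * norm (y k)"])
    fix k and w :: complex assume w: "w \<in> ball 0 r"
    have "((\<lambda>z. z ^ k) has_derivative (\<lambda>h. h * (of_nat k * w ^ (k - 1)))) (at w within ball 0 r)"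
      by (auto intro!: derivative_eq_intros simp: fun_eq_iff)
    from bounded_linear.has_derivative[OF scaleC.bounded_linear_left this]
    show "((\<lambda>z. z ^ k *\<^sub>C y k) has_derivative (\<lambda>h. h *\<^sub>C ?d k w)) (at w within ball 0 r)"
      by (simp add: scaleC_scaleC)
    show "norm (h *\<^sub>C ?d k w) \<le> (2 * r) ^ k * norm (y k) * norm h" for h
      unfolding norm_scaleC[of h] mult.commute[of _ "norm h"] using dbound[OF w] by (intro mult_left_mono) auto
  qed (use z sy y[of "2 * r"] r in auto)
  moreover have "(\<lambda>h. \<Sum>k. h *\<^sub>C ?d k z) = (\<lambda>h. h *\<^sub>C (\<Sum>k. ?d k z))"
    by (intro ext bounded_linear.suminf[OF scaleC.bounded_linear_right sd[OF z], symmetric])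
  moreover have "at z within ball 0 r = at z" using z by (intro at_within_open) auto
  ultimately show ?thesis by auto
qed

text \<open>The solution is \<open>V (t\<^sup>\<alpha>)\<close> with an entire power series \<open>V\<close>. The principal branch of the power is
  analytic off the negative half-axis, and for a natural number \<open>\<alpha>\<close> it is a polynomial.\<close>

theorem mittag_leffler_extension:
  fixes x :: "nat \<Rightarrow> 'a::complex_banach"
  assumes \<alpha>: "\<alpha> > 0" and x: "geometrically_bounded x"
  obtains U :: "complex \<Rightarrow> 'a" where
    "\<And>t. t \<ge> 0 \<Longrightarrow> U (complex_of_real t) = mittag_leffler \<alpha> 0 x t"
    "vec_holomorphic_on U (UNIV - complex_of_real ` {..0})"
    "\<alpha> \<in> \<nat> \<Longrightarrow> vec_holomorphic_on U UNIV"
proof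
  define y where "y k = (1 / Gamma (\<alpha> * real k + 1)) *\<^sub>R x k" for k
  define V where "V z = (\<Sum>k. z ^ k *\<^sub>C y k)" for z :: complex
  define U where "U z = V (z powr complex_of_real \<alpha>)" for z
  from x obtain D C where DC: "D \<ge> 0" "C \<ge> 0" "\<And>k. norm (x k) \<le> D * C ^ k"
    by (auto simp: geometrically_bounded_def)
  have "summable (\<lambda>k. r ^ k * norm (y k))" if r: "r \<ge> 0" for r
  proof (rule summable_comparison_test'[where N = 0])
    show "summable (\<lambda>k. D * ((r * C) ^ k / Gamma (\<alpha> * real k + 0 + 1)))"
      using r DC \<alpha> by (intro summable_mult summable_mittag_leffler) auto
    fix k
    have G: "Gamma (\<alpha> * real k + 1) > 0" using \<alpha> by (intro Gamma_real_pos add_nonneg_pos) auto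
    have "norm (r ^ k * norm (y k)) = r ^ k * norm (x k) / Gamma (\<alpha> * real k + 1)"
      using r G by (simp add: y_def)
    also have "\<dots> \<le> r ^ k * (D * C ^ k) / Gamma (\<alpha> * real k + 1)"
      using r DC(3)[of k] G by (intro divide_right_mono mult_left_mono) auto
    finally show "norm (r ^ k * norm (y k)) \<le> D * ((r * C) ^ k / Gamma (\<alpha> * real k + 0 + 1))"
      by (simp add: power_mult_distrib mult_ac)
  qed
  then have V: "\<exists>D. (V has_derivative (\<lambda>h. h *\<^sub>C D)) (at z)" for z
    unfolding V_def by (rule vec_power_series_has_derivative)
  have chain: "\<exists>D. ((\<lambda>z. V (p z)) has_derivative (\<lambda>h. h *\<^sub>C D)) (at z)"
    if p: "(p has_field_derivative p') (at z)" for p p' z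
  proof -
    obtain D where "(V has_derivative (\<lambda>h. h *\<^sub>C D)) (at (p z))" using V by blast
    from diff_chain_at[OF p[unfolded has_field_derivative_def] this]
    have "((\<lambda>z. V (p z)) has_derivative (\<lambda>h. h *\<^sub>C (p' *\<^sub>C D))) (at z)"
      by (simp add: o_def scaleC_scaleC mult.commute)
    then show ?thesis by blast
  qed
  show "U (complex_of_real t) = mittag_leffler \<alpha> 0 x t" if t: "t \<ge> 0" for t
  proof -
    have "(complex_of_real t powr complex_of_real \<alpha>) ^ k *\<^sub>C y k = g_fun (\<alpha> * real k + 0 + 1) t *\<^sub>R x k" for k
    proof -
      have "complex_of_real t powr complex_of_real \<alpha> = complex_of_real (t powr \<alpha>)"
        using t by (simp add: powr_of_real)
      moreover have "(t powr \<alpha>) ^ k / Gamma (\<alpha> * real k + 1) = g_fun (\<alpha> * real k + 0 + 1) t"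
      proof (cases "t = 0")
        case True
        then show ?thesis using \<alpha> by (cases "k = 0") (auto simp: g_fun_def)
      next
        case False
        then have "(t powr \<alpha>) ^ k = t powr (\<alpha> * real k)"
          using t by (simp add: powr_powr[symmetric] powr_realpow)
        then show ?thesis using False t \<alpha> by (auto simp: g_fun_def)
      qed
      ultimately show ?thesis by (simp add: y_def scaleC_of_real flip: of_real_power)
    qed
    then show ?thesis by (simp add: U_def V_def mittag_leffler_def)
  qed
  show "vec_holomorphic_on U (UNIV - complex_of_real ` {..0})"
    unfolding vec_holomorphic_on_def
  proof
    fix z assume "z \<in> UNIV - complex_of_real ` {..0}"
    then have "z \<notin> \<real>\<^sub>\<le>\<^sub>0" by (auto simp: nonpos_Reals_def)
    then have "((\<lambda>z. z powr complex_of_real \<alpha>) has_field_derivative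
        complex_of_real \<alpha> * z powr (complex_of_real \<alpha> - 1)) (at z)"
      by (rule has_field_derivative_powr)
    from chain[OF this] show "\<exists>D. (U has_derivative (\<lambda>h. h *\<^sub>C D)) (at z within UNIV - complex_of_real ` {..0})"
      unfolding U_def[abs_def] by (meson has_derivative_at_withinI)
  qed
  show "vec_holomorphic_on U UNIV" if "\<alpha> \<in> \<nat>"
    unfolding vec_holomorphic_on_def
  proof
    fix z :: complex
    obtain N where N: "\<alpha> = of_nat N" using \<open>\<alpha> \<in> \<nat>\<close> by (auto elim: Nats_cases)
    then have "N > 0" using \<alpha> by simp
    then have "U = (\<lambda>z. V (z ^ N))"
      by (auto simp: U_def fun_eq_iff N powr_nat' zero_power)
    moreover have "((\<lambda>z. z ^ N) has_field_derivative of_nat N * z ^ (N - 1)) (at z)"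
      by (auto intro!: derivative_eq_intros)
    ultimately show "\<exists>D. (U has_derivative (\<lambda>h. h *\<^sub>C D)) (at z within UNIV)"
      using chain by auto
  qed
qed

section \<open>Integrals of continuous functions over the real line\<close>

lemma has_integral_UNIV_real_iff:
  fixes f :: "real \<Rightarrow> 'b::banach"
  assumes f: "continuous_on UNIV f"
  shows "(f has_integral i) UNIV \<longleftrightarrow>
    (\<forall>e>0. \<exists>B>0. \<forall>a b. a \<le> - B \<and> B \<le> b \<longrightarrow> norm (integral {a..b} f - i) < e)"
proof -
  have "f integrable_on {a..b}" for a b
    by (intro integrable_continuous_interval continuous_on_subset[OF f]) auto
  moreover have "ball 0 B \<subseteq> {a..b} \<longleftrightarrow> a \<le> - B \<and> B \<le> b" if "B > 0" for B a b :: real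
  proof
    assume *: "ball 0 B \<subseteq> {a..b}"
    have ball: "ball 0 B = {-B<..<B}" by (auto simp: dist_real_def)
    show "a \<le> - B \<and> B \<le> b"
      using * that unfolding ball greaterThanLessThan_subseteq_atLeastAtMost_iff by auto
  qed (auto simp: dist_real_def)
  ultimately show ?thesis
    by (subst has_integral_alt') (simp cong: conj_cong)
qed

text \<open>The integrals over growing intervals form a Cauchy family, since they differ by at most the tails
  of the integral of \<open>g\<close>.\<close>

lemma integrable_on_UNIV_dominated:
  fixes f :: "real \<Rightarrow> 'b::banach" and g :: "real \<Rightarrow> real"
  assumes f: "continuous_on UNIV f" and g: "continuous_on UNIV g"
    and int: "g integrable_on UNIV" and le: "\<And>x. norm (f x) \<le> g x"
  shows "f integrable_on UNIV"
proof -
  let ?I = "integral UNIV g"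
  have fi: "f integrable_on {a..b}" and gi: "g integrable_on {a..b}" for a b
    by (auto intro!: integrable_continuous_interval continuous_on_subset[OF f] continuous_on_subset[OF g])
  have diff: "norm (integral {a..b} f - integral {p..q} f) \<le> integral {a..b} g - integral {p..q} g"
    if "a \<le> p" "p \<le> q" "q \<le> b" for a b p q
  proof -
    have split: "integral {a..b} h = integral {a..p} h + integral {p..q} h + integral {q..b} h"
      if "\<And>a b. h integrable_on {a..b}" for h :: "real \<Rightarrow> 'c::banach"
      using Henstock_Kurzweil_Integration.integral_combine[OF _ _ that, of a p b]
        Henstock_Kurzweil_Integration.integral_combine[OF _ _ that, of p q b]
        \<open>a \<le> p\<close> \<open>p \<le> q\<close> \<open>q \<le> b\<close> by (simp add: add.assoc)
    have "integral {a..b} f - integral {p..q} f = integral {a..p} f + integral {q..b} f"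
      using split[OF fi] by simp
    also have "norm \<dots> \<le> integral {a..p} g + integral {q..b} g"
      by (intro norm_triangle_mono integral_norm_bound_integral fi gi le)
    finally show ?thesis using split[OF gi] by simp
  qed
  have cauchy: "\<exists>B>0. \<forall>a b. a \<le> - B \<and> B \<le> b \<longrightarrow> norm (integral {a..b} f - integral {-B..B} f) < e" if e: "e > 0" for e
  proof -
    have "(g has_integral ?I) UNIV" using int by (rule integrable_integral)
    then obtain B where B: "B > 0" "\<And>a b. a \<le> - B \<Longrightarrow> B \<le> b \<Longrightarrow> norm (integral {a..b} g - ?I) < e / 2"
      using e unfolding has_integral_UNIV_real_iff[OF g] by (meson half_gt_zero)
    have "norm (integral {a..b} f - integral {-B..B} f) < e" if "a \<le> -B" "B \<le> b" for a b
    proof -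
      have "norm (integral {a..b} f - integral {-B..B} f) \<le> integral {a..b} g - integral {-B..B} g"
        using that B(1) by (intro diff) auto
      also have "\<dots> < e" using B(2)[OF that] B(2)[of "-B" B] unfolding real_norm_def by linarith
      finally show ?thesis .
    qed
    then show ?thesis using B(1) by blast
  qed
  define X where "X n = integral {- real n..real n} f" for n
  have "Cauchy X"
  proof (rule metric_CauchyI)
    fix e :: real assume e: "e > 0"
    obtain B where B: "B > 0" "\<And>a b. a \<le> - B \<Longrightarrow> B \<le> b \<Longrightarrow> norm (integral {a..b} f - integral {-B..B} f) < e / 2"
      using cauchy[of "e / 2"] e by auto
    obtain N where N: "real N \<ge> B" using real_arch_simple by blast
    have "dist (X m) (X n) < e" if "m \<ge> N" "n \<ge> N" for m n
    proof -
      have "norm (X k - integral {-B..B} f) < e / 2" if "k \<ge> N" for k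
        unfolding X_def using N that by (intro B(2)) auto
      then show ?thesis using that dist_triangle_half_l[of "X m" "integral {-B..B} f" e "X n"] by (simp add: dist_norm)
    qed
    then show "\<exists>M. \<forall>m\<ge>M. \<forall>n\<ge>M. dist (X m) (X n) < e" by blast
  qed
  then obtain i where i: "X \<longlonglongrightarrow> i" using Cauchy_convergent_iff convergent_def by blast
  have "(f has_integral i) UNIV" unfolding has_integral_UNIV_real_iff[OF f]
  proof (intro allI impI)
    fix e :: real assume e: "e > 0"
    obtain B where B: "B > 0" "\<And>a b. a \<le> - B \<Longrightarrow> B \<le> b \<Longrightarrow> norm (integral {a..b} f - integral {-B..B} f) < e / 3"
      using cauchy[of "e / 3"] e by auto
    have "eventually (\<lambda>n. dist (X n) i < e / 3) sequentially" by (rule tendstoD[OF i]) (use e in simp)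
    then have "eventually (\<lambda>n. dist (X n) i < e / 3 \<and> real n \<ge> B) sequentially"
      by (rule eventually_conj) (rule eventually_ge_at_top[of "nat \<lceil>B\<rceil>", THEN eventually_mono], linarith)
    then obtain n where n: "dist (X n) i < e / 3" "real n \<ge> B" by (auto dest: eventually_happens)
    have "norm (integral {a..b} f - i) < e" if "a \<le> -B" "B \<le> b" for a b
    proof -
      have 1: "norm (integral {a..b} f - integral {-B..B} f) < e / 3" using B(2)[OF that] .
      have 2: "norm (X n - integral {-B..B} f) < e / 3" unfolding X_def using n by (intro B(2)) auto
      have "integral {a..b} f - i = (integral {a..b} f - integral {-B..B} f) - (X n - integral {-B..B} f) + (X n - i)" by simp
      also have "norm \<dots> \<le> norm (integral {a..b} f - integral {-B..B} f) + norm (X n - integral {-B..B} f) + norm (X n - i)"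
        by (meson norm_triangle_ineq norm_triangle_ineq4 add_mono order.refl order_trans)
      finally show ?thesis using 1 2 n(1) by (simp add: dist_norm)
    qed
    then show "\<exists>B>0. \<forall>a b. a \<le> - B \<and> B \<le> b \<longrightarrow> norm (integral {a..b} f - i) < e" using B(1) by blast
  qed
  then show ?thesis by blast
qed

lemma has_integral_UNIV_shift:
  fixes f :: "real \<Rightarrow> 'b::banach"
  assumes f: "continuous_on UNIV f" and int: "f integrable_on UNIV"
  shows "((\<lambda>x. f (x + c)) has_integral integral UNIV f) UNIV"
proof -
  have fc: "continuous_on UNIV (\<lambda>x. f (x + c))"
    by (rule continuous_on_compose2[OF f]) (auto intro!: continuous_intros)
  have *: "\<forall>e>0. \<exists>B>0. \<forall>a b. a \<le> - B \<and> B \<le> b \<longrightarrow> norm (integral {a..b} f - integral UNIV f) < e"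
    using integrable_integral[OF int] unfolding has_integral_UNIV_real_iff[OF f] .
  show "((\<lambda>x. f (x + c)) has_integral integral UNIV f) UNIV"
    unfolding has_integral_UNIV_real_iff[OF fc]
  proof (intro allI impI)
    fix e :: real assume "e > 0"
    with * obtain B where B: "B > 0" "\<And>a b. a \<le> - B \<Longrightarrow> B \<le> b \<Longrightarrow> norm (integral {a..b} f - integral UNIV f) < e" by blast
    have "norm (integral {a..b} (\<lambda>x. f (x + c)) - integral UNIV f) < e" if "a \<le> - (B + \<bar>c\<bar>)" "B + \<bar>c\<bar> \<le> b" for a b
    proof -
      have "integral {a..b} (\<lambda>x. f (x + c)) = integral {a + c..b + c} f"
        using integral_shift_Icc_real[of a b f c] by (simp add: o_def add.commute)
      then show ?thesis using B(2)[of "a + c" "b + c"] that by (simp add: algebra_simps)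
    qed
    then show "\<exists>B>0. \<forall>a b. a \<le> - B \<and> B \<le> b \<longrightarrow> norm (integral {a..b} (\<lambda>x. f (x + c)) - integral UNIV f) < e"
      using B(1) by (intro exI[of _ "B + \<bar>c\<bar>"]) auto
  qed
qed

lemma has_integral_Cauchy_density:
  assumes r: "r > 0"
  shows "((\<lambda>\<xi>. r / (1 + (r * \<xi>)\<^sup>2)) has_integral pi) UNIV"
proof -
  have nz: "1 + (r * \<xi>)\<^sup>2 \<noteq> 0" for \<xi> using zero_le_power2[of "r * \<xi>"] by linarith
  have cont: "continuous_on UNIV (\<lambda>\<xi>. r / (1 + (r * \<xi>)\<^sup>2))"
    using nz by (intro continuous_intros) auto
  have I: "integral {a..b} (\<lambda>\<xi>. r / (1 + (r * \<xi>)\<^sup>2)) = arctan (r * b) - arctan (r * a)" if "a \<le> b" for a b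
  proof (rule integral_unique, rule fundamental_theorem_of_calculus[OF that])
    fix x
    have "((\<lambda>\<xi>. arctan (r * \<xi>)) has_real_derivative r / (1 + (r * x)\<^sup>2)) (at x within {a..b})"
      by (auto intro!: derivative_eq_intros simp: field_simps)
    then show "((\<lambda>\<xi>. arctan (r * \<xi>)) has_vector_derivative r / (1 + (r * x)\<^sup>2)) (at x within {a..b})"
      by (simp add: has_real_derivative_iff_has_vector_derivative)
  qed
  show ?thesis unfolding has_integral_UNIV_real_iff[OF cont]
  proof (intro allI impI)
    fix e :: real assume e: "e > 0"
    have "eventually (\<lambda>x. dist (arctan x) (pi / 2) < e / 2) at_top"
      by (rule tendstoD[OF tendsto_arctan_at_top]) (use e in simp)
    then obtain B0 where "\<And>x. x \<ge> B0 \<Longrightarrow> dist (arctan x) (pi / 2) < e / 2"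
      by (auto simp: eventually_at_top_linorder)
    moreover define B where "B = max 1 B0 / r"
    ultimately have B: "B > 0" "\<And>x. x \<ge> B \<Longrightarrow> dist (arctan (r * x)) (pi / 2) < e / 2"
      using r by (auto simp: B_def field_simps)
    have "norm (integral {a..b} (\<lambda>\<xi>. r / (1 + (r * \<xi>)\<^sup>2)) - pi) < e" if "a \<le> - B" "B \<le> b" for a b
    proof -
      have "\<bar>arctan (r * b) - arctan (r * a) - pi\<bar> \<le> \<bar>arctan (r * b) - pi / 2\<bar> + \<bar>- arctan (r * a) - pi / 2\<bar>"
        by (rule order_trans[OF _ abs_triangle_ineq]) simp
      then show ?thesis
        using B(2)[of b] B(2)[of "-a"] that B(1) I[of a b] by (simp add: dist_real_def arctan_minus)
    qed
    then show "\<exists>B>0. \<forall>a b. a \<le> - B \<and> B \<le> b \<longrightarrow> norm (integral {a..b} (\<lambda>\<xi>. r / (1 + (r * \<xi>)\<^sup>2)) - pi) < e"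
      using B(1) by blast
  qed
qed

lemma continuous_on_Cauchy_density: "continuous_on S (\<lambda>\<xi>::real. r / (1 + (r * \<xi>)\<^sup>2))"
proof -
  have "1 + (r * \<xi>)\<^sup>2 \<noteq> 0" for \<xi> using zero_le_power2[of "r * \<xi>"] by linarith
  then show ?thesis by (intro continuous_intros) auto
qed

section \<open>Fourier transforms of the monomials on the unit interval\<close>

definition moment :: "nat \<Rightarrow> real \<Rightarrow> complex" where
  "moment k \<xi> = integral {0..1} (\<lambda>x. x ^ k *\<^sub>R cis (- (\<xi> * x)))"

lemma cis_has_vector_derivative:
  "((\<lambda>x. cis (- (\<xi> * x))) has_vector_derivative (- \<i> * \<xi>) * cis (- (\<xi> * x))) (at x within S)"
proof -
  have "((\<lambda>z. exp (- \<i> * \<xi> * z)) has_field_derivative (- \<i> * \<xi>) * exp (- \<i> * \<xi> * complex_of_real x)) (at (complex_of_real x))"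
    by (auto intro!: derivative_eq_intros)
  from has_vector_derivative_real_field[OF this, of S]
  show ?thesis by (simp add: cis_conv_exp mult.assoc)
qed

lemma norm_moment_le: "norm (moment k \<xi>) \<le> 1 / real (Suc k)"
proof -
  have "((\<lambda>x::real. x ^ k) has_integral 1 ^ Suc k / real (Suc k) - 0 ^ Suc k / real (Suc k)) {0..1}"
    by (rule fundamental_theorem_of_calculus)
       (auto intro!: derivative_eq_intros simp del: power_Suc simp flip: has_real_derivative_iff_has_vector_derivative)
  then have *: "((\<lambda>x::real. x ^ k) has_integral 1 / real (Suc k)) {0..1}" by simp
  have "norm (moment k \<xi>) \<le> integral {0..1} (\<lambda>x::real. x ^ k)"
    unfolding moment_def
    by (rule integral_norm_bound_integral)
       (use * in \<open>auto intro!: integrable_continuous_interval continuous_intros\<close>)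
  then show ?thesis using integral_unique[OF *] by simp
qed

lemma moment_by_parts:
  "(\<i> * \<xi>) * moment k \<xi> = of_nat k * moment (k - 1) \<xi> + 0 ^ k - cis (- \<xi>)"
proof -
  have "((\<lambda>x. of_nat k * (x ^ (k - 1) *\<^sub>R cis (- (\<xi> * x))) - (\<i> * \<xi>) * (x ^ k *\<^sub>R cis (- (\<xi> * x))))
      has_integral 1 ^ k *\<^sub>R cis (- (\<xi> * 1)) - 0 ^ k *\<^sub>R cis (- (\<xi> * 0))) {0..1}"
  proof (rule fundamental_theorem_of_calculus)
    fix x :: real
    have 1: "((\<lambda>x. x ^ k) has_vector_derivative of_nat k * x ^ (k - 1)) (at x within {0..1})"
      by (auto intro!: derivative_eq_intros simp flip: has_real_derivative_iff_has_vector_derivative)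
    have "((\<lambda>x. x ^ k *\<^sub>R cis (- (\<xi> * x))) has_vector_derivative
       (x ^ k *\<^sub>R ((- \<i> * \<xi>) * cis (- (\<xi> * x))) + (of_nat k * x ^ (k - 1)) *\<^sub>R cis (- (\<xi> * x)))) (at x within {0..1})"
      by (rule bounded_bilinear.has_vector_derivative[OF bounded_bilinear_scaleR 1 cis_has_vector_derivative])
    then show "((\<lambda>x. x ^ k *\<^sub>R cis (- (\<xi> * x))) has_vector_derivative
      of_nat k * (x ^ (k - 1) *\<^sub>R cis (- (\<xi> * x))) - (\<i> * \<xi>) * (x ^ k *\<^sub>R cis (- (\<xi> * x)))) (at x within {0..1})"
      by (simp add: scaleR_conv_of_real algebra_simps)
  qed simp
  from integral_unique[OF this]
  have eq: "integral {0..1} (\<lambda>x. of_nat k * (x ^ (k - 1) *\<^sub>R cis (- (\<xi> * x))) - (\<i> * \<xi>) * (x ^ k *\<^sub>R cis (- (\<xi> * x))))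
     = cis (- \<xi>) - 0 ^ k" by (simp add: scaleR_conv_of_real)
  have int: "(\<lambda>x. c * (x ^ j *\<^sub>R cis (- (\<xi> * x)))) integrable_on {0..1}" for c :: complex and j
    by (intro integrable_continuous_interval continuous_intros)
  have "of_nat k * moment (k - 1) \<xi> - (\<i> * \<xi>) * moment k \<xi> = cis (- \<xi>) - 0 ^ k"
    using eq unfolding integral_diff[OF int int] integral_mult_right moment_def .
  then show ?thesis by (simp add: algebra_simps)
qed

text \<open>Integration by parts leaves boundary values and \<open>k\<close> times the moment of order \<open>k - 1\<close>, which is at
  most \<open>1\<close>.\<close>

lemma norm_moment_decay: "\<bar>\<xi>\<bar> * norm (moment k \<xi>) \<le> 2"
proof -
  have "\<bar>\<xi>\<bar> * norm (moment k \<xi>) = norm ((\<i> * \<xi>) * moment k \<xi>)" by (simp add: norm_mult)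
  also have "\<dots> \<le> norm (of_nat k * moment (k - 1) \<xi> + 0 ^ k) + norm (cis (- \<xi>))"
    unfolding moment_by_parts by (rule norm_triangle_ineq4)
  also have "norm (of_nat k * moment (k - 1) \<xi> + 0 ^ k) \<le> 1"
  proof (cases k)
    case (Suc j)
    have "real k * norm (moment j \<xi>) \<le> real k * (1 / real (Suc j))"
      by (intro mult_left_mono norm_moment_le) auto
    then show ?thesis using Suc by (simp add: norm_mult norm_of_nat del: of_nat_Suc)
  qed simp
  finally show ?thesis by simp
qed

lemma norm_moment_product_le: "norm (moment k \<xi> * moment l \<xi>) \<le> 5 / (1 + \<xi>\<^sup>2)"
proof -
  have 1: "norm (moment j \<xi>) \<le> 1" for j
    by (rule order_trans[OF norm_moment_le]) simp
  have "norm (moment k \<xi> * moment l \<xi>) \<le> 1 * 1"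
    unfolding norm_mult by (intro mult_mono 1) auto
  moreover have "(\<bar>\<xi>\<bar> * norm (moment k \<xi>)) * (\<bar>\<xi>\<bar> * norm (moment l \<xi>)) \<le> 2 * 2"
    by (intro mult_mono norm_moment_decay) auto
  then have "\<xi>\<^sup>2 * norm (moment k \<xi> * moment l \<xi>) \<le> 4"
    by (simp add: norm_mult power2_eq_square mult_ac)
  ultimately have "(1 + \<xi>\<^sup>2) * norm (moment k \<xi> * moment l \<xi>) \<le> 5" by (simp add: distrib_right)
  moreover have "1 + \<xi>\<^sup>2 > 0" by (simp add: add_pos_nonneg)
  ultimately show ?thesis by (simp add: field_simps)
qed

lemma moment_has_vector_derivative:
  "(moment k has_vector_derivative - \<i> * moment (Suc k) \<xi>) (at \<xi>)"
proof -
  have "((\<lambda>\<xi>. integral (cbox 0 1) (\<lambda>x. x ^ k *\<^sub>R cis (- (\<xi> * x)))) has_vector_derivative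
      integral (cbox 0 1) (\<lambda>x. - \<i> * (x ^ Suc k *\<^sub>R cis (- (\<xi> * x))))) (at \<xi> within UNIV)"
  proof (rule leibniz_rule_vector_derivative)
    fix \<xi> x :: real
    have "((\<lambda>\<xi>. x ^ k *\<^sub>R cis (- (\<xi> * x))) has_vector_derivative x ^ k *\<^sub>R ((- \<i> * x) * cis (- (\<xi> * x)))) (at \<xi> within UNIV)"
      using cis_has_vector_derivative[of x \<xi> UNIV]
      by (intro bounded_linear.has_vector_derivative[OF bounded_linear_scaleR_right]) (simp add: mult.commute)
    then show "((\<lambda>\<xi>. x ^ k *\<^sub>R cis (- (\<xi> * x))) has_vector_derivative - \<i> * (x ^ Suc k *\<^sub>R cis (- (\<xi> * x)))) (at \<xi> within UNIV)"
      by (simp add: scaleR_conv_of_real mult_ac)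
  qed (auto intro!: integrable_continuous_interval continuous_intros simp: case_prod_unfold)
  moreover have "integral (cbox 0 1) (\<lambda>x. - \<i> * (x ^ Suc k *\<^sub>R cis (- (\<xi> * x)))) = - \<i> * moment (Suc k) \<xi>"
    unfolding moment_def cbox_interval by (rule integral_mult_right)
  ultimately show ?thesis unfolding moment_def[abs_def] cbox_interval by simp
qed

text \<open>Convolving the indicator function of \<open>[0, 1]\<close> with itself gives a hat function on \<open>[0, 2]\<close>; this is
  the transform of its product with \<open>x\<^sup>N\<close>. The binomial formula reduces the decay to that of the
  moments, which need a single integration by parts.\<close>

definition hat_transform :: "nat \<Rightarrow> real \<Rightarrow> complex" where
  "hat_transform N \<xi> = (\<Sum>k\<le>N. of_nat (N choose k) * (moment k \<xi> * moment (N - k) \<xi>))"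

lemma norm_hat_transform_le: "norm (hat_transform N \<xi>) \<le> 2 ^ N * (5 / (1 + \<xi>\<^sup>2))"
proof -
  have "norm (hat_transform N \<xi>) \<le> (\<Sum>k\<le>N. of_nat (N choose k) * (5 / (1 + \<xi>\<^sup>2)))"
    unfolding hat_transform_def
    by (rule sum_norm_le) (unfold norm_mult[of "of_nat _"] norm_of_nat, intro mult_left_mono norm_moment_product_le of_nat_0_le_iff)
  also have "\<dots> = (\<Sum>k\<le>N. of_nat (N choose k)) * (5 / (1 + \<xi>\<^sup>2))" by (simp only: sum_distrib_right of_nat_sum)
  also have "(\<Sum>k\<le>N. real (N choose k)) = 2 ^ N"
    using choose_row_sum[of N] by (metis of_nat_sum of_nat_power of_nat_numeral)
  finally show ?thesis .
qed

lemma hat_transform_has_vector_derivative: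
  "(hat_transform N has_vector_derivative - \<i> * hat_transform (Suc N) \<xi>) (at \<xi>)"
proof -
  let ?m = "\<lambda>k. moment k \<xi>"
  have "hat_transform (Suc N) \<xi> = ?m 0 * ?m (Suc N) +
      (\<Sum>k\<le>N. of_nat (Suc N choose Suc k) * (?m (Suc k) * ?m (N - k)))"
    unfolding hat_transform_def by (subst sum.atMost_Suc_shift) simp
  also have "\<dots> = (?m 0 * ?m (Suc N) + (\<Sum>k\<le>N. of_nat (N choose Suc k) * (?m (Suc k) * ?m (N - k))))
      + (\<Sum>k\<le>N. of_nat (N choose k) * (?m (Suc k) * ?m (N - k)))"
    by (simp add: algebra_simps sum.distrib)
  also have "?m 0 * ?m (Suc N) + (\<Sum>k\<le>N. of_nat (N choose Suc k) * (?m (Suc k) * ?m (N - k)))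
      = (\<Sum>k\<le>Suc N. of_nat (N choose k) * (?m k * ?m (Suc N - k)))"
    by (subst sum.atMost_Suc_shift) simp
  also have "\<dots> = (\<Sum>k\<le>N. of_nat (N choose k) * (?m k * ?m (Suc (N - k))))"
    by (simp add: Suc_diff_le)
  finally have eq: "hat_transform (Suc N) \<xi> = (\<Sum>k\<le>N. of_nat (N choose k) * (?m k * ?m (Suc (N - k)) + ?m (Suc k) * ?m (N - k)))"
    by (simp add: sum.distrib algebra_simps)
  have "(hat_transform N has_vector_derivative
      (\<Sum>k\<le>N. of_nat (N choose k) * (?m k * (- \<i> * ?m (Suc (N - k))) + (- \<i> * ?m (Suc k)) * ?m (N - k)))) (at \<xi>)"
    unfolding hat_transform_def[abs_def]
    by (intro has_vector_derivative_sum has_vector_derivative_mult_right has_vector_derivative_mult moment_has_vector_derivative)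
  then show ?thesis unfolding eq sum_distrib_left by (simp add: algebra_simps)
qed

text \<open>The interval \<open>[0, 2]\<close> consists of \<open>[0, 1]\<close> and its translate by \<open>1\<close>.\<close>

lemma moment_0_double: "moment 0 (2 * \<xi>) = (1 + cis (- \<xi>)) / 2 * moment 0 \<xi>"
proof (cases "\<xi> = 0")
  case True
  then show ?thesis by simp
next
  case False
  have "(2 * \<i> * \<xi>) * moment 0 (2 * \<xi>) = 1 - cis (- (2 * \<xi>))"
    using moment_by_parts[of "2 * \<xi>" 0] by (simp add: mult_ac)
  also have "\<dots> = (1 + cis (- \<xi>)) * (1 - cis (- \<xi>))"
    by (simp add: algebra_simps cis_mult)
  also have "1 - cis (- \<xi>) = (\<i> * \<xi>) * moment 0 \<xi>"
    using moment_by_parts[of \<xi> 0] by simp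
  finally have "(2 * \<i> * \<xi>) * moment 0 (2 * \<xi>) = (2 * \<i> * \<xi>) * ((1 + cis (- \<xi>)) / 2 * moment 0 \<xi>)"
    by simp
  then show ?thesis using False by (subst (asm) mult_cancel_left) auto
qed

lemma hat_transform_0: "hat_transform 0 \<xi> = (moment 0 \<xi>)\<^sup>2"
  by (simp add: hat_transform_def power2_eq_square)

lemma hat_transform_0_double:
  "hat_transform 0 (2 * \<xi>) = (1 + 2 * cis (- \<xi>) + cis (- (2 * \<xi>))) / 4 * hat_transform 0 \<xi>"
proof -
  have "(1 + cis (- \<xi>))\<^sup>2 = 1 + 2 * cis (- \<xi>) + cis (- (2 * \<xi>))"
    by (simp add: power2_eq_square algebra_simps cis_mult)
  then show ?thesis by (simp add: hat_transform_0 moment_0_double power_mult_distrib power_divide)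
qed

text \<open>The kernel of the hat function on \<open>[a, a + 2 r]\<close> times \<open>((x - a) / r)\<^sup>N\<close>.\<close>

definition hat_kernel :: "real \<Rightarrow> real \<Rightarrow> nat \<Rightarrow> real \<Rightarrow> complex" where
  "hat_kernel a r N \<xi> = r * hat_transform N (r * \<xi>) * cis (- (a * \<xi>))"

lemma norm_hat_kernel_le: "r > 0 \<Longrightarrow> norm (hat_kernel a r N \<xi>) \<le> 5 * 2 ^ N * (r / (1 + (r * \<xi>)\<^sup>2))"
  using mult_left_mono[OF norm_hat_transform_le[of N "r * \<xi>"], of r]
  by (simp add: hat_kernel_def norm_mult mult_ac)

text \<open>Differentiation multiplies the transformed function by \<open>- \<i> x\<close>, and \<open>x = a + r ((x - a) / r)\<close>.\<close>

lemma hat_kernel_has_vector_derivative: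
  "(hat_kernel a r N has_vector_derivative
     - \<i> * (r * hat_kernel a r (Suc N) \<xi> + a * hat_kernel a r N \<xi>)) (at \<xi>)"
proof -
  have "((\<lambda>\<xi>. r * \<xi>) has_vector_derivative r) (at \<xi>)"
    by (auto intro!: derivative_eq_intros)
  then have "(hat_transform N \<circ> (\<lambda>\<xi>. r * \<xi>) has_vector_derivative r *\<^sub>R (- \<i> * hat_transform (Suc N) (r * \<xi>))) (at \<xi>)"
    by (rule vector_diff_chain_at) (rule hat_transform_has_vector_derivative)
  then have "((\<lambda>\<xi>. of_real r * hat_transform N (r * \<xi>)) has_vector_derivative
      of_real r * (r *\<^sub>R (- \<i> * hat_transform (Suc N) (r * \<xi>)))) (at \<xi>)"
    unfolding o_def by (rule has_vector_derivative_mult_right)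
  from has_vector_derivative_mult[OF this cis_has_vector_derivative[of a \<xi> UNIV]]
  show ?thesis unfolding hat_kernel_def[abs_def]
    by (simp add: scaleR_conv_of_real algebra_simps)
qed

lemma continuous_on_hat_kernel: "continuous_on S (hat_kernel a r N)"
  using hat_kernel_has_vector_derivative has_vector_derivative_continuous
  by (metis continuous_at_imp_continuous_on)

text \<open>The hat function of width \<open>2 r\<close> is the sum of three hat functions of half that width, with weights
  \<open>1/2\<close>, \<open>1\<close>, \<open>1/2\<close>.\<close>

lemma hat_kernel_refine:
  "hat_kernel a (2 * r) 0 \<xi> =
    hat_kernel a r 0 \<xi> / 2 + hat_kernel (a + r) r 0 \<xi> + hat_kernel (a + 2 * r) r 0 \<xi> / 2"
proof -
  have "cis (- ((a + r) * \<xi>)) = cis (- (r * \<xi>)) * cis (- (a * \<xi>))"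
    "cis (- ((a + 2 * r) * \<xi>)) = cis (- (2 * (r * \<xi>))) * cis (- (a * \<xi>))"
    by (simp_all add: cis_mult algebra_simps)
  moreover have "2 * r * \<xi> = 2 * (r * \<xi>)" by simp
  ultimately show ?thesis
    unfolding hat_kernel_def hat_transform_0_double[of "r * \<xi>", folded \<open>2 * r * \<xi> = 2 * (r * \<xi>)\<close>]
    by (simp add: algebra_simps add_divide_distrib)
qed

section \<open>Averages of a bounded group\<close>

text \<open>The majorant has the integral \<open>c \<pi>\<close> for every \<open>r\<close>, which makes the averages below bounded uniformly in
  the width of the band.\<close>

definition dominated_kernel :: "real \<Rightarrow> real \<Rightarrow> (real \<Rightarrow> complex) \<Rightarrow> bool" where
  "dominated_kernel c r k \<longleftrightarrow> r > 0 \<and> continuous_on UNIV k \<and> (\<forall>\<xi>. norm (k \<xi>) \<le> c * (r / (1 + (r * \<xi>)\<^sup>2)))"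

lemma dominated_kernel_nonneg: "dominated_kernel c r k \<Longrightarrow> c \<ge> 0"
proof -
  assume "dominated_kernel c r k"
  then have "r > 0" "norm (k 0) \<le> c * (r / (1 + (r * 0)\<^sup>2))" unfolding dominated_kernel_def by blast+
  then have "0 \<le> c * r" by (intro order_trans[OF norm_ge_zero, of "k 0"]) simp
  then show "c \<ge> 0" using \<open>r > 0\<close> by (simp add: zero_le_mult_iff)
qed

lemma dominated_hat_kernel: "r > 0 \<Longrightarrow> dominated_kernel (5 * 2 ^ N) r (hat_kernel a r N)"
  unfolding dominated_kernel_def using norm_hat_kernel_le continuous_on_hat_kernel by blast

lemma dominated_kernel_add:
  assumes "dominated_kernel c r k" "dominated_kernel d r l"
  shows "dominated_kernel (c + d) r (\<lambda>\<xi>. k \<xi> + l \<xi>)"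
  unfolding dominated_kernel_def distrib_right
proof (intro conjI allI)
  show "continuous_on UNIV (\<lambda>\<xi>. k \<xi> + l \<xi>)"
    using assms unfolding dominated_kernel_def by (intro continuous_on_add) blast+
  show "norm (k \<xi> + l \<xi>) \<le> c * (r / (1 + (r * \<xi>)\<^sup>2)) + d * (r / (1 + (r * \<xi>)\<^sup>2))" for \<xi>
    using assms unfolding dominated_kernel_def by (intro norm_triangle_mono) blast+
qed (use assms in \<open>simp add: dominated_kernel_def\<close>)

lemma dominated_kernel_mult:
  assumes "dominated_kernel c r k"
  shows "dominated_kernel (norm b * c) r (\<lambda>\<xi>. b * k \<xi>)"
  unfolding dominated_kernel_def
proof (intro conjI allI)
  show "continuous_on UNIV (\<lambda>\<xi>. b * k \<xi>)"
    using assms unfolding dominated_kernel_def by (intro continuous_on_mult_left) blast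
  show "norm (b * k \<xi>) \<le> norm b * c * (r / (1 + (r * \<xi>)\<^sup>2))" for \<xi>
    using assms unfolding dominated_kernel_def norm_mult mult.assoc by (intro mult_left_mono) auto
qed (use assms in \<open>simp add: dominated_kernel_def\<close>)

lemma dominated_kernel_shift:
  assumes k: "dominated_kernel c r k" and h: "\<bar>h\<bar> \<le> 1"
  shows "norm (k (\<xi> + h)) \<le> c * (2 + 2 * r\<^sup>2) * (r / (1 + (r * \<xi>)\<^sup>2))"
proof -
  have r: "r > 0" and c: "c \<ge> 0" using k dominated_kernel_nonneg by (auto simp: dominated_kernel_def)
  have "\<xi>\<^sup>2 \<le> 2 * (\<xi> + h)\<^sup>2 + 2 * h\<^sup>2"
    using zero_le_power2[of "\<xi> + 2 * h"] by (simp add: power2_eq_square algebra_simps)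
  moreover have "h\<^sup>2 \<le> 1" using h by (simp add: abs_square_le_1)
  ultimately have "\<xi>\<^sup>2 \<le> 2 * (\<xi> + h)\<^sup>2 + 2" by linarith
  then have 1: "r\<^sup>2 * \<xi>\<^sup>2 \<le> r\<^sup>2 * (2 * (\<xi> + h)\<^sup>2 + 2)" by (rule mult_left_mono) simp
  define s where "s = (r * (\<xi> + h))\<^sup>2"
  have s: "s = r\<^sup>2 * (\<xi> + h)\<^sup>2" by (simp only: s_def power_mult_distrib)
  have "0 \<le> r\<^sup>2 * s" by (simp add: s_def)
  moreover have "r\<^sup>2 * \<xi>\<^sup>2 \<le> 2 * s + 2 * r\<^sup>2" using 1 unfolding s distrib_left by (simp add: mult_ac)
  ultimately have "1 + r\<^sup>2 * \<xi>\<^sup>2 \<le> (2 + 2 * r\<^sup>2) * (1 + s)" by (simp add: algebra_simps)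
  then have le: "1 + (r * \<xi>)\<^sup>2 \<le> (2 + 2 * r\<^sup>2) * (1 + (r * (\<xi> + h))\<^sup>2)"
    by (simp only: s_def power_mult_distrib)
  have pos: "1 + (r * x)\<^sup>2 > 0" for x by (simp add: add_pos_nonneg)
  have "r / (1 + (r * (\<xi> + h))\<^sup>2) \<le> (2 + 2 * r\<^sup>2) * (r / (1 + (r * \<xi>)\<^sup>2))"
    using mult_left_mono[OF le, of r] r pos[of \<xi>] pos[of "\<xi> + h"]
    by (simp add: divide_le_eq pos_le_divide_eq mult_ac)
  then have "c * (r / (1 + (r * (\<xi> + h))\<^sup>2)) \<le> c * ((2 + 2 * r\<^sup>2) * (r / (1 + (r * \<xi>)\<^sup>2)))"
    by (rule mult_left_mono) (rule c)
  moreover have "norm (k (\<xi> + h)) \<le> c * (r / (1 + (r * (\<xi> + h))\<^sup>2))" using k by (simp add: dominated_kernel_def)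
  ultimately show ?thesis by (simp add: mult.assoc)
qed

locale bounded_group =
  fixes T :: "real \<Rightarrow> 'a::complex_banach \<Rightarrow> 'a" and M :: real
  assumes group: "bounded_C0_group T" and M: "M \<ge> 0" and bound: "\<And>t x. norm (T t x) \<le> M * norm x"
begin

lemma T_linear: "bounded_linear (T t)"
  and T_scaleC: "T t (c *\<^sub>C x) = c *\<^sub>C T t x"
  and T_0: "T 0 x = x"
  and T_add: "T (s + t) x = T s (T t x)"
  and T_tendsto: "((\<lambda>t. T t x) \<longlongrightarrow> x) (at 0)"
  using group by (auto simp: bounded_C0_group_def)

lemma T_continuous: "continuous_on UNIV (\<lambda>t. T t x)"
proof (rule continuous_at_imp_continuous_on, rule ballI)
  fix s
  interpret bounded_linear "T s" by (rule T_linear)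
  have "((\<lambda>h. T s (T h x)) \<longlongrightarrow> T s x) (at 0)" by (rule tendsto[OF T_tendsto])
  then show "isCont (\<lambda>t. T t x) s" unfolding isCont_iff by (simp add: T_add)
qed

text \<open>If \<open>T \<xi> = exp (\<i> \<xi> A)\<close> and \<open>k\<close> is the Fourier transform of \<open>f\<close>, then this is \<open>2 \<pi> f(A)\<close>.\<close>

definition avg :: "(real \<Rightarrow> complex) \<Rightarrow> 'a \<Rightarrow> 'a" where
  "avg k x = integral UNIV (\<lambda>\<xi>. k \<xi> *\<^sub>C T \<xi> x)"

lemma continuous_avg_integrand: "continuous_on UNIV k \<Longrightarrow> continuous_on UNIV (\<lambda>\<xi>. k \<xi> *\<^sub>C T \<xi> x)"
  by (rule scaleC.continuous_on[OF _ T_continuous])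

lemma
  assumes k: "dominated_kernel c r k"
  shows avg_integrable: "(\<lambda>\<xi>. k \<xi> *\<^sub>C T \<xi> x) integrable_on UNIV"
    and norm_avg_le: "norm (avg k x) \<le> c * pi * M * norm x"
proof -
  have r: "r > 0" and kc: "continuous_on UNIV k" and c: "c \<ge> 0"
    and kb: "\<And>\<xi>. norm (k \<xi>) \<le> c * (r / (1 + (r * \<xi>)\<^sup>2))"
    using k dominated_kernel_nonneg by (auto simp: dominated_kernel_def)
  let ?g = "\<lambda>\<xi>. c * M * norm x * (r / (1 + (r * \<xi>)\<^sup>2))"
  have g: "(?g has_integral c * M * norm x * pi) UNIV"
    by (rule has_integral_mult_right[OF has_integral_Cauchy_density[OF r]])
  have le: "norm (k \<xi> *\<^sub>C T \<xi> x) \<le> ?g \<xi>" for \<xi>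
  proof -
    have "norm (k \<xi> *\<^sub>C T \<xi> x) \<le> (c * (r / (1 + (r * \<xi>)\<^sup>2))) * (M * norm x)"
      unfolding norm_scaleC
    proof (rule mult_mono[OF kb bound])
      show "0 \<le> c * (r / (1 + (r * \<xi>)\<^sup>2))" by (rule order_trans[OF norm_ge_zero kb])
    qed simp
    then show ?thesis by (simp add: mult_ac)
  qed
  show int: "(\<lambda>\<xi>. k \<xi> *\<^sub>C T \<xi> x) integrable_on UNIV"
  proof (rule integrable_on_UNIV_dominated[OF continuous_avg_integrand[OF kc] _ _ le])
    show "continuous_on UNIV ?g" by (intro continuous_on_mult_left continuous_on_Cauchy_density)
    show "?g integrable_on UNIV" using g by (rule has_integral_integrable)
  qed
  have "norm (avg k x) \<le> integral UNIV ?g" unfolding avg_def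
    by (rule integral_norm_bound_integral[OF int has_integral_integrable[OF g] le])
  then show "norm (avg k x) \<le> c * pi * M * norm x"
    unfolding integral_unique[OF g] by (simp add: mult_ac)
qed

lemma avg_commute:
  assumes k: "dominated_kernel c r k" and L: "bounded_linear L"
    and "\<And>c x. L (c *\<^sub>C x) = c *\<^sub>C L x" and "\<And>\<xi> x. L (T \<xi> x) = T \<xi> (L x)"
  shows "L (avg k x) = avg k (L x)"
  using integral_linear[OF avg_integrable[OF k] L, of x] assms(3,4) by (simp add: avg_def o_def)

lemma avg_add_kernel:
  assumes "dominated_kernel c r k" "dominated_kernel d r l"
  shows "avg (\<lambda>\<xi>. k \<xi> + l \<xi>) x = avg k x + avg l x"
  unfolding avg_def scaleC_add_left
  by (rule integral_add) (use assms avg_integrable in blast)+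

lemma avg_mult_kernel:
  assumes "dominated_kernel c r k"
  shows "avg (\<lambda>\<xi>. b * k \<xi>) x = b *\<^sub>C avg k x"
  using integral_linear[OF avg_integrable[OF assms] scaleC.bounded_linear_right, of b x]
  by (simp add: avg_def o_def scaleC_scaleC)

lemma bounded_linear_avg:
  assumes k: "dominated_kernel c r k"
  shows "bounded_linear (avg k)"
proof (rule bounded_linear_intro)
  fix x y :: 'a and s :: real
  interpret T: bounded_linear "T t" for t by (rule T_linear)
  show "avg k (x + y) = avg k x + avg k y"
    unfolding avg_def T.add scaleC_add_right by (rule integral_add) (rule avg_integrable[OF k])+
  show "avg k (s *\<^sub>R x) = s *\<^sub>R avg k x"
    unfolding avg_def T.scaleR scaleC.scaleR_right by (rule integral_cmul)
  show "norm (avg k x) \<le> norm x * (c * pi * M)"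
    using norm_avg_le[OF k] by (simp add: mult_ac)
qed

lemma avg_scaleC:
  assumes k: "dominated_kernel c r k"
  shows "avg k (b *\<^sub>C x) = b *\<^sub>C avg k x"
  by (rule avg_commute[OF k scaleC.bounded_linear_right, symmetric])
     (simp_all add: T_scaleC scaleC_scaleC mult.commute)

lemma T_avg_has_integral:
  assumes k: "dominated_kernel c r k"
  shows "((\<lambda>\<xi>. k (\<xi> - h) *\<^sub>C T \<xi> x) has_integral T h (avg k x)) UNIV"
proof -
  have kc: "continuous_on UNIV k" using k by (simp add: dominated_kernel_def)
  have "((\<lambda>\<xi>. (\<lambda>\<xi>. k \<xi> *\<^sub>C T \<xi> (T h x)) (\<xi> + (- h))) has_integral avg k (T h x)) UNIV"
    unfolding avg_def
    by (rule has_integral_UNIV_shift[OF continuous_avg_integrand[OF kc] avg_integrable[OF k]])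
  moreover have "T h (avg k x) = avg k (T h x)"
    by (rule avg_commute[OF k T_linear]) (simp_all add: T_scaleC add.commute flip: T_add)
  ultimately show ?thesis by (simp flip: T_add)
qed

text \<open>Translating the average by the group translates the kernel, so that the difference quotient falls on
  the kernel; the second derivative controls the error.\<close>

lemma avg_in_generator:
  assumes k: "dominated_kernel c r k" and k': "dominated_kernel c' r k'" and k'': "dominated_kernel c'' r k''"
    and der: "\<And>\<xi>. (k has_vector_derivative k' \<xi>) (at \<xi>)"
    and der': "\<And>\<xi>. (k' has_vector_derivative k'' \<xi>) (at \<xi>)"
  shows "(avg k x, - avg k' x) \<in> group_generator T"
proof -
  define K where "K = c'' * (2 + 2 * r\<^sup>2) * pi * M * norm x"
  have r: "r > 0" using k by (simp add: dominated_kernel_def)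
  have est: "norm (T h (avg k x) - avg k x + h *\<^sub>R avg k' x) \<le> h\<^sup>2 * K" if h: "\<bar>h\<bar> \<le> 1" for h
  proof -
    define e where "e \<xi> = k (\<xi> - h) - k \<xi> + h * k' \<xi>" for \<xi>
    have "((\<lambda>\<xi>. k (\<xi> - h) *\<^sub>C T \<xi> x - k \<xi> *\<^sub>C T \<xi> x + h *\<^sub>R (k' \<xi> *\<^sub>C T \<xi> x)) has_integral
        T h (avg k x) - avg k x + h *\<^sub>R avg k' x) UNIV"
      using integrable_integral[OF avg_integrable[OF k, of x]] integrable_integral[OF avg_integrable[OF k', of x]]
      by (intro has_integral_add has_integral_diff has_integral_cmul T_avg_has_integral[OF k]) (simp_all add: avg_def)
    moreover have "k (\<xi> - h) *\<^sub>C T \<xi> x - k \<xi> *\<^sub>C T \<xi> x + h *\<^sub>R (k' \<xi> *\<^sub>C T \<xi> x) = e \<xi> *\<^sub>C T \<xi> x" for \<xi>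
      by (simp add: e_def scaleC_add_left scaleC.diff_left scaleC_scaleC flip: scaleC_of_real)
    ultimately have avg_e: "avg e x = T h (avg k x) - avg k x + h *\<^sub>R avg k' x"
      unfolding avg_def by (auto intro: integral_unique)
    have dom_e: "dominated_kernel (h\<^sup>2 * (c'' * (2 + 2 * r\<^sup>2))) r e"
      unfolding dominated_kernel_def
    proof (intro conjI allI r)
      have ck: "continuous_on UNIV k" and ck': "continuous_on UNIV k'"
        using k k' by (auto simp: dominated_kernel_def)
      show "continuous_on UNIV e" unfolding e_def
        by (intro continuous_intros ck' continuous_on_compose2[OF ck]) auto
      fix \<xi>
      define B where "B = c'' * (2 + 2 * r\<^sup>2) * (r / (1 + (r * \<xi>)\<^sup>2))"
      define S where "S = closed_segment \<xi> (\<xi> - h)"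
      have S: "\<bar>\<eta> - \<xi>\<bar> \<le> \<bar>h\<bar>" if "\<eta> \<in> S" for \<eta>
        using that by (auto simp: S_def closed_segment_eq_real_ivl split: if_splits)
      have B: "norm (k'' \<eta>) \<le> B" if "\<eta> \<in> S" for \<eta>
        using dominated_kernel_shift[OF k'', of "\<eta> - \<xi>" \<xi>] S[OF that] h by (simp add: B_def)
      have B0: "B \<ge> 0" by (rule order_trans[OF norm_ge_zero B[of \<xi>]]) (simp add: S_def)
      have "norm (k' \<eta> - k' \<xi>) \<le> B * \<bar>h\<bar>" if \<eta>: "\<eta> \<in> S" for \<eta>
      proof -
        have "norm (k' \<eta> - k' \<xi>) \<le> B * norm (\<eta> - \<xi>)"
        proof (rule differentiable_bound[where f' = "\<lambda>\<eta> t. t *\<^sub>R k'' \<eta>"])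
          show "convex S" by (simp add: S_def)
          show "(k' has_derivative (\<lambda>t. t *\<^sub>R k'' \<zeta>)) (at \<zeta> within S)" for \<zeta>
            using der'[of \<zeta>] unfolding has_vector_derivative_def by (rule has_derivative_at_withinI)
          show "onorm (\<lambda>t. t *\<^sub>R k'' \<zeta>) \<le> B" if "\<zeta> \<in> S" for \<zeta>
            by (rule onorm_le) (use B[OF that] in \<open>auto simp: mult.commute[of B] intro: mult_left_mono\<close>)
        qed (use \<eta> in \<open>auto simp: S_def\<close>)
        also have "\<dots> \<le> B * \<bar>h\<bar>" using S[OF \<eta>] B0 by (intro mult_left_mono) auto
        finally show ?thesis .
      qed
      then have "norm (k (\<xi> - h) - k \<xi> - ((\<xi> - h) - \<xi>) *\<^sub>R k' \<xi>) \<le> norm ((\<xi> - h) - \<xi>) * (B * \<bar>h\<bar>)"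
        by (intro vector_differentiable_bound_linearization[where S = S])
           (use der in \<open>auto simp: S_def intro: has_vector_derivative_at_within\<close>)
      then have "norm (e \<xi>) \<le> \<bar>h\<bar> * (B * \<bar>h\<bar>)" by (simp add: e_def scaleR_conv_of_real)
      also have "\<dots> = h\<^sup>2 * (c'' * (2 + 2 * r\<^sup>2)) * (r / (1 + (r * \<xi>)\<^sup>2))"
        by (simp add: B_def power2_eq_square mult_ac flip: abs_mult)
      finally show "norm (e \<xi>) \<le> h\<^sup>2 * (c'' * (2 + 2 * r\<^sup>2)) * (r / (1 + (r * \<xi>)\<^sup>2))" .
    qed
    show ?thesis
      using norm_avg_le[OF dom_e, of x] unfolding avg_e K_def by (simp only: mult.assoc)
  qed
  have "((\<lambda>h. (T h (avg k x) - avg k x) /\<^sub>R h - (- avg k' x)) \<longlongrightarrow> 0) (at 0)"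
  proof (rule Lim_null_comparison)
    show "((\<lambda>h. \<bar>h\<bar> * K) \<longlongrightarrow> 0) (at (0::real))" by (auto intro!: tendsto_eq_intros)
    have "norm ((T h (avg k x) - avg k x) /\<^sub>R h - (- avg k' x)) \<le> \<bar>h\<bar> * K" if "h \<noteq> 0" "\<bar>h\<bar> \<le> 1" for h
    proof -
      have "(T h (avg k x) - avg k x) /\<^sub>R h - (- avg k' x) = (T h (avg k x) - avg k x + h *\<^sub>R avg k' x) /\<^sub>R h"
        using that by (simp add: scaleR_add_right)
      also have "norm \<dots> \<le> h\<^sup>2 * K / \<bar>h\<bar>"
        using divide_right_mono[OF est[OF that(2)], of "\<bar>h\<bar>"] by (simp add: divide_inverse mult.commute)
      also have "\<dots> = \<bar>h\<bar> * K"
      proof -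
        have "h\<^sup>2 = \<bar>h\<bar> * \<bar>h\<bar>" by (simp add: power2_eq_square)
        moreover have "c * c * K / c = c * K" if "c \<noteq> 0" for c :: real using that by simp
        ultimately show ?thesis using that by (simp only: abs_eq_0 not_False_eq_True)
      qed
      finally show ?thesis .
    qed
    then show "\<forall>\<^sub>F h in at 0. norm ((T h (avg k x) - avg k x) /\<^sub>R h - (- avg k' x)) \<le> \<bar>h\<bar> * K"
      unfolding eventually_at by (intro exI[of _ 1]) auto
  qed
  from Lim_null[THEN iffD2, OF this] show ?thesis by (simp add: group_generator_def)
qed

text \<open>Up to the factor \<open>2 \<pi>\<close> this is \<open>f(A)\<close> for the hat function on \<open>[a, a + 2 r]\<close> times \<open>((x - a) / r)\<^sup>N\<close>: it
  cuts out the part of the space where \<open>A\<close> is close to \<open>a\<close>.\<close>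

definition band :: "real \<Rightarrow> real \<Rightarrow> nat \<Rightarrow> 'a \<Rightarrow> 'a" where
  "band a r N = avg (hat_kernel a r N)"

lemma norm_band_le: "r > 0 \<Longrightarrow> norm (band a r N x) \<le> 5 * 2 ^ N * pi * M * norm x"
  unfolding band_def by (rule norm_avg_le[OF dominated_hat_kernel])

text \<open>Formally the generator is \<open>\<i> A\<close>, and \<open>x = a + r ((x - a) / r)\<close> raises the exponent \<open>N\<close> by one.\<close>

lemma band_in_generator:
  assumes r: "r > 0"
  shows "(band a r N x, \<i> *\<^sub>C (a *\<^sub>R band a r N x + r *\<^sub>R band a r (Suc N) x)) \<in> group_generator T"
proof -
  let ?k = "\<lambda>N \<xi>. (- \<i> * r) * hat_kernel a r (Suc N) \<xi> + (- \<i> * a) * hat_kernel a r N \<xi>"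
  let ?k2 = "\<lambda>\<xi>. (- \<i> * r) * ?k (Suc N) \<xi> + (- \<i> * a) * ?k N \<xi>"
  note dom = dominated_kernel_add[OF dominated_kernel_mult dominated_kernel_mult]
  have d: "(hat_kernel a r N has_vector_derivative ?k N \<xi>) (at \<xi>)" for N \<xi>
    using hat_kernel_has_vector_derivative[of a r N \<xi>] by (simp add: algebra_simps)
  have "(avg (hat_kernel a r N) x, - avg (?k N) x) \<in> group_generator T"
  proof (rule avg_in_generator[where k'' = ?k2])
    show "(?k N has_vector_derivative ?k2 \<xi>) (at \<xi>)" for \<xi>
      by (intro has_vector_derivative_add has_vector_derivative_mult_right d)
  qed (rule dominated_hat_kernel[OF r] dom d)+
  moreover have "- avg (?k N) x = \<i> *\<^sub>C (a *\<^sub>R band a r N x + r *\<^sub>R band a r (Suc N) x)"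
  proof -
    have "avg (?k N) x = (- \<i> * r) *\<^sub>C band a r (Suc N) x + (- \<i> * a) *\<^sub>C band a r N x"
      unfolding band_def
      by (simp only: avg_add_kernel[OF dominated_kernel_mult dominated_kernel_mult] dominated_hat_kernel[OF r]
          avg_add_kernel[OF dominated_kernel_mult[OF dominated_hat_kernel[OF r]] dominated_kernel_mult[OF dominated_hat_kernel[OF r]]]
          avg_mult_kernel[OF dominated_hat_kernel[OF r]])
    then show ?thesis
      by (simp add: scaleC_add_right scaleC_scaleC scaleC.minus_left add.commute flip: scaleC_of_real)
  qed
  ultimately show ?thesis by (simp add: band_def)
qed

lemma bounded_linear_band: "r > 0 \<Longrightarrow> bounded_linear (band a r N)"
  unfolding band_def by (rule bounded_linear_avg[OF dominated_hat_kernel])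

lemma band_scaleC: "r > 0 \<Longrightarrow> band a r N (b *\<^sub>C x) = b *\<^sub>C band a r N x"
  unfolding band_def by (rule avg_scaleC[OF dominated_hat_kernel])

lemma band_commute:
  assumes "r > 0" "bounded_linear L" "\<And>c x. L (c *\<^sub>C x) = c *\<^sub>C L x" "\<And>\<xi> x. L (T \<xi> x) = T \<xi> (L x)"
  shows "L (band a r N x) = band a r N (L x)"
  unfolding band_def by (rule avg_commute[OF dominated_hat_kernel assms(2-4)]) (use assms(1) in auto)

lemma band_refine:
  assumes r: "r > 0"
  shows "band a (2 * r) 0 x = (1/2) *\<^sub>R band a r 0 x + band (a + r) r 0 x + (1/2) *\<^sub>R band (a + 2 * r) r 0 x"
proof -
  define k1 k2 k3 where "k1 = hat_kernel a r 0" and "k2 = hat_kernel (a + r) r 0" and "k3 = hat_kernel (a + 2 * r) r 0"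
  note defs = k1_def k2_def k3_def
  have dom: "dominated_kernel 5 r k1" "dominated_kernel 5 r k2" "dominated_kernel 5 r k3"
    using dominated_hat_kernel[OF r, of 0] by (auto simp: defs)
  have "hat_kernel a (2 * r) 0 = (\<lambda>\<xi>. ((1/2) * k1 \<xi> + k2 \<xi>) + (1/2) * k3 \<xi>)"
    by (auto simp: hat_kernel_refine defs)
  moreover have "avg (\<lambda>\<xi>. ((1/2) * k1 \<xi> + k2 \<xi>) + (1/2) * k3 \<xi>) x
      = ((1/2) *\<^sub>C avg k1 x + avg k2 x) + (1/2) *\<^sub>C avg k3 x"
    unfolding avg_add_kernel[OF dominated_kernel_add[OF dominated_kernel_mult[OF dom(1)] dom(2)] dominated_kernel_mult[OF dom(3)]]
      avg_add_kernel[OF dominated_kernel_mult[OF dom(1)] dom(2)] avg_mult_kernel[OF dom(1)] avg_mult_kernel[OF dom(3)] ..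
  ultimately have "band a (2 * r) 0 x = (1/2) *\<^sub>C band a r 0 x + band (a + r) r 0 x + (1/2) *\<^sub>C band (a + 2 * r) r 0 x"
    by (simp add: band_def defs)
  then show ?thesis using scaleC_of_real[of "1/2", where 'a = 'a] by simp
qed

end

section \<open>The averages over wide bands approximate the identity\<close>

text \<open>The hat function on \<open>[-1, 1]\<close> is the convolution of an indicator function with its reflection, so its
  transform is a nonnegative Fejer kernel.\<close>

lemma moment_0_squared_cis: "(moment 0 \<eta>)\<^sup>2 * cis \<eta> = of_real ((norm (moment 0 \<eta>))\<^sup>2)"
proof -
  have "cnj (moment 0 \<eta>) = moment 0 \<eta> * cis \<eta>"
  proof (cases "\<eta> = 0")
    case True
    then show ?thesis by (simp add: moment_def)
  next
    case False
    have m: "(\<i> * \<eta>) * moment 0 \<eta> = 1 - cis (- \<eta>)" using moment_by_parts[of \<eta> 0] by simp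
    have "(\<i> * \<eta>) * cnj (moment 0 \<eta>) = - cnj ((\<i> * \<eta>) * moment 0 \<eta>)" by simp
    also have "\<dots> = cis \<eta> - 1" unfolding m by (simp add: cis_cnj)
    also have "\<dots> = (\<i> * \<eta>) * moment 0 \<eta> * cis \<eta>" unfolding m by (simp add: algebra_simps cis_mult)
    finally show ?thesis using False by simp
  qed
  then have "(moment 0 \<eta>)\<^sup>2 * cis \<eta> = moment 0 \<eta> * cnj (moment 0 \<eta>)" by (simp add: power2_eq_square)
  then show ?thesis by (simp only: complex_norm_square)
qed

lemma norm_moment_0_ge: assumes "\<bar>\<eta>\<bar> \<le> 1" shows "norm (moment 0 \<eta>) \<ge> 1 / 2"
proof -
  have lin: "((\<lambda>x::real. x) has_integral 1 / 2) {0..1}"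
    using ident_has_integral[of 0 "1::real"] by simp
  have "1 - moment 0 \<eta> = integral {0..1} (\<lambda>x. 1 - cis (- (\<eta> * x)))"
    unfolding moment_def by (subst integral_diff) (auto intro!: integrable_continuous_interval continuous_intros)
  also have "norm \<dots> \<le> integral {0..1} (\<lambda>x. x)"
  proof (rule integral_norm_bound_integral)
    fix x :: real assume x: "x \<in> {0..1}"
    have "norm (cis (- (\<eta> * x)) - cis 0) \<le> 1 * norm (- (\<eta> * x) - 0)"
    proof (rule differentiable_bound[where f' = "\<lambda>t h. h *\<^sub>R (\<i> * cis t)"])
      show "(cis has_derivative (\<lambda>h. h *\<^sub>R (\<i> * cis t))) (at t within UNIV)" for t
        using cis_has_vector_derivative[of "-1" t UNIV] by (simp add: has_vector_derivative_def)
      show "onorm (\<lambda>h. h *\<^sub>R (\<i> * cis t)) \<le> 1" for t by (rule onorm_le) (simp add: norm_mult)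
    qed auto
    also have "\<dots> \<le> x" using x assms by (simp add: abs_mult mult_left_le_one_le)
    finally show "norm (1 - cis (- (\<eta> * x))) \<le> x" by (simp add: norm_minus_commute)
  qed (use lin in \<open>auto intro!: integrable_continuous_interval continuous_intros\<close>)
  also have "\<dots> = 1 / 2" by (rule integral_unique[OF lin])
  finally have "norm (1 - moment 0 \<eta>) \<le> 1 / 2" .
  then show ?thesis using norm_triangle_ineq2[of 1 "1 - moment 0 \<eta>"] by simp
qed

text \<open>The integral of the kernel of the hat function on \<open>[-R, R]\<close>, by which the averages are normalised.\<close>

definition hat_mass :: "real \<Rightarrow> real" where
  "hat_mass R = integral UNIV (\<lambda>\<xi>. R * (norm (moment 0 (R * \<xi>)))\<^sup>2)"

lemma hat_kernel_symmetric:
  "hat_kernel (- R) R 0 \<xi> = of_real (R * (norm (moment 0 (R * \<xi>)))\<^sup>2)"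
  using moment_0_squared_cis[of "R * \<xi>"] by (simp add: hat_kernel_def hat_transform_0 mult.assoc)

lemma
  assumes R: "R > 0"
  shows continuous_on_hat_density: "continuous_on S (\<lambda>\<xi>. R * (norm (moment 0 (R * \<xi>)))\<^sup>2)"
    and hat_density_le: "R * (norm (moment 0 (R * \<xi>)))\<^sup>2 \<le> 5 * (R / (1 + (R * \<xi>)\<^sup>2))"
    and hat_density_integrable: "(\<lambda>\<xi>. R * (norm (moment 0 (R * \<xi>)))\<^sup>2) integrable_on UNIV"
proof -
  let ?w = "\<lambda>\<xi>. R * (norm (moment 0 (R * \<xi>)))\<^sup>2"
  have n: "?w \<xi> = norm (hat_kernel (- R) R 0 \<xi>)" for \<xi>
    using R by (simp add: hat_kernel_symmetric norm_mult norm_power)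
  show c: "continuous_on S ?w" for S
    unfolding n by (intro continuous_on_norm continuous_on_hat_kernel)
  show le: "?w \<xi> \<le> 5 * (R / (1 + (R * \<xi>)\<^sup>2))" for \<xi>
    unfolding n using norm_hat_kernel_le[OF R, of "- R" 0 \<xi>] by simp
  show "?w integrable_on UNIV"
  proof (rule integrable_on_UNIV_dominated[OF c, where g = "\<lambda>\<xi>. 5 * (R / (1 + (R * \<xi>)\<^sup>2))"])
    show "continuous_on UNIV (\<lambda>\<xi>. 5 * (R / (1 + (R * \<xi>)\<^sup>2)))"
      by (intro continuous_on_mult_left continuous_on_Cauchy_density)
    show "(\<lambda>\<xi>. 5 * (R / (1 + (R * \<xi>)\<^sup>2))) integrable_on UNIV"
      by (rule has_integral_integrable[OF has_integral_mult_right[OF has_integral_Cauchy_density[OF R]]])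
  qed (use le R in auto)
qed

lemma hat_mass_ge: assumes R: "R > 0" shows "hat_mass R \<ge> 1 / 2"
proof -
  let ?w = "\<lambda>\<xi>. R * (norm (moment 0 (R * \<xi>)))\<^sup>2"
  have "1 / 2 = integral {- (1/R)..1/R} (\<lambda>_. R / 4)" using R by simp
  also have "\<dots> \<le> integral {- (1/R)..1/R} ?w"
  proof (rule integral_le)
    fix \<xi> assume "\<xi> \<in> {- (1/R)..1/R}"
    then have "\<bar>R * \<xi>\<bar> \<le> 1" using R by (auto simp: abs_le_iff field_simps)
    then have "(1 / 2)\<^sup>2 \<le> (norm (moment 0 (R * \<xi>)))\<^sup>2" by (intro power_mono norm_moment_0_ge) auto
    then show "R / 4 \<le> ?w \<xi>" using R mult_left_mono[of "(1/2)\<^sup>2" _ R] by (simp add: power2_eq_square)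
  qed (auto intro!: integrable_continuous_interval continuous_on_hat_density R)
  also have "\<dots> \<le> hat_mass R" unfolding hat_mass_def
    by (intro integral_subset_le hat_density_integrable R integrable_continuous_interval continuous_on_hat_density)
       (use R in auto)
  finally show ?thesis .
qed

context bounded_group
begin

text \<open>The mass of the kernel concentrates at \<open>\<xi> = 0\<close>, where \<open>T \<xi> x\<close> is close to \<open>x\<close>: outside of a
  neighbourhood of \<open>0\<close> the mass is \<open>O(1/R)\<close>.\<close>

lemma band_approximates_identity:
  "((\<lambda>R. band (- R) R 0 x - hat_mass R *\<^sub>R x) \<longlongrightarrow> 0) at_top"
proof (rule tendstoI)
  fix e :: real assume e: "e > 0"
  define \<epsilon> where "\<epsilon> = e / (10 * pi + 10)"
  have \<epsilon>: "\<epsilon> > 0" "5 * \<epsilon> * pi < e / 2" using e pi_gt_zero by (auto simp: \<epsilon>_def field_simps add_pos_pos)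
  have "((\<lambda>t. T t x) \<longlongrightarrow> T 0 x) (at 0)" using T_tendsto by (simp add: T_0)
  then obtain \<delta> where \<delta>: "\<delta> > 0" "\<And>\<xi>. \<bar>\<xi>\<bar> < \<delta> \<Longrightarrow> norm (T \<xi> x - x) \<le> \<epsilon>"
  proof -
    assume *: "\<And>\<delta>. \<lbrakk>\<delta> > 0; \<And>\<xi>. \<bar>\<xi>\<bar> < \<delta> \<Longrightarrow> norm (T \<xi> x - x) \<le> \<epsilon>\<rbrakk> \<Longrightarrow> thesis"
    from tendstoD[OF T_tendsto \<epsilon>(1), of x] obtain \<delta> where
      "\<delta> > 0" "\<And>\<xi>. \<xi> \<noteq> 0 \<Longrightarrow> dist \<xi> 0 < \<delta> \<Longrightarrow> dist (T \<xi> x) x < \<epsilon>"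
      unfolding eventually_at by auto
    then have "norm (T \<xi> x - x) \<le> \<epsilon>" if "\<bar>\<xi>\<bar> < \<delta>" for \<xi>
      using that \<epsilon>(1) by (cases "\<xi> = 0") (auto simp: T_0 dist_norm less_imp_le)
    with \<open>\<delta> > 0\<close> show thesis by (rule *)
  qed
  define L where "L = 5 * ((M + 1) * norm x) * (1 + 1 / \<delta>\<^sup>2)"
  have L: "L \<ge> 0" using M by (simp add: L_def)
  have est: "norm (band (- R) R 0 x - hat_mass R *\<^sub>R x) \<le> 5 * \<epsilon> * pi + L / R * pi" if R: "R > 0" for R
  proof -
    let ?w = "\<lambda>\<xi>. R * (norm (moment 0 (R * \<xi>)))\<^sup>2"
    have "((\<lambda>\<xi>. hat_kernel (- R) R 0 \<xi> *\<^sub>C T \<xi> x) has_integral band (- R) R 0 x) UNIV"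
      unfolding band_def avg_def by (intro integrable_integral avg_integrable[OF dominated_hat_kernel[OF R]])
    moreover have "((\<lambda>\<xi>. ?w \<xi> *\<^sub>R x) has_integral hat_mass R *\<^sub>R x) UNIV"
      unfolding hat_mass_def by (intro has_integral_scaleR_left integrable_integral hat_density_integrable R)
    ultimately have "((\<lambda>\<xi>. hat_kernel (- R) R 0 \<xi> *\<^sub>C T \<xi> x - ?w \<xi> *\<^sub>R x) has_integral
        band (- R) R 0 x - hat_mass R *\<^sub>R x) UNIV" by (rule has_integral_diff)
    then have I: "((\<lambda>\<xi>. ?w \<xi> *\<^sub>R (T \<xi> x - x)) has_integral band (- R) R 0 x - hat_mass R *\<^sub>R x) UNIV"
      by (simp only: hat_kernel_symmetric scaleC_of_real scaleR_diff_right)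
    let ?g = "\<lambda>\<xi>. 5 * \<epsilon> * (R / (1 + (R * \<xi>)\<^sup>2)) + L / R * (1 / (1 + (1 * \<xi>)\<^sup>2))"
    have g: "(?g has_integral 5 * \<epsilon> * pi + L / R * pi) UNIV"
      by (intro has_integral_add has_integral_mult_right has_integral_Cauchy_density R) simp
    have le: "norm (?w \<xi> *\<^sub>R (T \<xi> x - x)) \<le> ?g \<xi>" for \<xi>
    proof -
      have pos: "1 + (R * \<xi>)\<^sup>2 > 0" "1 + \<xi>\<^sup>2 > 0" by (auto simp: add_pos_nonneg)
      have w0: "?w \<xi> \<ge> 0" using R by simp
      have "norm (?w \<xi> *\<^sub>R (T \<xi> x - x)) = ?w \<xi> * norm (T \<xi> x - x)" using w0 by simp
      also have "\<dots> \<le> 5 * (R / (1 + (R * \<xi>)\<^sup>2)) * norm (T \<xi> x - x)"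
        by (intro mult_right_mono hat_density_le R) auto
      also have "\<dots> \<le> ?g \<xi>"
      proof (cases "\<bar>\<xi>\<bar> < \<delta>")
        case True
        have "5 * (R / (1 + (R * \<xi>)\<^sup>2)) * norm (T \<xi> x - x) \<le> 5 * (R / (1 + (R * \<xi>)\<^sup>2)) * \<epsilon>"
          using \<delta>(2)[OF True] R pos by (intro mult_left_mono) auto
        moreover have "L / R * (1 / (1 + (1 * \<xi>)\<^sup>2)) \<ge> 0" using L R pos by auto
        ultimately show ?thesis by (simp add: mult_ac)
      next
        case False
        then have \<delta>\<xi>: "\<delta>\<^sup>2 \<le> \<xi>\<^sup>2" using \<delta>(1) by (metis abs_le_square_iff abs_of_pos not_less)
        have \<xi>0: "\<xi>\<^sup>2 > 0" using \<delta>\<xi> \<delta>(1) by (meson less_le_trans zero_less_power)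
        have "norm (T \<xi> x - x) \<le> norm (T \<xi> x) + norm x" by (rule norm_triangle_ineq4)
        also have "\<dots> \<le> (M + 1) * norm x" using bound[of \<xi> x] by (simp add: algebra_simps)
        finally have Tx: "norm (T \<xi> x - x) \<le> (M + 1) * norm x" .
        have "R / (1 + (R * \<xi>)\<^sup>2) \<le> R / (R\<^sup>2 * \<xi>\<^sup>2)"
          using R \<xi>0 by (intro divide_left_mono) (auto simp: power_mult_distrib intro!: mult_pos_pos add_pos_nonneg)
        also have "\<dots> = (1 / R) * (1 / \<xi>\<^sup>2)" using R by (simp add: power2_eq_square)
        also have "1 / \<xi>\<^sup>2 \<le> (1 + 1 / \<delta>\<^sup>2) * (1 / (1 + \<xi>\<^sup>2))"
        proof -
          have "1 + \<xi>\<^sup>2 \<le> (1 + 1 / \<delta>\<^sup>2) * \<xi>\<^sup>2" using \<delta>\<xi> \<delta>(1) by (simp add: field_simps)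
          then show ?thesis using \<xi>0 pos by (simp add: field_simps)
        qed
        finally have "R / (1 + (R * \<xi>)\<^sup>2) \<le> (1 / R) * ((1 + 1 / \<delta>\<^sup>2) * (1 / (1 + \<xi>\<^sup>2)))"
          using R by (simp add: mult_left_mono del: times_divide_eq_left times_divide_eq_right)
        then have "5 * (R / (1 + (R * \<xi>)\<^sup>2)) * norm (T \<xi> x - x) \<le>
            5 * ((1 / R) * ((1 + 1 / \<delta>\<^sup>2) * (1 / (1 + \<xi>\<^sup>2)))) * ((M + 1) * norm x)"
          using Tx R pos by (intro mult_mono) auto
        also have "\<dots> = L / R * (1 / (1 + (1 * \<xi>)\<^sup>2))" by (simp add: L_def)
        also have "\<dots> \<le> ?g \<xi>" using \<epsilon>(1) R pos by simp
        finally show ?thesis .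
      qed
      finally show ?thesis .
    qed
    have "norm (integral UNIV (\<lambda>\<xi>. ?w \<xi> *\<^sub>R (T \<xi> x - x))) \<le> integral UNIV ?g"
      by (rule integral_norm_bound_integral[OF has_integral_integrable[OF I] has_integral_integrable[OF g] le])
    then show ?thesis unfolding integral_unique[OF I] integral_unique[OF g] .
  qed
  have "((\<lambda>R. L / R * pi) \<longlongrightarrow> L * 0 * pi) at_top"
    unfolding divide_inverse by (intro tendsto_intros tendsto_inverse_0_at_top filterlim_ident)
  then have "eventually (\<lambda>R. dist (L / R * pi) 0 < e / 2) at_top"
    by (intro tendstoD) (use e in auto)
  then show "eventually (\<lambda>R. dist (band (- R) R 0 x - hat_mass R *\<^sub>R x) 0 < e) at_top"
    using eventually_gt_at_top[of 0]
  proof eventually_elim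
    case (elim R)
    have "L / R * pi < e / 2" using elim(1) unfolding dist_real_def by linarith
    then show ?case using est[OF elim(2)] \<epsilon>(2) unfolding dist_norm diff_0_right by linarith
  qed
qed

end

section \<open>Generators\<close>

lemma scaleC_i_cancel: "\<i> *\<^sub>C x = \<i> *\<^sub>C y \<longleftrightarrow> (x::'a::complex_banach) = y"
proof
  assume "\<i> *\<^sub>C x = \<i> *\<^sub>C y"
  then have "(- \<i>) *\<^sub>C \<i> *\<^sub>C x = (- \<i>) *\<^sub>C \<i> *\<^sub>C y" by simp
  then show "x = y" using scaleC_of_real[of 1 x] scaleC_of_real[of 1 y] by (simp add: scaleC_scaleC)
qed simp

lemma op_scaleC_i_iff: "(x, \<i> *\<^sub>C y) \<in> op_scaleC \<i> S \<longleftrightarrow> (x, y) \<in> S"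
  by (auto simp: op_scaleC_def scaleC_i_cancel)

context bounded_group
begin

lemma generator_add:
  assumes "(x, y) \<in> group_generator T" "(x', y') \<in> group_generator T"
  shows "(x + x', y + y') \<in> group_generator T"
proof -
  have "((\<lambda>h. (T h x - x) /\<^sub>R h + (T h x' - x') /\<^sub>R h) \<longlongrightarrow> y + y') (at 0)"
    using assms by (intro tendsto_add) (auto simp: group_generator_def)
  moreover have "(T h x - x) /\<^sub>R h + (T h x' - x') /\<^sub>R h = (T h (x + x') - (x + x')) /\<^sub>R h" for h
    by (simp add: bounded_linear.linear[OF T_linear, THEN linear_add] algebra_simps)
  ultimately show ?thesis by (simp add: group_generator_def)
qed

lemma generator_map:
  assumes xy: "(x, y) \<in> group_generator T" and L: "bounded_linear L" and LT: "\<And>t x. L (T t x) = T t (L x)"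
  shows "(L x, L y) \<in> group_generator T"
proof -
  interpret bounded_linear L by (rule L)
  have "((\<lambda>h. L ((T h x - x) /\<^sub>R h)) \<longlongrightarrow> L y) (at 0)"
    using xy by (intro tendsto) (auto simp: group_generator_def)
  then show ?thesis by (simp add: group_generator_def diff scaleR LT)
qed

lemma generator_functional:
  assumes "(x, y) \<in> group_generator T" "(x, y') \<in> group_generator T"
  shows "y = y'"
  using assms LIM_unique unfolding group_generator_def by blast

lemma T_has_vector_derivative:
  assumes "(x, y) \<in> group_generator T"
  shows "((\<lambda>t. T t x) has_vector_derivative T t y) (at t)"
proof -
  interpret bounded_linear "T t" by (rule T_linear)
  have "((\<lambda>h. T t ((T h x - x) /\<^sub>R h)) \<longlongrightarrow> T t y) (at 0)"
    using assms by (intro tendsto) (auto simp: group_generator_def)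
  then have *: "((\<lambda>h. (T (t + h) x - T t x) /\<^sub>R h) \<longlongrightarrow> T t y) (at 0)"
    by (simp add: scaleR diff T_add)
  have "((\<lambda>h. (T (t + h) x - T t x - h *\<^sub>R T t y) /\<^sub>R h) \<longlongrightarrow> 0) (at 0)"
  proof (rule Lim_transform_eventually)
    show "((\<lambda>h. (T (t + h) x - T t x) /\<^sub>R h - T t y) \<longlongrightarrow> 0) (at 0)" using * by (rule LIM_zero)
    show "\<forall>\<^sub>F h in at 0. (T (t + h) x - T t x) /\<^sub>R h - T t y = (T (t + h) x - T t x - h *\<^sub>R T t y) /\<^sub>R h"
      by (auto simp: eventually_at_filter scaleR_diff_right)
  qed
  then have "((\<lambda>h. norm (T (t + h) x - T t x - h *\<^sub>R T t y) / norm h) \<longlongrightarrow> 0) (at 0)"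
    by (drule_tac tendsto_norm_zero) (simp add: divide_inverse mult.commute)
  then show ?thesis
    unfolding has_vector_derivative_def has_derivative_at by (simp add: bounded_linear_scaleR_left)
qed

text \<open>The mean value inequality bounds \<open>T h x - x - h y\<close> on the graph by \<open>\<bar>h\<bar>\<close> times the supremum of
  \<open>\<parallel>T s y - y\<parallel>\<close> over \<open>\<bar>s\<bar> \<le> \<bar>h\<bar>\<close>, and this bound survives the passage to the limit.\<close>

lemma generator_closed:
  assumes lim: "\<And>n. (X n, Y n) \<in> group_generator T" "X \<longlonglongrightarrow> x" "Y \<longlonglongrightarrow> y"
  shows "(x, y) \<in> group_generator T"
proof -
  have "((\<lambda>h. (T h x - x) /\<^sub>R h) \<longlongrightarrow> y) (at 0)"
  proof (rule tendstoI)
    fix e :: real assume e: "e > 0"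
    obtain \<delta> where \<delta>: "\<delta> > 0" "\<And>s. \<bar>s\<bar> < \<delta> \<Longrightarrow> norm (T s y - y) \<le> e / 2"
    proof -
      assume *: "\<And>\<delta>. \<lbrakk>\<delta> > 0; \<And>s. \<bar>s\<bar> < \<delta> \<Longrightarrow> norm (T s y - y) \<le> e / 2\<rbrakk> \<Longrightarrow> thesis"
      have "e / 2 > 0" using e by simp
      from tendstoD[OF T_tendsto this, of y] obtain \<delta> where
        d: "\<delta> > 0" "\<And>s. s \<noteq> 0 \<Longrightarrow> dist s 0 < \<delta> \<Longrightarrow> dist (T s y) y < e / 2"
        unfolding eventually_at by auto
      have "norm (T s y - y) \<le> e / 2" if "\<bar>s\<bar> < \<delta>" for s
      proof (cases "s = 0")
        case False
        then show ?thesis using d(2)[of s] that by (simp add: dist_norm)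
      qed (use e in \<open>simp add: T_0\<close>)
      with d(1) show thesis by (rule *)
    qed
    have est: "norm (T h x - x - h *\<^sub>R y) \<le> \<bar>h\<bar> * (e / 2)" if h: "\<bar>h\<bar> < \<delta>" for h
    proof (rule LIMSEQ_le)
      show "(\<lambda>n. norm (T h (X n) - X n - h *\<^sub>R Y n)) \<longlonglongrightarrow> norm (T h x - x - h *\<^sub>R y)"
        by (intro tendsto_intros lim bounded_linear.tendsto[OF T_linear])
      have "(\<lambda>n. \<bar>h\<bar> * (e / 2 + (M + 1) * norm (Y n - y))) \<longlonglongrightarrow> \<bar>h\<bar> * (e / 2 + (M + 1) * norm (y - y))"
        by (intro tendsto_intros lim)
      then show "(\<lambda>n. \<bar>h\<bar> * (e / 2 + (M + 1) * norm (Y n - y))) \<longlonglongrightarrow> \<bar>h\<bar> * (e / 2)" by simp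
      have "norm (T h (X n) - X n - h *\<^sub>R Y n) \<le> \<bar>h\<bar> * (e / 2 + (M + 1) * norm (Y n - y))" for n
      proof -
        define S where "S = closed_segment 0 h"
        have "norm (T h (X n) - T 0 (X n) - (h - 0) *\<^sub>R T 0 (Y n)) \<le> norm (h - 0) * (e / 2 + (M + 1) * norm (Y n - y))"
        proof (rule vector_differentiable_bound_linearization[where S = S and f' = "\<lambda>s. T s (Y n)"])
          show "((\<lambda>t. T t (X n)) has_vector_derivative T s (Y n)) (at s within S)" for s
            by (rule has_vector_derivative_at_within[OF T_has_vector_derivative[OF lim(1)]])
          fix s assume "s \<in> S"
          then have s: "\<bar>s\<bar> < \<delta>" using h by (auto simp: S_def closed_segment_eq_real_ivl split: if_splits)
          interpret bounded_linear "T s" by (rule T_linear)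
          have "T s (Y n) - T 0 (Y n) = (T s y - y) + (T s (Y n - y) - (Y n - y))" by (simp add: T_0 diff)
          also have "norm \<dots> \<le> norm (T s y - y) + (norm (T s (Y n - y)) + norm (Y n - y))"
            by (intro norm_triangle_mono order.refl norm_triangle_ineq4)
          also have "\<dots> \<le> e / 2 + (M + 1) * norm (Y n - y)"
            using \<delta>(2)[OF s] bound[of s "Y n - y"] by (simp add: distrib_right)
          finally show "norm (T s (Y n) - T 0 (Y n)) \<le> e / 2 + (M + 1) * norm (Y n - y)" .
        qed (auto simp: S_def)
        then show ?thesis by (simp add: T_0)
      qed
      then show "\<exists>N. \<forall>n\<ge>N. norm (T h (X n) - X n - h *\<^sub>R Y n) \<le> \<bar>h\<bar> * (e / 2 + (M + 1) * norm (Y n - y))" by blast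
    qed
    have "dist ((T h x - x) /\<^sub>R h) y < e" if "h \<noteq> 0" "\<bar>h\<bar> < \<delta>" for h
    proof -
      have "(T h x - x) /\<^sub>R h - y = (T h x - x - h *\<^sub>R y) /\<^sub>R h" using that by (simp add: scaleR_diff_right)
      then have "dist ((T h x - x) /\<^sub>R h) y = norm (T h x - x - h *\<^sub>R y) / \<bar>h\<bar>"
        by (simp add: dist_norm divide_inverse mult.commute)
      also have "\<dots> \<le> e / 2" using est[OF that(2)] that(1) by (simp add: divide_le_eq mult.commute)
      finally show ?thesis using e by simp
    qed
    then show "\<forall>\<^sub>F h in at 0. dist ((T h x - x) /\<^sub>R h) y < e"
      unfolding eventually_at using \<delta>(1) by (intro exI[of _ \<delta>]) auto
  qed
  then show ?thesis by (simp add: group_generator_def)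
qed

end

section \<open>Commuting bounded groups\<close>

locale commuting_groups =
  fixes A :: "'n::{finite,linorder} \<Rightarrow> ('a::complex_banach \<times> 'a) set" and T :: "'n \<Rightarrow> real \<Rightarrow> 'a \<Rightarrow> 'a" and M :: real
  assumes groups: "\<And>j. bounded_group (T j) M"
    and generators: "\<And>j. op_scaleC \<i> (A j) = group_generator (T j)"
    and commute: "\<And>j k s t x. T j s (T k t x) = T k t (T j s x)"
begin

sublocale bounded_group "T j" M for j by (rule groups)

lemma A_iff: "(x, y) \<in> A j \<longleftrightarrow> (x, \<i> *\<^sub>C y) \<in> group_generator (T j)"
  by (simp add: op_scaleC_i_iff flip: generators)

lemma A_add: "\<lbrakk>(x, y) \<in> A j; (x', y') \<in> A j\<rbrakk> \<Longrightarrow> (x + x', y + y') \<in> A j"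
  using generator_add by (simp add: A_iff scaleC_add_right)

lemma A_map:
  assumes "(x, y) \<in> A j" "bounded_linear L" "\<And>c x. L (c *\<^sub>C x) = c *\<^sub>C L x" "\<And>t x. L (T j t x) = T j t (L x)"
  shows "(L x, L y) \<in> A j"
  using generator_map[OF assms(1)[unfolded A_iff] assms(2,4)] by (simp add: A_iff assms(3))

lemma A_scaleC: "(x, y) \<in> A j \<Longrightarrow> (c *\<^sub>C x, c *\<^sub>C y) \<in> A j"
  by (rule A_map[OF _ scaleC.bounded_linear_right]) (simp_all add: scaleC_scaleC mult.commute T_scaleC)

lemma A_scaleR: "(x, y) \<in> A j \<Longrightarrow> (c *\<^sub>R x, c *\<^sub>R y) \<in> A j"
  using A_scaleC[of x y j "of_real c"] by (simp add: scaleC_of_real)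

lemma A_functional: "\<lbrakk>(x, y) \<in> A j; (x, y') \<in> A j\<rbrakk> \<Longrightarrow> y = y'"
  using generator_functional scaleC_i_cancel by (metis A_iff)

lemma A_closed: "\<lbrakk>\<And>n. (X n, Y n) \<in> A j; X \<longlonglongrightarrow> x; Y \<longlonglongrightarrow> y\<rbrakk> \<Longrightarrow> (x, y) \<in> A j"
  unfolding A_iff by (erule generator_closed) (auto intro: bounded_linear.tendsto[OF scaleC.bounded_linear_right])

abbreviation Band :: "'n \<Rightarrow> real \<Rightarrow> real \<Rightarrow> nat \<Rightarrow> 'a \<Rightarrow> 'a" where
  "Band j \<equiv> bounded_group.band (T j)"

lemma Band_in_A: "r > 0 \<Longrightarrow> (Band j a r N x, a *\<^sub>R Band j a r N x + r *\<^sub>R Band j a r (Suc N) x) \<in> A j"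
  by (simp add: A_iff band_in_generator)

lemma T_commutes_Band: "r > 0 \<Longrightarrow> T k t (Band j a r N x) = Band j a r N (T k t x)"
  by (rule band_commute[OF _ T_linear T_scaleC commute])

definition band_product :: "('n \<Rightarrow> real) \<Rightarrow> real \<Rightarrow> ('n \<Rightarrow> nat) \<Rightarrow> 'n list \<Rightarrow> 'a \<Rightarrow> 'a" where
  "band_product a r \<eta> = fold (\<lambda>j. Band j (a j) r (\<eta> j))"

lemma band_product_simps [simp]:
  "band_product a r \<eta> [] x = x"
  "band_product a r \<eta> (j # js) x = band_product a r \<eta> js (Band j (a j) r (\<eta> j) x)"
  by (simp_all add: band_product_def)

lemma bounded_linear_band_product: "r > 0 \<Longrightarrow> bounded_linear (band_product a r \<eta> js)"
proof (induction js)
  case (Cons j js)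
  then show ?case using bounded_linear_compose[OF Cons.IH[OF Cons.prems] bounded_linear_band[OF Cons.prems]]
    by (simp add: o_def)
next
  case Nil
  have "band_product a r \<eta> [] = (\<lambda>x. x)" by (simp add: fun_eq_iff)
  then show ?case by (simp add: bounded_linear_ident)
qed

lemma band_product_map:
  assumes r: "r > 0" and L: "bounded_linear L" "\<And>c x. L (c *\<^sub>C x) = c *\<^sub>C L x" "\<And>j t x. L (T j t x) = T j t (L x)"
  shows "L (band_product a r \<eta> js x) = band_product a r \<eta> js (L x)"
  by (induction js arbitrary: x) (simp_all add: band_commute[OF r L])

lemma band_product_scaleC: "r > 0 \<Longrightarrow> band_product a r \<eta> js (c *\<^sub>C x) = c *\<^sub>C band_product a r \<eta> js x"
  by (induction js arbitrary: x) (simp_all add: band_scaleC)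

lemma T_commutes_band_product: "r > 0 \<Longrightarrow> band_product a r \<eta> js (T k t x) = T k t (band_product a r \<eta> js x)"
  by (induction js arbitrary: x) (simp_all add: T_commutes_Band[symmetric])

lemma norm_band_product_le:
  assumes r: "r > 0"
  shows "norm (band_product a r \<eta> js x) \<le> (5 * pi * M) ^ length js * 2 ^ sum_list (map \<eta> js) * norm x"
proof (induction js arbitrary: x)
  case (Cons j js)
  have "norm (band_product a r \<eta> (j # js) x) \<le>
      (5 * pi * M) ^ length js * 2 ^ sum_list (map \<eta> js) * norm (Band j (a j) r (\<eta> j) x)"
    using Cons.IH by simp
  also have "\<dots> \<le> (5 * pi * M) ^ length js * 2 ^ sum_list (map \<eta> js) * (5 * 2 ^ \<eta> j * pi * M * norm x)"
    using M by (intro mult_left_mono norm_band_le[OF r]) auto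
  finally show ?case by (simp add: power_add mult_ac)
qed simp

lemma band_product_cong: "(\<And>j. j \<in> set js \<Longrightarrow> a j = a' j \<and> \<eta> j = \<eta>' j) \<Longrightarrow> band_product a r \<eta> js x = band_product a' r \<eta>' js x"
  by (induction js arbitrary: x) auto

text \<open>Only the factor of the coordinate \<open>j\<close> interacts with \<open>A j\<close>; the others commute with it.\<close>

lemma band_product_in_A:
  assumes r: "r > 0" and "j \<in> set js" "distinct js"
  shows "(band_product a r \<eta> js x,
    a j *\<^sub>R band_product a r \<eta> js x + r *\<^sub>R band_product a r (\<eta>(j := Suc (\<eta> j))) js x) \<in> A j"
  using assms(2,3)
proof (induction js arbitrary: x)
  case (Cons i js)
  show ?case
  proof (cases "i = j")
    case True
    let ?L = "band_product a r \<eta> js"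
    have L: "bounded_linear ?L" by (rule bounded_linear_band_product[OF r])
    have "?L (a j *\<^sub>R Band j (a j) r (\<eta> j) x + r *\<^sub>R Band j (a j) r (Suc (\<eta> j)) x)
      = a j *\<^sub>R ?L (Band j (a j) r (\<eta> j) x) + r *\<^sub>R ?L (Band j (a j) r (Suc (\<eta> j)) x)"
      by (simp add: linear_add[OF bounded_linear.linear[OF L]] linear_scale[OF bounded_linear.linear[OF L]])
    moreover have "band_product a r (\<eta>(j := Suc (\<eta> j))) js y = ?L y" for y
      using Cons.prems True by (intro band_product_cong) auto
    ultimately show ?thesis
      using A_map[OF Band_in_A[OF r] L band_product_scaleC[OF r] T_commutes_band_product[OF r], of j "a j" "\<eta> j" x]
      by (simp only: True band_product_simps fun_upd_same)
  next
    case False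
    then show ?thesis using Cons.IH[of "Band i (a i) r (\<eta> i) x"] Cons.prems by simp
  qed
qed simp

text \<open>Splitting the hat function of every coordinate into three writes the product as a linear combination
  of \<open>3\<^sup>n\<close> products of half the width.\<close>

lemma band_product_refine:
  assumes S: "subspace S" and r: "r > 0" and "distinct js"
    and children: "\<And>a'. (\<And>j. a' j \<in> {a j, a j + r, a j + 2 * r}) \<Longrightarrow> band_product a' r (\<lambda>_. 0) js y \<in> S"
  shows "band_product a (2 * r) (\<lambda>_. 0) js y \<in> S"
  using assms(3,4)
proof (induction js arbitrary: y)
  case (Cons j js)
  have child: "band_product a (2 * r) (\<lambda>_. 0) js (Band j b r 0 y) \<in> S" if b: "b \<in> {a j, a j + r, a j + 2 * r}" for b
  proof (rule Cons.IH)
    fix a' assume a': "\<And>i. a' i \<in> {a i, a i + r, a i + 2 * r}"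
    have "band_product (a'(j := b)) r (\<lambda>_. 0) (j # js) y \<in> S"
      by (rule Cons.prems(2)) (use a' b in auto)
    moreover have "band_product (a'(j := b)) r (\<lambda>_. 0) js z = band_product a' r (\<lambda>_. 0) js z" for z
      using Cons.prems(1) by (intro band_product_cong) auto
    ultimately show "band_product a' r (\<lambda>_. 0) js (Band j b r 0 y) \<in> S" by simp
  qed (use Cons.prems in simp)
  let ?L = "band_product a (2 * r) (\<lambda>_. 0) js"
  have L: "linear ?L" using r by (intro bounded_linear.linear bounded_linear_band_product) simp
  have "band_product a (2 * r) (\<lambda>_. 0) (j # js) y =
      (1/2) *\<^sub>R ?L (Band j (a j) r 0 y) + ?L (Band j (a j + r) r 0 y) + (1/2) *\<^sub>R ?L (Band j (a j + 2 * r) r 0 y)"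
    by (simp add: band_refine[OF r] linear_add[OF L] linear_scale[OF L])
  also have "\<dots> \<in> S"
    by (intro subspace_add[OF S] subspace_scale[OF S] child) auto
  finally show ?case .
qed (use r in auto)

text \<open>The vector \<open>Y R\<close> depends on \<open>R\<close> in order that the induction can apply one factor after the other.\<close>

lemma band_product_approximates_identity:
  assumes "(Y \<longlongrightarrow> y) at_top"
  shows "((\<lambda>R. (1 / hat_mass R) ^ length js *\<^sub>R band_product (\<lambda>_. - R) R (\<lambda>_. 0) js (Y R)) \<longlongrightarrow> y) at_top"
  using assms
proof (induction js arbitrary: Y)
  case (Cons j js)
  define Z where "Z R = (1 / hat_mass R) *\<^sub>R Band j (- R) R 0 (Y R)" for R
  have "(Z \<longlongrightarrow> y) at_top"
  proof -
    have "((\<lambda>R. Z R - y) \<longlongrightarrow> 0) at_top"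
    proof (rule Lim_null_comparison)
      have "((\<lambda>R. norm (Y R - y)) \<longlongrightarrow> 0) at_top" using Cons.prems by (simp add: tendsto_norm_zero LIM_zero)
      moreover have "((\<lambda>R. norm (Band j (- R) R 0 y - hat_mass R *\<^sub>R y)) \<longlongrightarrow> 0) at_top"
        by (intro tendsto_norm_zero band_approximates_identity)
      ultimately have "((\<lambda>R. 2 * (5 * pi * M * norm (Y R - y)) + 2 * norm (Band j (- R) R 0 y - hat_mass R *\<^sub>R y)) \<longlongrightarrow>
          2 * (5 * pi * M * 0) + 2 * 0) at_top" by (intro tendsto_intros)
      then show "((\<lambda>R. 2 * (5 * pi * M * norm (Y R - y)) + 2 * norm (Band j (- R) R 0 y - hat_mass R *\<^sub>R y)) \<longlongrightarrow> 0) at_top"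
        by simp
      show "\<forall>\<^sub>F R in at_top. norm (Z R - y) \<le> 2 * (5 * pi * M * norm (Y R - y)) + 2 * norm (Band j (- R) R 0 y - hat_mass R *\<^sub>R y)"
        using eventually_gt_at_top[of 0]
      proof eventually_elim
        case (elim R)
        interpret B: bounded_linear "Band j (- R) R 0" by (rule bounded_linear_band[OF elim])
        have m: "hat_mass R \<ge> 1 / 2" by (rule hat_mass_ge[OF elim])
        have "Z R - y = (1 / hat_mass R) *\<^sub>R (Band j (- R) R 0 (Y R - y) + (Band j (- R) R 0 y - hat_mass R *\<^sub>R y))"
          using m by (simp add: Z_def B.diff scaleR_diff_right scaleR_add_right)
        also have "norm \<dots> \<le> 2 * (norm (Band j (- R) R 0 (Y R - y)) + norm (Band j (- R) R 0 y - hat_mass R *\<^sub>R y))"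
          unfolding norm_scaleR using m by (intro mult_mono norm_triangle_ineq) (auto simp: field_simps)
        also have "\<dots> \<le> 2 * (5 * pi * M * norm (Y R - y) + norm (Band j (- R) R 0 y - hat_mass R *\<^sub>R y))"
          using norm_band_le[OF elim, of j "- R" 0 "Y R - y"] by (simp add: mult_ac)
        finally show ?case by simp
      qed
    qed
    then show ?thesis by (simp add: LIM_zero_iff)
  qed
  from Cons.IH[OF this]
  have lim: "((\<lambda>R. (1 / hat_mass R) ^ length js *\<^sub>R band_product (\<lambda>_. - R) R (\<lambda>_. 0) js (Z R)) \<longlongrightarrow> y) at_top" .
  show ?case
  proof (rule Lim_transform_eventually[OF lim])
    show "\<forall>\<^sub>F R in at_top. (1 / hat_mass R) ^ length js *\<^sub>R band_product (\<lambda>_. - R) R (\<lambda>_. 0) js (Z R)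
        = (1 / hat_mass R) ^ length (j # js) *\<^sub>R band_product (\<lambda>_. - R) R (\<lambda>_. 0) (j # js) (Y R)"
      using eventually_gt_at_top[of 0]
    proof eventually_elim
      case (elim R)
      have "linear (band_product (\<lambda>_. - R) R (\<lambda>_. 0) js)"
        by (intro bounded_linear.linear bounded_linear_band_product elim)
      then show ?case by (simp add: Z_def linear_scale mult.commute)
    qed
  qed
qed simp

text \<open>Bisection: if a wide product of hat functions maps \<open>y\<close> outside \<open>S\<close>, then so does one of the products
  into which it decomposes after halving the widths, and their corners converge.\<close>

lemma band_product_local_to_global:
  assumes S: "subspace S" and js: "distinct js"
    and local: "\<And>b. \<exists>\<delta>>0. \<forall>a r. 0 < r \<and> (\<forall>j. \<bar>a j - b j\<bar> + 2 * r \<le> \<delta>) \<longrightarrow> band_product a r (\<lambda>_. 0) js y \<in> S"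
    and R: "R > 0"
  shows "band_product a0 R (\<lambda>_. 0) js y \<in> S"
proof (rule ccontr)
  assume bad: "band_product a0 R (\<lambda>_. 0) js y \<notin> S"
  define rad where "rad k = R / 2 ^ k" for k
  have rad: "rad k > 0" "rad k = 2 * rad (Suc k)" for k using R by (auto simp: rad_def)
  have "\<exists>f. f 0 = a0 \<and> (\<forall>k. band_product (f k) (rad k) (\<lambda>_. 0) js y \<notin> S \<and>
      (\<forall>j. \<bar>f (Suc k) j - f k j\<bar> \<le> rad k))"
  proof -
    have step: "\<exists>a'. band_product a' (rad (Suc k)) (\<lambda>_. 0) js y \<notin> S \<and> (\<forall>j. \<bar>a' j - a j\<bar> \<le> rad k)"
      if a: "band_product a (rad k) (\<lambda>_. 0) js y \<notin> S" for a k
    proof (rule ccontr)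
      assume no: "\<not> ?thesis"
      have "band_product a (2 * rad (Suc k)) (\<lambda>_. 0) js y \<in> S"
      proof (rule band_product_refine[OF S rad(1) js])
        fix a' assume a': "\<And>j. a' j \<in> {a j, a j + rad (Suc k), a j + 2 * rad (Suc k)}"
        have "\<bar>a' j - a j\<bar> \<le> rad k" for j using a'[of j] rad(1)[of "Suc k"] rad(2)[of k] by auto
        then show "band_product a' (rad (Suc k)) (\<lambda>_. 0) js y \<in> S" using no by blast
      qed
      then show False using a by (simp flip: rad(2))
    qed
    define P where "P k a \<longleftrightarrow> band_product a (rad k) (\<lambda>_. 0) js y \<notin> S" for k a
    define Q where "Q k a a' \<longleftrightarrow> (\<forall>j. \<bar>a' j - a j\<bar> \<le> rad k)" for k and a a' :: "'n \<Rightarrow> real"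
    define f where "f = rec_nat a0 (\<lambda>k a. SOME a'. P (Suc k) a' \<and> Q k a a')"
    have f0: "f 0 = a0" and fS: "f (Suc k) = (SOME a'. P (Suc k) a' \<and> Q k (f k) a')" for k
      by (simp_all add: f_def)
    have Pf: "P k (f k)" for k
    proof (induction k)
      case 0
      then show ?case using bad by (simp add: P_def f0 rad_def)
    next
      case (Suc k)
      then show ?case unfolding fS using someI_ex[OF step[of "f k" k]] by (auto simp: P_def Q_def)
    qed
    moreover have "Q k (f k) (f (Suc k))" for k
      unfolding fS using someI_ex[OF step[of "f k" k]] Pf[of k] by (auto simp: P_def Q_def)
    ultimately show ?thesis using f0 unfolding P_def Q_def by blast
  qed
  then obtain f where f: "\<And>k. band_product (f k) (rad k) (\<lambda>_. 0) js y \<notin> S"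
    "\<And>k j. \<bar>f (Suc k) j - f k j\<bar> \<le> rad k" by blast
  have "\<exists>b. \<forall>k. \<bar>f k j - b\<bar> \<le> 2 * rad k" for j
  proof -
    have dist: "\<bar>f (k + l) j - f k j\<bar> \<le> 2 * rad k - 2 * rad (k + l)" for k l
    proof (induction l)
      case (Suc l)
      then show ?case using f(2)[of "k + l" j] rad(2)[of "k + l"] by simp
    qed simp
    have dist': "\<bar>f (k + l) j - f k j\<bar> \<le> 2 * rad k" for k l
      using dist[of k l] rad(1)[of "k + l"] by linarith
    have "Cauchy (\<lambda>k. f k j)"
    proof (rule metric_CauchyI)
      fix e :: real assume e: "e > 0"
      have "rad \<longlonglongrightarrow> 0" unfolding rad_def[abs_def] divide_inverse
        by (intro tendsto_mult_right_zero) (simp add: power_inverse[symmetric] LIMSEQ_power_zero)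
      then have "eventually (\<lambda>k. dist (rad k) 0 < e / 4) sequentially" by (rule tendstoD) (use e in simp)
      then obtain N where "dist (rad N) 0 < e / 4" by (auto dest: eventually_happens)
      then have N: "rad N < e / 4" using rad(1)[of N] by simp
      have "dist (f m j) (f n j) < e" if "m \<ge> N" "n \<ge> N" for m n
        using dist'[of N "m - N"] dist'[of N "n - N"] that N by (simp add: dist_real_def)
      then show "\<exists>N. \<forall>m\<ge>N. \<forall>n\<ge>N. dist (f m j) (f n j) < e" by blast
    qed
    then obtain b where b: "(\<lambda>k. f k j) \<longlonglongrightarrow> b" using Cauchy_convergent_iff convergent_def by blast
    have "\<bar>f k j - b\<bar> \<le> 2 * rad k" for k
    proof (rule LIMSEQ_le_const2)
      show "(\<lambda>l. \<bar>f k j - f (l + k) j\<bar>) \<longlonglongrightarrow> \<bar>f k j - b\<bar>"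
        by (intro tendsto_intros LIMSEQ_ignore_initial_segment b)
      show "\<exists>N. \<forall>l\<ge>N. \<bar>f k j - f (l + k) j\<bar> \<le> 2 * rad k"
        using dist'[of k] by (auto simp: add.commute abs_minus_commute)
    qed
    then show ?thesis by blast
  qed
  then obtain b where b: "\<And>j k. \<bar>f k j - b j\<bar> \<le> 2 * rad k" by metis
  obtain \<delta> where \<delta>: "\<delta> > 0"
    "\<And>a r. 0 < r \<Longrightarrow> (\<And>j. \<bar>a j - b j\<bar> + 2 * r \<le> \<delta>) \<Longrightarrow> band_product a r (\<lambda>_. 0) js y \<in> S"
    using local[of b] by blast
  have "\<exists>k. 4 * rad k \<le> \<delta>"
  proof -
    obtain k where "(1/2) ^ k < \<delta> / (4 * R)" using real_arch_pow_inv[of "\<delta> / (4 * R)" "1/2"] \<delta>(1) R by auto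
    then show ?thesis using R by (intro exI[of _ k]) (simp add: rad_def field_simps power_one_over)
  qed
  then obtain k where k: "4 * rad k \<le> \<delta>" by blast
  have "band_product (f k) (rad k) (\<lambda>_. 0) js y \<in> S"
  proof (rule \<delta>(2)[OF rad(1)])
    show "\<bar>f k j - b j\<bar> + 2 * rad k \<le> \<delta>" for j using b[of k j] k by linarith
  qed
  then show False using f(1) by blast
qed

end

section \<open>Bounded families\<close>

text \<open>The bounded families with a given index set, under the supremum norm, form a Banach space: over the
  discrete topology they are the bounded continuous functions.\<close>

instance bcontfun :: (metric_space, banach) banach ..

definition family :: "('i \<Rightarrow> 'b::real_normed_vector) \<Rightarrow> 'i discrete \<Rightarrow>\<^sub>C 'b" where
  "family f = Bcontfun (\<lambda>d. f (of_discrete d))"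

definition entry :: "('i discrete \<Rightarrow>\<^sub>C 'b::real_normed_vector) \<Rightarrow> 'i \<Rightarrow> 'b" where
  "entry z i = apply_bcontfun z (discrete i)"

lemma entry_family: assumes "\<And>i. norm (f i) \<le> B" shows "entry (family f) i = f i"
proof -
  have "continuous_on UNIV (\<lambda>d. f (of_discrete d))"
    by (simp add: continuous_on_open_vimage open_discrete)
  then have "(\<lambda>d. f (of_discrete d)) \<in> bcontfun"
    by (rule bcontfun_normI) (rule assms)
  then show ?thesis by (simp add: entry_def family_def Bcontfun_inverse discrete_inverse)
qed

lemma family_eqI: "(\<And>i. entry z i = entry w i) \<Longrightarrow> z = w"
  unfolding entry_def by (rule bcontfun_eqI) (metis of_discrete_inverse)

lemma norm_entry_le: "norm (entry z i) \<le> norm z"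
  unfolding entry_def by (rule norm_bounded)

lemma norm_le_entries: "(\<And>i. norm (entry z i) \<le> B) \<Longrightarrow> norm z \<le> B"
  unfolding entry_def by (rule norm_bound) (metis of_discrete_inverse)

lemma entry_add [simp]: "entry (z + w) i = entry z i + entry w i"
  and entry_diff [simp]: "entry (z - w) i = entry z i - entry w i"
  and entry_scaleR [simp]: "entry (c *\<^sub>R z) i = c *\<^sub>R entry z i"
  and entry_zero [simp]: "entry 0 i = 0"
  by (simp_all add: entry_def plus_bcontfun.rep_eq minus_bcontfun.rep_eq scaleR_bcontfun.rep_eq zero_bcontfun.rep_eq)

lemma bounded_linear_entry: "bounded_linear (\<lambda>z. entry z i)"
  by (rule bounded_linear_intro[of _ 1]) (simp_all add: norm_entry_le)

lemma entry_sum [simp]: "entry (sum f S) i = (\<Sum>x\<in>S. entry (f x) i)"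
  by (rule linear_sum[OF bounded_linear.linear[OF bounded_linear_entry]])

definition entrywise :: "('a::real_normed_vector \<Rightarrow> 'b::real_normed_vector) \<Rightarrow> ('i discrete \<Rightarrow>\<^sub>C 'a) \<Rightarrow> ('i discrete \<Rightarrow>\<^sub>C 'b)" where
  "entrywise L z = family (\<lambda>i. L (entry z i))"

lemma
  assumes L: "bounded_linear L"
  shows entry_entrywise: "entry (entrywise L z) i = L (entry z i)"
    and norm_entrywise_le: "norm (entrywise L z) \<le> onorm L * norm z"
proof -
  have le: "norm (L (entry z i)) \<le> onorm L * norm z" for i
    by (rule order_trans[OF onorm[OF L]]) (intro mult_left_mono norm_entry_le onorm_pos_le[OF L])
  show e: "entry (entrywise L z) i = L (entry z i)" for i
    unfolding entrywise_def by (rule entry_family[OF le])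
  show "norm (entrywise L z) \<le> onorm L * norm z"
    by (rule norm_le_entries) (simp add: e le)
qed

lemma bounded_linear_entrywise:
  assumes L: "bounded_linear L" shows "bounded_linear (entrywise L)"
proof -
  interpret bounded_linear L by (rule L)
  show ?thesis
    by (rule bounded_linear_intro[of _ "onorm L"])
       (auto intro!: family_eqI simp: entry_entrywise[OF L] add scaleR mult.commute[of _ "onorm L"] norm_entrywise_le[OF L])
qed

section \<open>Polynomials in commuting generators\<close>

lemma bounded_linear_funpow:
  fixes f :: "'v::real_normed_vector \<Rightarrow> 'v"
  assumes "bounded_linear f" shows "bounded_linear (f ^^ k)"
proof (induction k)
  case (Suc k)
  then show ?case using bounded_linear_compose[OF assms Suc] by (simp add: o_def)
qed (simp add: id_def bounded_linear_ident)

lemma sum_increment: "sum (\<eta>(j := Suc (\<eta> j))) (UNIV :: 'n::finite set) = Suc (sum \<eta> UNIV)"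
proof -
  have "sum (\<eta>(j := Suc (\<eta> j))) UNIV = Suc (\<eta> j) + sum (\<eta>(j := Suc (\<eta> j))) (UNIV - {j})"
    by (subst sum.remove[of UNIV j]) auto
  also have "sum (\<eta>(j := Suc (\<eta> j))) (UNIV - {j}) = sum \<eta> (UNIV - {j})" by (rule sum.cong) auto
  also have "Suc (\<eta> j) + sum \<eta> (UNIV - {j}) = Suc (sum \<eta> UNIV)"
    by (subst sum.remove[of UNIV j \<eta>]) auto
  finally show ?thesis .
qed

context commuting_groups
begin

text \<open>These operators may be coefficients of a polynomial in the generators. On \<open>X\<^sup>m\<close> the complex
  matrices are of this kind.\<close>

definition admissible :: "('a \<Rightarrow> 'a) \<Rightarrow> bool" where
  "admissible L \<longleftrightarrow> bounded_linear L \<and> (\<forall>c x. L (c *\<^sub>C x) = c *\<^sub>C L x) \<and> (\<forall>j t x. L (T j t x) = T j t (L x))"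

definition poly_graph :: "nat \<Rightarrow> (('n \<Rightarrow> nat) \<Rightarrow> 'a \<Rightarrow> 'a) \<Rightarrow> ('a \<times> 'a) set" where
  "poly_graph d C = {(v, \<Sum>\<eta>\<in>multi_indices d. C \<eta> (w \<eta>)) | v w. \<forall>\<eta>\<in>multi_indices d. (v, w \<eta>) \<in> op_monomial A \<eta>}"

definition symbol :: "nat \<Rightarrow> (('n \<Rightarrow> nat) \<Rightarrow> 'a \<Rightarrow> 'a) \<Rightarrow> ('n \<Rightarrow> real) \<Rightarrow> 'a \<Rightarrow> 'a" where
  "symbol d C b x = (\<Sum>\<eta>\<in>multi_indices d. (\<Prod>j\<in>UNIV. b j ^ \<eta> j) *\<^sub>R C \<eta> x)"

abbreviation coords :: "'n list" where "coords \<equiv> sorted_list_of_set UNIV"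

text \<open>The product \<open>band_product a r \<eta>\<close> may grow like \<open>2\<^bsup>\<bar>\<eta>\<bar>\<^esup>\<close>; the weights make the family bounded. Its entry at
  \<open>\<eta> = 0\<close> is the component of \<open>x\<close> that belongs to the box with corner \<open>a\<close> and side length \<open>2 r\<close>.\<close>

definition moments :: "('n \<Rightarrow> real) \<Rightarrow> real \<Rightarrow> 'a \<Rightarrow> ('n \<Rightarrow> nat) discrete \<Rightarrow>\<^sub>C 'a" where
  "moments a r x = family (\<lambda>\<eta>. (1/2) ^ sum \<eta> UNIV *\<^sub>R band_product a r \<eta> coords x)"

text \<open>The action of \<open>A j\<close> on the moments. The factor \<open>2\<close> undoes the weight of the next moment.\<close>

definition shift :: "('n \<Rightarrow> real) \<Rightarrow> real \<Rightarrow> 'n \<Rightarrow> (('n \<Rightarrow> nat) discrete \<Rightarrow>\<^sub>C 'a) \<Rightarrow> ('n \<Rightarrow> nat) discrete \<Rightarrow>\<^sub>C 'a" where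
  "shift a r j z = family (\<lambda>\<eta>. a j *\<^sub>R entry z \<eta> + (2 * r) *\<^sub>R entry z (\<eta>(j := Suc (\<eta> j))))"

definition shift_power :: "('n \<Rightarrow> real) \<Rightarrow> real \<Rightarrow> ('n \<Rightarrow> nat) \<Rightarrow> (('n \<Rightarrow> nat) discrete \<Rightarrow>\<^sub>C 'a) \<Rightarrow> ('n \<Rightarrow> nat) discrete \<Rightarrow>\<^sub>C 'a" where
  "shift_power a r \<eta> = fold (\<lambda>j f. f \<circ> (shift a r j ^^ \<eta> j)) coords id"

definition shift_poly :: "nat \<Rightarrow> (('n \<Rightarrow> nat) \<Rightarrow> 'a \<Rightarrow> 'a) \<Rightarrow> ('n \<Rightarrow> real) \<Rightarrow> real \<Rightarrow>
    (('n \<Rightarrow> nat) discrete \<Rightarrow>\<^sub>C 'a) \<Rightarrow> ('n \<Rightarrow> nat) discrete \<Rightarrow>\<^sub>C 'a" where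
  "shift_poly d C a r z = (\<Sum>\<eta>\<in>multi_indices d. entrywise (C \<eta>) (shift_power a r \<eta> z))"

text \<open>The families on which \<open>A j\<close> acts entrywise as the shift. They form a closed subspace which is invariant
  under the shifts and the coefficients, so an equation solved by iteration inside this subspace has
  a solution with entries in the domains of all polynomials in the generators.\<close>

definition joint :: "('n \<Rightarrow> real) \<Rightarrow> real \<Rightarrow> (('n \<Rightarrow> nat) discrete \<Rightarrow>\<^sub>C 'a) set" where
  "joint a r = {z. \<forall>j \<eta>. (entry z \<eta>, entry (shift a r j z) \<eta>) \<in> A j}"

lemma coords_facts: "distinct coords" "set coords = UNIV" "sum_list (map \<eta> coords) = sum \<eta> UNIV" "length coords = CARD('n)"
  by (simp_all add: sum_list_distinct_conv_sum_set)

lemma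
  assumes r: "r > 0"
  shows entry_moments: "entry (moments a r x) \<eta> = (1/2) ^ sum \<eta> UNIV *\<^sub>R band_product a r \<eta> coords x"
    and norm_moments_le: "norm (moments a r x) \<le> (5 * pi * M) ^ CARD('n) * norm x"
proof -
  have le: "norm ((1/2) ^ sum \<eta> UNIV *\<^sub>R band_product a r \<eta> coords x) \<le> (5 * pi * M) ^ CARD('n) * norm x" for \<eta>
  proof -
    have "norm ((1/2) ^ sum \<eta> UNIV *\<^sub>R band_product a r \<eta> coords x)
        \<le> (1/2) ^ sum \<eta> UNIV * ((5 * pi * M) ^ CARD('n) * 2 ^ sum \<eta> UNIV * norm x)"
      using norm_band_product_le[OF r, of a \<eta> coords x] by (simp add: coords_facts)
    then show ?thesis by (simp add: power_one_over)
  qed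
  show e: "entry (moments a r x) \<eta> = (1/2) ^ sum \<eta> UNIV *\<^sub>R band_product a r \<eta> coords x" for \<eta>
    unfolding moments_def by (rule entry_family[OF le])
  show "norm (moments a r x) \<le> (5 * pi * M) ^ CARD('n) * norm x"
    by (rule norm_le_entries) (unfold e, rule le)
qed

lemma bounded_linear_moments:
  assumes r: "r > 0" shows "bounded_linear (moments a r)"
proof -
  have L: "linear (band_product a r \<eta> coords)" for \<eta>
    by (rule bounded_linear.linear[OF bounded_linear_band_product[OF r]])
  show ?thesis
    by (rule bounded_linear_intro[of _ "(5 * pi * M) ^ CARD('n)"])
       (auto intro!: family_eqI simp: entry_moments[OF r] linear_add[OF L] linear_scale[OF L] scaleR_add_right
          mult.commute[of "norm _"] norm_moments_le[OF r])
qed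

lemma
  shows entry_shift: "entry (shift a r j z) \<eta> = a j *\<^sub>R entry z \<eta> + (2 * r) *\<^sub>R entry z (\<eta>(j := Suc (\<eta> j)))"
    and norm_shift_le: "norm (shift a r j z) \<le> (\<bar>a j\<bar> + 2 * \<bar>r\<bar>) * norm z"
proof -
  have le: "norm (a j *\<^sub>R entry z \<eta> + (2 * r) *\<^sub>R entry z (\<eta>(j := Suc (\<eta> j)))) \<le> (\<bar>a j\<bar> + 2 * \<bar>r\<bar>) * norm z" for \<eta>
    unfolding distrib_right
    by (intro norm_triangle_mono) (auto simp: abs_mult intro!: mult_left_mono norm_entry_le)
  show e: "entry (shift a r j z) \<eta> = a j *\<^sub>R entry z \<eta> + (2 * r) *\<^sub>R entry z (\<eta>(j := Suc (\<eta> j)))" for \<eta>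
    unfolding shift_def by (rule entry_family[OF le])
  show "norm (shift a r j z) \<le> (\<bar>a j\<bar> + 2 * \<bar>r\<bar>) * norm z"
    by (rule norm_le_entries) (unfold e, rule le)
qed

lemma bounded_linear_shift: "bounded_linear (shift a r j)"
proof (rule bounded_linear_intro)
  show "shift a r j (z + w) = shift a r j z + shift a r j w" for z w
    by (rule family_eqI) (simp add: entry_shift scaleR_add_right del: fun_upd_apply)
  show "shift a r j (c *\<^sub>R z) = c *\<^sub>R shift a r j z" for c z
    by (rule family_eqI) (simp add: entry_shift scaleR_add_right mult.commute del: fun_upd_apply)
  show "norm (shift a r j z) \<le> norm z * (\<bar>a j\<bar> + 2 * \<bar>r\<bar>)" for z
    using norm_shift_le[of a r j z] by (simp only: mult.commute)
qed

lemma bounded_linear_shift_power: "bounded_linear (shift_power a r \<eta>)"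
proof -
  have step: "bounded_linear f \<Longrightarrow> bounded_linear (fold (\<lambda>j f. f \<circ> (shift a r j ^^ \<eta> j)) js f)" for js f
  proof (induction js arbitrary: f)
    case (Cons j js)
    have "bounded_linear (f \<circ> (shift a r j ^^ \<eta> j))"
      unfolding o_def by (rule bounded_linear_compose[OF Cons.prems bounded_linear_funpow[OF bounded_linear_shift]])
    then show ?case unfolding fold_simps by (rule Cons.IH)
  qed simp
  show ?thesis unfolding shift_power_def id_def by (rule step) (rule bounded_linear_ident)
qed

lemma bounded_linear_shift_poly:
  assumes "\<And>\<eta>. admissible (C \<eta>)" shows "bounded_linear (shift_poly d C a r)"
  unfolding shift_poly_def[abs_def]
  by (intro bounded_linear_sum bounded_linear_compose[OF bounded_linear_entrywise bounded_linear_shift_power])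
     (use assms in \<open>auto simp: admissible_def\<close>)

text \<open>The moments turn the generator \<open>A j\<close> into the bounded operator \<open>shift a r j\<close>: on the range of a
  band product this is the recursion of the moments, and the two representations of \<open>A j\<close> agree
  because \<open>A j\<close> is single valued.\<close>

lemma moments_A:
  assumes r: "r > 0" and xy: "(x, y) \<in> A j"
  shows "moments a r y = shift a r j (moments a r x)"
proof (rule family_eqI)
  fix \<eta>
  have "(band_product a r \<eta> coords x, band_product a r \<eta> coords y) \<in> A j"
    by (rule A_map[OF xy bounded_linear_band_product[OF r] band_product_scaleC[OF r] T_commutes_band_product[OF r]])
  moreover have "(band_product a r \<eta> coords x,
      a j *\<^sub>R band_product a r \<eta> coords x + r *\<^sub>R band_product a r (\<eta>(j := Suc (\<eta> j))) coords x) \<in> A j"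
    by (rule band_product_in_A[OF r]) (simp_all add: coords_facts)
  ultimately have "band_product a r \<eta> coords y = a j *\<^sub>R band_product a r \<eta> coords x + r *\<^sub>R band_product a r (\<eta>(j := Suc (\<eta> j))) coords x"
    by (rule A_functional)
  then show "entry (moments a r y) \<eta> = entry (shift a r j (moments a r x)) \<eta>"
    by (simp add: entry_moments[OF r] entry_shift sum_increment scaleR_add_right mult.commute del: fun_upd_apply)
qed

lemma moments_A_power:
  assumes r: "r > 0" and "(x, y) \<in> A j ^^ k"
  shows "moments a r y = (shift a r j ^^ k) (moments a r x)"
  using assms(2)
proof (induction k arbitrary: y)
  case (Suc k)
  then obtain u where "(x, u) \<in> A j ^^ k" "(u, y) \<in> A j" by auto
  then show ?case using Suc.IH moments_A[OF r] by simp
qed simp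

lemma moments_monomial:
  assumes r: "r > 0" and "(x, y) \<in> op_monomial A \<eta>"
  shows "moments a r y = shift_power a r \<eta> (moments a r x)"
proof -
  have "moments a r y = fold (\<lambda>j f. f \<circ> (shift a r j ^^ \<eta> j)) js f (moments a r x)"
    if "(x, y) \<in> fold (\<lambda>j R. (A j ^^ \<eta> j) O R) js R" "\<And>x y. (x, y) \<in> R \<Longrightarrow> moments a r y = f (moments a r x)"
    for js R f x y
    using that
  proof (induction js arbitrary: R f x y)
    case (Cons j js)
    show ?case unfolding fold_simps
    proof (rule Cons.IH)
      show "(x, y) \<in> fold (\<lambda>j R. (A j ^^ \<eta> j) O R) js ((A j ^^ \<eta> j) O R)" using Cons.prems(1) by simp
      fix u v assume "(u, v) \<in> (A j ^^ \<eta> j) O R"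
      then obtain w where "(u, w) \<in> A j ^^ \<eta> j" "(w, v) \<in> R" by auto
      then show "moments a r v = (f \<circ> (shift a r j ^^ \<eta> j)) (moments a r u)"
        using Cons.prems(2) moments_A_power[OF r] by simp
    qed
  qed simp
  from this[OF assms(2)[unfolded op_monomial_def], of id] show ?thesis
    by (simp add: shift_power_def)
qed

lemma moments_admissible:
  assumes r: "r > 0" and L: "admissible L"
  shows "moments a r (L x) = entrywise L (moments a r x)"
proof (rule family_eqI)
  fix \<eta>
  have bl: "bounded_linear L" using L by (simp add: admissible_def)
  have "L (band_product a r \<eta> coords x) = band_product a r \<eta> coords (L x)"
    by (rule band_product_map[OF r]) (use L in \<open>auto simp: admissible_def\<close>)
  then show "entry (moments a r (L x)) \<eta> = entry (entrywise L (moments a r x)) \<eta>"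
    by (simp add: entry_moments[OF r] entry_entrywise[OF bl] linear_scale[OF bounded_linear.linear[OF bl]])
qed

text \<open>Both sides depend continuously on \<open>x\<close> and \<open>y\<close>, so the identity extends from the graph to its
  closure.\<close>

lemma moments_poly:
  assumes r: "r > 0" and C: "\<And>\<eta>. admissible (C \<eta>)" and xy: "(x, y) \<in> closure (poly_graph d C)"
  shows "moments a r y = shift_poly d C a r (moments a r x)"
proof -
  have graph: "moments a r y = shift_poly d C a r (moments a r x)" if "(x, y) \<in> poly_graph d C" for x y
  proof -
    from that obtain w where y: "y = (\<Sum>\<eta>\<in>multi_indices d. C \<eta> (w \<eta>))"
      and w: "\<And>\<eta>. \<eta> \<in> multi_indices d \<Longrightarrow> (x, w \<eta>) \<in> op_monomial A \<eta>"
      unfolding poly_graph_def by blast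
    have "moments a r y = (\<Sum>\<eta>\<in>multi_indices d. moments a r (C \<eta> (w \<eta>)))"
      unfolding y by (rule linear_sum[OF bounded_linear.linear[OF bounded_linear_moments[OF r]]])
    also have "\<dots> = shift_poly d C a r (moments a r x)"
      unfolding shift_poly_def
      by (intro sum.cong refl) (simp add: moments_admissible[OF r C] moments_monomial[OF r w])
    finally show ?thesis .
  qed
  obtain f where f: "\<And>n. f n \<in> poly_graph d C" "f \<longlonglongrightarrow> (x, y)"
    using xy by (auto simp: closure_sequential)
  have 1: "(\<lambda>n. fst (f n)) \<longlonglongrightarrow> x" "(\<lambda>n. snd (f n)) \<longlonglongrightarrow> y"
    using tendsto_fst[OF f(2)] tendsto_snd[OF f(2)] by simp_all
  have "(\<lambda>n. moments a r (snd (f n))) \<longlonglongrightarrow> moments a r y"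
    by (rule bounded_linear.tendsto[OF bounded_linear_moments[OF r] 1(2)])
  moreover have "(\<lambda>n. shift_poly d C a r (moments a r (fst (f n)))) \<longlonglongrightarrow> shift_poly d C a r (moments a r x)"
    by (rule bounded_linear.tendsto[OF bounded_linear_shift_poly[OF C] bounded_linear.tendsto[OF bounded_linear_moments[OF r] 1(1)]])
  moreover have "moments a r (snd (f n)) = shift_poly d C a r (moments a r (fst (f n)))" for n
    by (rule graph) (use f(1) in simp)
  ultimately show ?thesis using LIMSEQ_unique by simp
qed

subsection \<open>Families of joint moments\<close>

lemma moments_joint: "r > 0 \<Longrightarrow> moments a r x \<in> joint a r"
proof -
  assume r: "r > 0"
  have "(entry (moments a r x) \<eta>, entry (shift a r j (moments a r x)) \<eta>) \<in> A j" for j \<eta>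
  proof -
    have "(band_product a r \<eta> coords x,
        a j *\<^sub>R band_product a r \<eta> coords x + r *\<^sub>R band_product a r (\<eta>(j := Suc (\<eta> j))) coords x) \<in> A j"
      by (rule band_product_in_A[OF r]) (simp_all add: coords_facts)
    from A_scaleR[OF this, of "(1/2) ^ sum \<eta> UNIV"] show ?thesis
      by (simp add: entry_moments[OF r] entry_shift sum_increment scaleR_add_right mult.commute del: fun_upd_apply)
  qed
  then show ?thesis by (simp add: joint_def)
qed

lemma shift_commute: "shift a r i (shift a r j z) = shift a r j (shift a r i z)"
proof (rule family_eqI)
  fix \<eta>
  have "\<eta>(i := Suc (\<eta> i), j := Suc ((\<eta>(i := Suc (\<eta> i))) j)) = \<eta>(j := Suc (\<eta> j), i := Suc ((\<eta>(j := Suc (\<eta> j))) i))"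
    by auto
  then show "entry (shift a r i (shift a r j z)) \<eta> = entry (shift a r j (shift a r i z)) \<eta>"
    by (simp add: entry_shift algebra_simps del: fun_upd_apply)
qed

lemma joint_scaleR:
  assumes "z \<in> joint a r" shows "c *\<^sub>R z \<in> joint a r"
proof -
  have "(c *\<^sub>R entry z \<eta>, c *\<^sub>R entry (shift a r j z) \<eta>) \<in> A j" for j \<eta>
    by (rule A_scaleR) (use assms in \<open>simp add: joint_def\<close>)
  then show ?thesis by (simp add: joint_def linear_scale[OF bounded_linear.linear[OF bounded_linear_shift]])
qed

lemma joint_add:
  assumes "z \<in> joint a r" "w \<in> joint a r" shows "z + w \<in> joint a r"
proof -
  have "(entry z \<eta> + entry w \<eta>, entry (shift a r j z) \<eta> + entry (shift a r j w) \<eta>) \<in> A j" for j \<eta>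
    by (rule A_add) (use assms in \<open>simp_all add: joint_def\<close>)
  then show ?thesis by (simp add: joint_def linear_add[OF bounded_linear.linear[OF bounded_linear_shift]])
qed

lemma joint_diff: "z \<in> joint a r \<Longrightarrow> w \<in> joint a r \<Longrightarrow> z - w \<in> joint a r"
  using joint_add[of z a r "(-1) *\<^sub>R w"] joint_scaleR[of w a r "-1"] by simp

lemma joint_sum:
  assumes "0 \<in> joint a r" "\<And>i. i \<in> I \<Longrightarrow> f i \<in> joint a r"
  shows "sum f I \<in> joint a r"
  using assms(2) by (induction I rule: infinite_finite_induct) (simp_all add: joint_add assms(1))

lemma joint_shift: "z \<in> joint a r \<Longrightarrow> shift a r i z \<in> joint a r"
proof -
  assume z: "z \<in> joint a r"
  have "(entry (shift a r i z) \<eta>, entry (shift a r j (shift a r i z)) \<eta>) \<in> A j" for j \<eta>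
  proof -
    have "(a i *\<^sub>R entry z \<eta> + (2 * r) *\<^sub>R entry z (\<eta>(i := Suc (\<eta> i))),
       a i *\<^sub>R entry (shift a r j z) \<eta> + (2 * r) *\<^sub>R entry (shift a r j z) (\<eta>(i := Suc (\<eta> i)))) \<in> A j"
      by (intro A_add A_scaleR) (use z in \<open>simp_all add: joint_def\<close>)
    then show ?thesis unfolding entry_shift[of a r i z] shift_commute[of a r j i] entry_shift[of a r i "shift a r j z"] .
  qed
  then show ?thesis by (simp add: joint_def)
qed

lemma joint_shift_funpow: "z \<in> joint a r \<Longrightarrow> (shift a r i ^^ k) z \<in> joint a r"
  by (induction k) (simp_all add: joint_shift)

lemma joint_shift_power: "z \<in> joint a r \<Longrightarrow> shift_power a r \<eta> z \<in> joint a r"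
proof -
  have "(\<And>z. z \<in> joint a r \<Longrightarrow> f z \<in> joint a r) \<Longrightarrow> z \<in> joint a r \<Longrightarrow>
      fold (\<lambda>j f. f \<circ> (shift a r j ^^ \<eta> j)) js f z \<in> joint a r" for js f z
  proof (induction js arbitrary: f z)
    case (Cons j js)
    show ?case unfolding fold_simps
      by (rule Cons.IH) (use Cons.prems joint_shift_funpow in auto)
  qed simp
  then show "z \<in> joint a r \<Longrightarrow> shift_power a r \<eta> z \<in> joint a r" by (simp add: shift_power_def)
qed

lemma joint_entrywise:
  assumes L: "admissible L" and z: "z \<in> joint a r"
  shows "entrywise L z \<in> joint a r"
proof -
  have bl: "bounded_linear L" using L by (simp add: admissible_def)
  have "(entry (entrywise L z) \<eta>, entry (shift a r j (entrywise L z)) \<eta>) \<in> A j" for j \<eta>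
  proof -
    have "(L (entry z \<eta>), L (entry (shift a r j z) \<eta>)) \<in> A j"
      by (rule A_map) (use L z in \<open>auto simp: admissible_def joint_def\<close>)
    then show ?thesis
      by (simp add: entry_shift entry_entrywise[OF bl] linear_add[OF bounded_linear.linear[OF bl]]
          linear_scale[OF bounded_linear.linear[OF bl]] del: fun_upd_apply)
  qed
  then show ?thesis by (simp add: joint_def)
qed

lemma zero_joint: "r > 0 \<Longrightarrow> 0 \<in> joint a r"
  using joint_scaleR[OF moments_joint, of r 0] by simp

lemma joint_shift_poly:
  assumes "r > 0" "\<And>\<eta>. admissible (C \<eta>)" "z \<in> joint a r"
  shows "shift_poly d C a r z \<in> joint a r"
  unfolding shift_poly_def
  by (intro joint_sum zero_joint joint_entrywise joint_shift_power assms)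

lemma closed_joint: "closed (joint a r)"
  unfolding closed_sequential_limits
proof (intro allI impI)
  fix Z z assume "(\<forall>n. Z n \<in> joint a r) \<and> Z \<longlonglongrightarrow> z"
  then have Z: "\<And>n. Z n \<in> joint a r" "Z \<longlonglongrightarrow> z" by auto
  have "(entry z \<eta>, entry (shift a r j z) \<eta>) \<in> A j" for j \<eta>
  proof (rule A_closed)
    show "(entry (Z n) \<eta>, entry (shift a r j (Z n)) \<eta>) \<in> A j" for n using Z(1) by (simp add: joint_def)
    show "(\<lambda>n. entry (Z n) \<eta>) \<longlonglongrightarrow> entry z \<eta>" by (rule bounded_linear.tendsto[OF bounded_linear_entry Z(2)])
    show "(\<lambda>n. entry (shift a r j (Z n)) \<eta>) \<longlonglongrightarrow> entry (shift a r j z) \<eta>"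
      by (rule bounded_linear.tendsto[OF bounded_linear_entry bounded_linear.tendsto[OF bounded_linear_shift Z(2)]])
  qed
  then show "z \<in> joint a r" by (simp add: joint_def)
qed

lemma entry_shift_power_in_monomial:
  assumes "z \<in> joint a r"
  shows "(entry z \<eta>0, entry (shift_power a r \<eta> z) \<eta>0) \<in> op_monomial A \<eta>"
proof -
  have pow: "(entry z \<eta>0, entry ((shift a r j ^^ k) z) \<eta>0) \<in> A j ^^ k" if "z \<in> joint a r" for z j k
  proof (induction k)
    case (Suc k)
    have "(entry ((shift a r j ^^ k) z) \<eta>0, entry (shift a r j ((shift a r j ^^ k) z)) \<eta>0) \<in> A j"
      using joint_shift_funpow[OF that] by (simp add: joint_def)
    then show ?case using Suc by auto
  qed simp
  have "(entry z \<eta>0, entry (fold (\<lambda>j f. f \<circ> (shift a r j ^^ \<eta> j)) js f z) \<eta>0) \<in> fold (\<lambda>j R. (A j ^^ \<eta> j) O R) js R"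
    if "z \<in> joint a r" "\<And>z. z \<in> joint a r \<Longrightarrow> (entry z \<eta>0, entry (f z) \<eta>0) \<in> R" for js f R z
    using that
  proof (induction js arbitrary: f R z)
    case (Cons j js)
    show ?case unfolding fold_simps
    proof (rule Cons.IH[OF Cons.prems(1)])
      fix u assume u: "u \<in> joint a r"
      show "(entry u \<eta>0, entry ((f \<circ> (shift a r j ^^ \<eta> j)) u) \<eta>0) \<in> (A j ^^ \<eta> j) O R"
        unfolding o_apply using pow[OF u] Cons.prems(2)[OF joint_shift_funpow[OF u]] by blast
    qed
  qed simp
  from this[OF assms, of id Id] show ?thesis by (simp add: op_monomial_def shift_power_def)
qed

lemma entry_shift_poly_in_graph:
  assumes C: "\<And>\<eta>. admissible (C \<eta>)" and z: "z \<in> joint a r"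
  shows "(entry z \<eta>0, entry (shift_poly d C a r z) \<eta>0) \<in> poly_graph d C"
proof -
  have "entry (shift_poly d C a r z) \<eta>0 = (\<Sum>\<eta>\<in>multi_indices d. C \<eta> (entry (shift_power a r \<eta> z) \<eta>0))"
    unfolding shift_poly_def using C by (simp add: entry_entrywise admissible_def)
  then show ?thesis unfolding poly_graph_def
    by (intro CollectI exI[of _ "entry z \<eta>0"] exI[of _ "\<lambda>\<eta>. entry (shift_power a r \<eta> z) \<eta>0"])
       (simp add: entry_shift_power_in_monomial[OF z])
qed

subsection \<open>Polynomials in the shifts are close to their symbols\<close>

text \<open>The box with corner \<open>a\<close> and side length \<open>2 r\<close> lies within distance \<open>\<delta>\<close> of \<open>b\<close>.\<close>

definition near :: "('n \<Rightarrow> real) \<Rightarrow> real \<Rightarrow> ('n \<Rightarrow> real) \<Rightarrow> real \<Rightarrow> bool" where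
  "near b \<delta> a r \<longleftrightarrow> 0 < r \<and> (\<forall>j. \<bar>a j - b j\<bar> + 2 * r \<le> \<delta>)"

text \<open>The constant is uniform over all boxes near \<open>b\<close>, and the property is stable under composition, hence
  passes from the shifts to their monomials.\<close>

definition close_to_scalar ::
  "('n \<Rightarrow> real) \<Rightarrow> (('n \<Rightarrow> real) \<Rightarrow> real \<Rightarrow> (('n \<Rightarrow> nat) discrete \<Rightarrow>\<^sub>C 'a) \<Rightarrow> ('n \<Rightarrow> nat) discrete \<Rightarrow>\<^sub>C 'a) \<Rightarrow> real \<Rightarrow> bool" where
  "close_to_scalar b G c \<longleftrightarrow>
    (\<exists>K\<ge>0. \<forall>\<delta> a r z. 0 < \<delta> \<and> \<delta> \<le> 1 \<and> near b \<delta> a r \<longrightarrow> norm (G a r z - c *\<^sub>R z) \<le> K * \<delta> * norm z)"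

lemma close_to_scalar_id: "close_to_scalar b (\<lambda>a r z. z) 1"
  unfolding close_to_scalar_def by (rule exI[of _ 0]) simp

lemma close_to_scalar_comp:
  assumes "close_to_scalar b G c" "close_to_scalar b H d"
  shows "close_to_scalar b (\<lambda>a r z. G a r (H a r z)) (c * d)"
proof -
  obtain K where K: "K \<ge> 0" "\<And>\<delta> a r z. 0 < \<delta> \<Longrightarrow> \<delta> \<le> 1 \<Longrightarrow> near b \<delta> a r \<Longrightarrow> norm (G a r z - c *\<^sub>R z) \<le> K * \<delta> * norm z"
    using assms(1) unfolding close_to_scalar_def by blast
  obtain L where L: "L \<ge> 0" "\<And>\<delta> a r z. 0 < \<delta> \<Longrightarrow> \<delta> \<le> 1 \<Longrightarrow> near b \<delta> a r \<Longrightarrow> norm (H a r z - d *\<^sub>R z) \<le> L * \<delta> * norm z"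
    using assms(2) unfolding close_to_scalar_def by blast
  have "norm (G a r (H a r z) - (c * d) *\<^sub>R z) \<le> (K * (\<bar>d\<bar> + L) + \<bar>c\<bar> * L) * \<delta> * norm z"
    if \<delta>: "0 < \<delta>" "\<delta> \<le> 1" "near b \<delta> a r" for \<delta> a r z
  proof -
    have "norm (H a r z) \<le> norm (d *\<^sub>R z) + norm (H a r z - d *\<^sub>R z)" by (rule norm_triangle_sub)
    also have "\<dots> \<le> \<bar>d\<bar> * norm z + L * 1 * norm z"
      using L(2)[OF \<delta>, of z] L(1) \<delta>(2) mult_right_mono[OF mult_left_mono[OF \<delta>(2) L(1)], of "norm z"] by simp
    finally have H: "norm (H a r z) \<le> (\<bar>d\<bar> + L) * norm z" by (simp add: distrib_right)
    have "G a r (H a r z) - (c * d) *\<^sub>R z = (G a r (H a r z) - c *\<^sub>R H a r z) + c *\<^sub>R (H a r z - d *\<^sub>R z)"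
      by (simp add: scaleR_diff_right)
    also have "norm \<dots> \<le> K * \<delta> * norm (H a r z) + \<bar>c\<bar> * (L * \<delta> * norm z)"
      by (intro norm_triangle_mono K(2)[OF \<delta>]) (auto intro!: mult_left_mono L(2)[OF \<delta>])
    also have "\<dots> \<le> K * \<delta> * ((\<bar>d\<bar> + L) * norm z) + \<bar>c\<bar> * (L * \<delta> * norm z)"
      using H K(1) \<delta>(1) by (intro add_right_mono mult_left_mono) auto
    finally show ?thesis by (simp add: algebra_simps)
  qed
  then show ?thesis unfolding close_to_scalar_def
    using K(1) L(1) by (intro exI[of _ "K * (\<bar>d\<bar> + L) + \<bar>c\<bar> * L"]) auto
qed

lemma close_to_scalar_shift: "close_to_scalar b (\<lambda>a r. shift a r j) (b j)"
proof -
  have "norm (shift a r j z - b j *\<^sub>R z) \<le> 1 * \<delta> * norm z" if "near b \<delta> a r" for \<delta> a r z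
  proof (rule norm_le_entries)
    fix \<eta>
    have r: "r > 0" and \<delta>: "\<bar>a j - b j\<bar> + 2 * r \<le> \<delta>" using that by (auto simp: near_def)
    have "entry (shift a r j z - b j *\<^sub>R z) \<eta> = (a j - b j) *\<^sub>R entry z \<eta> + (2 * r) *\<^sub>R entry z (\<eta>(j := Suc (\<eta> j)))"
      by (simp add: entry_shift scaleR_diff_left del: fun_upd_apply)
    also have "norm \<dots> \<le> \<bar>a j - b j\<bar> * norm z + (2 * r) * norm z"
      using r by (intro norm_triangle_mono) (auto intro!: mult_left_mono norm_entry_le)
    also have "\<dots> \<le> 1 * \<delta> * norm z" using mult_right_mono[OF \<delta>, of "norm z"] by (simp add: distrib_right)
    finally show "norm (entry (shift a r j z - b j *\<^sub>R z) \<eta>) \<le> 1 * \<delta> * norm z" .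
  qed
  then show ?thesis unfolding close_to_scalar_def by (intro exI[of _ 1]) auto
qed

lemma close_to_scalar_funpow:
  assumes "close_to_scalar b G c" shows "close_to_scalar b (\<lambda>a r. G a r ^^ k) (c ^ k)"
proof (induction k)
  case 0
  then show ?case using close_to_scalar_id by (simp add: id_def)
next
  case (Suc k)
  then show ?case using close_to_scalar_comp[OF assms Suc] by (simp add: o_def)
qed

lemma close_to_scalar_shift_power: "close_to_scalar b (\<lambda>a r. shift_power a r \<eta>) (\<Prod>j\<in>UNIV. b j ^ \<eta> j)"
proof -
  have "close_to_scalar b f c \<Longrightarrow> close_to_scalar b (\<lambda>a r. fold (\<lambda>j f. f \<circ> (shift a r j ^^ \<eta> j)) js (f a r))
      (c * prod_list (map (\<lambda>j. b j ^ \<eta> j) js))" for js f c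
  proof (induction js arbitrary: f c)
    case (Cons j js)
    from Cons.IH[OF close_to_scalar_comp[OF Cons.prems close_to_scalar_funpow[OF close_to_scalar_shift, where k = "\<eta> j"]], of j]
    show ?case by (simp add: o_def mult.assoc)
  qed simp
  from this[of "\<lambda>a r z. z" 1 coords] close_to_scalar_id[of b]
  show ?thesis by (simp add: shift_power_def id_def prod.distinct_set_conv_list[symmetric])
qed

lemma shift_poly_close_to_symbol:
  assumes C: "\<And>\<eta>. admissible (C \<eta>)"
  shows "\<exists>K\<ge>0. \<forall>\<delta> a r z. 0 < \<delta> \<and> \<delta> \<le> 1 \<and> near b \<delta> a r \<longrightarrow>
    norm (shift_poly d C a r z - entrywise (symbol d C b) z) \<le> K * \<delta> * norm z"
proof -
  let ?c = "\<lambda>\<eta>. \<Prod>j\<in>UNIV. b j ^ \<eta> j"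
  have bl: "bounded_linear (C \<eta>)" for \<eta> using C by (simp add: admissible_def)
  obtain K where K: "\<And>\<eta>. K \<eta> \<ge> 0"
    "\<And>\<eta> \<delta> a r z. 0 < \<delta> \<Longrightarrow> \<delta> \<le> 1 \<Longrightarrow> near b \<delta> a r \<Longrightarrow> norm (shift_power a r \<eta> z - ?c \<eta> *\<^sub>R z) \<le> K \<eta> * \<delta> * norm z"
    using close_to_scalar_shift_power[of b] unfolding close_to_scalar_def by metis
  have bls: "bounded_linear (symbol d C b)"
    unfolding symbol_def[abs_def] by (intro bounded_linear_sum bounded_linear_compose[OF bounded_linear_scaleR_right bl])
  define K' where "K' = (\<Sum>\<eta>\<in>multi_indices d. onorm (C \<eta>) * K \<eta>)"
  have "norm (shift_poly d C a r z - entrywise (symbol d C b) z) \<le> K' * \<delta> * norm z"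
    if \<delta>: "0 < \<delta>" "\<delta> \<le> 1" "near b \<delta> a r" for \<delta> a r z
  proof -
    have "shift_poly d C a r z - entrywise (symbol d C b) z =
        (\<Sum>\<eta>\<in>multi_indices d. entrywise (C \<eta>) (shift_power a r \<eta> z - ?c \<eta> *\<^sub>R z))"
      by (rule family_eqI)
         (simp add: shift_poly_def entry_entrywise[OF bl] entry_entrywise[OF bls] symbol_def
           linear_diff[OF bounded_linear.linear[OF bl]] linear_scale[OF bounded_linear.linear[OF bl]] sum_subtractf)
    also have "norm \<dots> \<le> (\<Sum>\<eta>\<in>multi_indices d. onorm (C \<eta>) * (K \<eta> * \<delta> * norm z))"
      by (intro sum_norm_le order_trans[OF norm_entrywise_le[OF bl]] mult_left_mono K(2)[OF \<delta>] onorm_pos_le bl)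
    also have "\<dots> = K' * \<delta> * norm z" by (simp add: K'_def sum_distrib_right mult.assoc)
    finally show ?thesis .
  qed
  moreover have "K' \<ge> 0" unfolding K'_def by (intro sum_nonneg mult_nonneg_nonneg K(1) onorm_pos_le bl)
  ultimately show ?thesis by blast
qed

end

section \<open>Solutions given by Mittag-Leffler series\<close>

lemma
  assumes "\<And>t. t \<ge> 0 \<Longrightarrow> u t = v t"
  shows caputo_cong: "t \<ge> 0 \<Longrightarrow> caputo \<alpha> u t = caputo \<alpha> v t"
    and caputo_defined_cong: "caputo_defined \<alpha> u \<Longrightarrow> caputo_defined \<alpha> v"
proof -
  have prim: "caputo_primitive \<alpha> u t = caputo_primitive \<alpha> v t" if "t \<ge> 0" for t
    unfolding caputo_primitive_def
    by (intro g_conv_cong that) (use nderiv_cong[of u v 0, OF assms] assms in auto)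
  show "t \<ge> 0 \<Longrightarrow> caputo \<alpha> u t = caputo \<alpha> v t"
    unfolding caputo_def by (rule nderiv_cong[OF prim])
  show "caputo_defined \<alpha> v" if "caputo_defined \<alpha> u"
    unfolding caputo_defined_def
  proof
    show "C_k (nat \<lceil>\<alpha>\<rceil> - 1) v"
      by (rule C_k_cong[OF assms]) (use that in \<open>simp_all add: caputo_defined_def\<close>)
    show "C_k (nat \<lceil>\<alpha>\<rceil>) (caputo_primitive \<alpha> v)"
      by (rule C_k_cong[OF prim]) (use that in \<open>simp_all add: caputo_defined_def\<close>)
  qed
qed

text \<open>Formally \<open>X k = (Q2\<inverse> Q1)\<^sup>k x\<close>, written without an inverse: these are the coefficients of the
  Mittag-Leffler series that solves the Cauchy problem.\<close>

definition chain_vector :: "('b::real_normed_vector \<times> 'b) set \<Rightarrow> ('b \<times> 'b) set \<Rightarrow> 'b \<Rightarrow> bool" where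
  "chain_vector Q1 Q2 x \<longleftrightarrow> (\<exists>X Y1 Y2. X 0 = x \<and>
     (\<forall>k. (X k, Y1 k) \<in> Q1 \<and> (X k, Y2 k) \<in> Q2 \<and> Y2 (Suc k) = Y1 k) \<and>
     geometrically_bounded X \<and> geometrically_bounded Y1 \<and> geometrically_bounded Y2)"

lemma geometrically_bounded_add:
  assumes "geometrically_bounded x" "geometrically_bounded y"
  shows "geometrically_bounded (\<lambda>k. x k + y k)"
proof -
  obtain D C where x: "D \<ge> 0" "C \<ge> 0" "\<And>k. norm (x k) \<le> D * C ^ k"
    using assms(1) by (auto simp: geometrically_bounded_def)
  obtain D' C' where y: "D' \<ge> 0" "C' \<ge> 0" "\<And>k. norm (y k) \<le> D' * C' ^ k"
    using assms(2) by (auto simp: geometrically_bounded_def)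
  have "norm (x k + y k) \<le> (D + D') * max C C' ^ k" for k
  proof -
    have "norm (x k + y k) \<le> D * C ^ k + D' * C' ^ k" by (intro norm_triangle_mono x y)
    also have "\<dots> \<le> D * max C C' ^ k + D' * max C C' ^ k"
      using x y by (intro add_mono mult_left_mono power_mono) auto
    finally show ?thesis by (simp add: distrib_right)
  qed
  then show ?thesis unfolding geometrically_bounded_def
    using x(1,2) y(1) by (intro exI[of _ "D + D'"] conjI exI[of _ "max C C'"]) auto
qed

lemma geometrically_bounded_scaleR:
  assumes "geometrically_bounded x" shows "geometrically_bounded (\<lambda>k. c *\<^sub>R x k)"
proof -
  obtain D C where x: "D \<ge> 0" "C \<ge> 0" "\<And>k. norm (x k) \<le> D * C ^ k"
    using assms by (auto simp: geometrically_bounded_def)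
  have "norm (c *\<^sub>R x k) \<le> (\<bar>c\<bar> * D) * C ^ k" for k
    using mult_left_mono[OF x(3)[of k], of "\<bar>c\<bar>"] by (simp add: mult.assoc)
  then show ?thesis unfolding geometrically_bounded_def
    using x(1,2) by (intro exI[of _ "\<bar>c\<bar> * D"] conjI exI[of _ C]) auto
qed

lemma geometrically_bounded_0: "geometrically_bounded (\<lambda>_. 0)"
  unfolding geometrically_bounded_def by (rule exI[of _ 0], simp, rule exI[of _ 0], simp)

lemma subspace_chain_vector:
  assumes Q1: "subspace Q1" and Q2: "subspace Q2"
  shows "subspace {x. chain_vector Q1 Q2 x}"
proof (rule subspaceI; unfold mem_Collect_eq)
  show "chain_vector Q1 Q2 0"
    unfolding chain_vector_def
    using subspace_0[OF Q1] subspace_0[OF Q2]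
    by (intro exI[of _ "\<lambda>_. 0"]) (auto simp: zero_prod_def geometrically_bounded_0)
next
  fix x y assume x: "chain_vector Q1 Q2 x" and y: "chain_vector Q1 Q2 y"
  from x obtain X Y1 Y2 where X:
    "X 0 = x" "\<And>k. (X k, Y1 k) \<in> Q1" "\<And>k. (X k, Y2 k) \<in> Q2" "\<And>k. Y2 (Suc k) = Y1 k"
    "geometrically_bounded X" "geometrically_bounded Y1" "geometrically_bounded Y2"
    unfolding chain_vector_def by blast
  from y obtain X' Y1' Y2' where Y:
    "X' 0 = y" "\<And>k. (X' k, Y1' k) \<in> Q1" "\<And>k. (X' k, Y2' k) \<in> Q2" "\<And>k. Y2' (Suc k) = Y1' k"
    "geometrically_bounded X'" "geometrically_bounded Y1'" "geometrically_bounded Y2'"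
    unfolding chain_vector_def by blast
  have "(X k + X' k, Y1 k + Y1' k) \<in> Q1" "(X k + X' k, Y2 k + Y2' k) \<in> Q2" for k
    using subspace_add[OF Q1 X(2) Y(2), of k k] subspace_add[OF Q2 X(3) Y(3), of k k] by simp_all
  then show "chain_vector Q1 Q2 (x + y)"
    unfolding chain_vector_def using X Y
    by (intro exI[of _ "\<lambda>k. X k + X' k"] exI[of _ "\<lambda>k. Y1 k + Y1' k"] exI[of _ "\<lambda>k. Y2 k + Y2' k"])
       (simp add: geometrically_bounded_add)
next
  fix c x assume "chain_vector Q1 Q2 x"
  then obtain X Y1 Y2 where *:
    "X 0 = x" "\<And>k. (X k, Y1 k) \<in> Q1" "\<And>k. (X k, Y2 k) \<in> Q2" "\<And>k. Y2 (Suc k) = Y1 k"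
    "geometrically_bounded X" "geometrically_bounded Y1" "geometrically_bounded Y2"
    unfolding chain_vector_def by blast
  have "(c *\<^sub>R X k, c *\<^sub>R Y1 k) \<in> Q1" "(c *\<^sub>R X k, c *\<^sub>R Y2 k) \<in> Q2" for k
    using subspace_scale[OF Q1 *(2)[of k], of c] subspace_scale[OF Q2 *(3)[of k], of c] by simp_all
  then show "chain_vector Q1 Q2 (c *\<^sub>R x)"
    unfolding chain_vector_def using *
    by (intro exI[of _ "\<lambda>k. c *\<^sub>R X k"] exI[of _ "\<lambda>k. c *\<^sub>R Y1 k"] exI[of _ "\<lambda>k. c *\<^sub>R Y2 k"])
       (simp add: geometrically_bounded_scaleR)
qed

text \<open>A closed operator acts on a Mittag-Leffler series term by term.\<close>

lemma mittag_leffler_in_closed_subspace: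
  fixes Q :: "('b::banach \<times> 'b) set"
  assumes Q: "subspace Q" "closed Q" and XY: "\<And>k. (X k, Y k) \<in> Q"
    and gb: "geometrically_bounded X" "geometrically_bounded Y" and \<alpha>: "\<alpha> > 0" and t: "t \<ge> 0"
  shows "(mittag_leffler \<alpha> 0 X t, mittag_leffler \<alpha> 0 Y t) \<in> Q"
proof -
  let ?g = "\<lambda>k. g_fun (\<alpha> * real k + 0 + 1) t"
  have "(\<lambda>N. (\<Sum>k<N. ?g k *\<^sub>R X k, \<Sum>k<N. ?g k *\<^sub>R Y k)) \<longlonglongrightarrow> (mittag_leffler \<alpha> 0 X t, mittag_leffler \<alpha> 0 Y t)"
    unfolding mittag_leffler_def
    by (intro tendsto_Pair summable_LIMSEQ summable_mittag_leffler_terms \<alpha> gb t order.refl)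
  moreover have "(\<Sum>k<N. ?g k *\<^sub>R X k, \<Sum>k<N. ?g k *\<^sub>R Y k) \<in> Q" for N
  proof -
    have "(\<Sum>k<N. ?g k *\<^sub>R (X k, Y k)) \<in> Q"
      by (intro subspace_sum[OF Q(1)] subspace_scale[OF Q(1)] XY)
    also have "(\<Sum>k<N. ?g k *\<^sub>R (X k, Y k)) = (\<Sum>k<N. ?g k *\<^sub>R X k, \<Sum>k<N. ?g k *\<^sub>R Y k)"
      by (simp add: sum_prod)
    finally show ?thesis .
  qed
  ultimately show ?thesis by (rule closed_sequentially[OF Q(2), rotated])
qed

lemma op_app_eq:
  assumes "single_valued Q" "(x, y) \<in> Q" shows "op_app Q x = y"
  unfolding op_app_def by (rule the_equality[where a = y]) (fact assms(2), rule single_valuedD[OF assms(1) _ assms(2)])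

text \<open>The Caputo derivative shifts the coefficients of the series, and \<open>Q2\<close> maps the shifted coefficients
  \<open>X (k + 1)\<close> to \<open>Q1 (X k)\<close>.\<close>

theorem cauchy_solution_mittag_leffler:
  fixes Q1 Q2 :: "('b::banach \<times> 'b) set"
  assumes \<alpha>: "\<alpha> > 0" and Q1: "subspace Q1" "closed Q1" "single_valued Q1"
    and Q2: "subspace Q2" "closed Q2" "single_valued Q2" and x: "chain_vector Q1 Q2 x"
  obtains X where "geometrically_bounded X" "cauchy_solution \<alpha> Q1 Q2 x (mittag_leffler \<alpha> 0 X)"
proof -
  from x obtain X Y1 Y2 where X:
    "X 0 = x" "\<And>k. (X k, Y1 k) \<in> Q1" "\<And>k. (X k, Y2 k) \<in> Q2" "\<And>k. Y2 (Suc k) = Y1 k"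
    "geometrically_bounded X" "geometrically_bounded Y1" "geometrically_bounded Y2"
    unfolding chain_vector_def by blast
  let ?E = "mittag_leffler \<alpha> 0"
  let ?u = "?E X"
  have in1: "(?u t, ?E Y1 t) \<in> Q1" if "t \<ge> 0" for t
    by (rule mittag_leffler_in_closed_subspace[OF Q1(1,2) X(2,5,6) \<alpha> that])
  have in2: "(?u t, ?E Y2 t) \<in> Q2" if "t \<ge> 0" for t
    by (rule mittag_leffler_in_closed_subspace[OF Q2(1,2) X(3,5,7) \<alpha> that])
  have cap: "caputo \<alpha> ?u t = ?E (\<lambda>k. X (Suc k)) t" if "t \<ge> 0" for t
    by (rule caputo_mittag_leffler[OF \<alpha> X(5) that])
  have cap2: "(caputo \<alpha> ?u t, ?E Y1 t) \<in> Q2" if "t \<ge> 0" for t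
  proof -
    have "(?E (\<lambda>k. X (Suc k)) t, ?E (\<lambda>k. Y2 (Suc k)) t) \<in> Q2"
      by (rule mittag_leffler_in_closed_subspace[OF Q2(1,2) X(3) geometrically_bounded_Suc[OF X(5)] geometrically_bounded_Suc[OF X(7)] \<alpha> that])
    then show ?thesis using cap[OF that] by (simp add: X(4))
  qed
  have Q2u: "?E Y2 t = op_app Q2 (?u t)" if "t \<ge> 0" for t
    using op_app_eq[OF Q2(3) in2[OF that]] by simp
  have "cauchy_solution \<alpha> Q1 Q2 x ?u"
    unfolding cauchy_solution_def
  proof (intro conjI allI impI ballI)
    show "continuous_on {0..} ?u" by (rule continuous_on_mittag_leffler[OF \<alpha> X(5) order.refl])
    show "caputo_defined \<alpha> ?u" by (rule caputo_defined_mittag_leffler[OF \<alpha> X(5)])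
    show "caputo_defined \<alpha> (\<lambda>t. op_app Q2 (?u t))"
      by (rule caputo_defined_cong[OF Q2u caputo_defined_mittag_leffler[OF \<alpha> X(7)]])
    show "?u 0 = x" using mittag_leffler_0_at_0[OF \<alpha> X(5)] X(1) by simp
    show "nderiv j ?u 0 = 0" if "j \<in> {1..nat \<lceil>\<alpha>\<rceil> - 1}" for j
      using that by (intro nderiv_mittag_leffler_at_0[OF \<alpha> X(5)]) auto
    fix t :: real assume t: "t \<ge> 0"
    show "?u t \<in> Domain Q1 \<inter> Domain Q2" using in1[OF t] in2[OF t] by blast
    show "caputo \<alpha> ?u t \<in> Domain Q2" using cap2[OF t] by blast
    have "caputo \<alpha> (\<lambda>s. op_app Q2 (?u s)) t = ?E (\<lambda>k. Y2 (Suc k)) t"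
      using caputo_cong[OF Q2u t] caputo_mittag_leffler[OF \<alpha> X(7) t] by simp
    then show "caputo \<alpha> (\<lambda>s. op_app Q2 (?u s)) t = op_app Q2 (caputo \<alpha> ?u t)"
      using op_app_eq[OF Q2(3) cap2[OF t]] by (simp add: X(4))
    show "op_app Q2 (caputo \<alpha> ?u t) = op_app Q1 (?u t)"
      using op_app_eq[OF Q2(3) cap2[OF t]] op_app_eq[OF Q1(3) in1[OF t]] by simp
  qed
  with X(5) show ?thesis by (rule that)
qed

section \<open>The Cauchy problem for polynomials in commuting generators\<close>

lemma subspace_closure:
  fixes S :: "'b::real_normed_vector set"
  assumes S: "subspace S" shows "subspace (closure S)"
proof (rule subspaceI)
  show "0 \<in> closure S" using subspace_0[OF S] closure_subset by blast
next
  fix x y assume "x \<in> closure S" "y \<in> closure S"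
  then obtain f g where f: "\<And>n. f n \<in> S" "f \<longlonglongrightarrow> x" and g: "\<And>n. g n \<in> S" "g \<longlonglongrightarrow> y"
    unfolding closure_sequential by metis
  then show "x + y \<in> closure S"
    unfolding closure_sequential
    by (intro exI[of _ "\<lambda>n. f n + g n"] conjI allI tendsto_add subspace_add[OF S])
next
  fix c x assume "x \<in> closure S"
  then obtain f where f: "\<And>n. f n \<in> S" "f \<longlonglongrightarrow> x"
    unfolding closure_sequential by metis
  then show "c *\<^sub>R x \<in> closure S"
    unfolding closure_sequential
    by (intro exI[of _ "\<lambda>n. c *\<^sub>R f n"] conjI allI tendsto_scaleR tendsto_const subspace_scale[OF S])
qed

lemma subspace_relcomp:
  assumes R: "subspace R" and S: "subspace S" shows "subspace (R O S)"
proof (rule subspaceI)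
  show "0 \<in> R O S" using subspace_0[OF R] subspace_0[OF S] by (auto simp: zero_prod_def)
  show "p + q \<in> R O S" if pq: "p \<in> R O S" "q \<in> R O S" for p q
  proof -
    obtain x y z x' y' z' where *: "p = (x, z)" "q = (x', z')" "(x, y) \<in> R" "(y, z) \<in> S" "(x', y') \<in> R" "(y', z') \<in> S"
      using pq by blast
    have "(x + x', y + y') \<in> R" "(y + y', z + z') \<in> S"
      using subspace_add[OF R *(3,5)] subspace_add[OF S *(4,6)] by simp_all
    then show ?thesis using *(1,2) by auto
  qed
  show "c *\<^sub>R p \<in> R O S" if p: "p \<in> R O S" for c p
  proof -
    obtain x y z where *: "p = (x, z)" "(x, y) \<in> R" "(y, z) \<in> S" using p by blast
    have "(c *\<^sub>R x, c *\<^sub>R y) \<in> R" "(c *\<^sub>R y, c *\<^sub>R z) \<in> S"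
      using subspace_scale[OF R *(2), of c] subspace_scale[OF S *(3), of c] by simp_all
    then show ?thesis using *(1) by auto
  qed
qed

lemma subspace_Id: "subspace (Id :: ('b::real_vector \<times> 'b) set)"
  by (rule subspaceI) (auto simp: zero_prod_def)

context commuting_groups
begin

lemma subspace_A: "subspace (A j)"
proof (rule subspaceI)
  show "0 \<in> A j" using A_scaleR[OF Band_in_A[where r = 1 and j = j], of 0] by (simp add: zero_prod_def)
qed (auto intro: A_add A_scaleR)

lemma subspace_op_monomial: "subspace (op_monomial A \<eta>)"
proof -
  have pow: "subspace (A j ^^ k)" for j k
    by (induction k) (auto intro: subspace_relcomp subspace_A subspace_Id)
  have "subspace R \<Longrightarrow> subspace (fold (\<lambda>j R. (A j ^^ \<eta> j) O R) js R)" for js and R :: "('a \<times> 'a) set"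
    by (induction js arbitrary: R) (auto intro: subspace_relcomp pow)
  then show ?thesis unfolding op_monomial_def by (simp add: subspace_Id)
qed

lemma subspace_poly_graph:
  assumes C: "\<And>\<eta>. admissible (C \<eta>)" shows "subspace (poly_graph d C)"
proof -
  have lin: "linear (C \<eta>)" for \<eta> using C by (auto simp: admissible_def bounded_linear.linear)
  show ?thesis
  proof (rule subspaceI)
    show "0 \<in> poly_graph d C"
      unfolding poly_graph_def
      by (intro CollectI exI[of _ 0] exI[of _ "\<lambda>_. 0"])
         (use subspace_0[OF subspace_op_monomial] linear_0[OF lin] in \<open>auto simp: zero_prod_def\<close>)
  next
    fix p q assume "p \<in> poly_graph d C" "q \<in> poly_graph d C"
    then obtain v w v' w' where *:
      "p = (v, \<Sum>\<eta>\<in>multi_indices d. C \<eta> (w \<eta>))" "\<And>\<eta>. \<eta> \<in> multi_indices d \<Longrightarrow> (v, w \<eta>) \<in> op_monomial A \<eta>"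
      "q = (v', \<Sum>\<eta>\<in>multi_indices d. C \<eta> (w' \<eta>))" "\<And>\<eta>. \<eta> \<in> multi_indices d \<Longrightarrow> (v', w' \<eta>) \<in> op_monomial A \<eta>"
      unfolding poly_graph_def by blast
    have "(v + v', w \<eta> + w' \<eta>) \<in> op_monomial A \<eta>" if "\<eta> \<in> multi_indices d" for \<eta>
      using subspace_add[OF subspace_op_monomial *(2)[OF that] *(4)[OF that]] by simp
    then show "p + q \<in> poly_graph d C"
      unfolding poly_graph_def
      by (intro CollectI exI[of _ "v + v'"] exI[of _ "\<lambda>\<eta>. w \<eta> + w' \<eta>"])
         (simp add: *(1,3) linear_add[OF lin] sum.distrib)
  next
    fix c p assume "p \<in> poly_graph d C"
    then obtain v w where *:
      "p = (v, \<Sum>\<eta>\<in>multi_indices d. C \<eta> (w \<eta>))" "\<And>\<eta>. \<eta> \<in> multi_indices d \<Longrightarrow> (v, w \<eta>) \<in> op_monomial A \<eta>"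
      unfolding poly_graph_def by blast
    have "(c *\<^sub>R v, c *\<^sub>R w \<eta>) \<in> op_monomial A \<eta>" if "\<eta> \<in> multi_indices d" for \<eta>
      using subspace_scale[OF subspace_op_monomial *(2)[OF that], of c] by simp
    then show "c *\<^sub>R p \<in> poly_graph d C"
      unfolding poly_graph_def
      by (intro CollectI exI[of _ "c *\<^sub>R v"] exI[of _ "\<lambda>\<eta>. c *\<^sub>R w \<eta>"])
         (simp add: *(1) linear_scale[OF lin] scaleR_sum_right)
  qed
qed

lemma band_products_separate:
  assumes "\<And>R. R > 0 \<Longrightarrow> band_product (\<lambda>_. - R) R (\<lambda>_. 0) coords y = 0"
  shows "y = 0"
proof -
  have lim: "((\<lambda>R. (1 / hat_mass R) ^ length coords *\<^sub>R band_product (\<lambda>_. - R) R (\<lambda>_. 0) coords y) \<longlongrightarrow> y) at_top"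
    by (rule band_product_approximates_identity[where Y = "\<lambda>_. y"]) simp
  have "\<forall>\<^sub>F R in at_top. (1 / hat_mass R) ^ length coords *\<^sub>R band_product (\<lambda>_. - R) R (\<lambda>_. 0) coords y = 0"
    using eventually_gt_at_top[of 0] by eventually_elim (simp add: assms)
  from Lim_transform_eventually[OF lim this]
  show ?thesis by (rule tendsto_unique[OF trivial_limit_at_top_linorder _ tendsto_const])
qed

lemma entry_moments_0: "r > 0 \<Longrightarrow> entry (moments a r y) (\<lambda>_. 0) = band_product a r (\<lambda>_. 0) coords y"
  by (simp add: entry_moments)

text \<open>Polynomials in the generators are closable: the moments of the image are determined by those of the
  argument, and a vector is determined by its components in wide boxes.\<close>

lemma single_valued_closure_poly_graph:
  assumes C: "\<And>\<eta>. admissible (C \<eta>)" shows "single_valued (closure (poly_graph d C))"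
proof (rule single_valuedI)
  fix x y y' assume xy: "(x, y) \<in> closure (poly_graph d C)" "(x, y') \<in> closure (poly_graph d C)"
  have "y - y' = 0"
  proof (rule band_products_separate)
    fix R :: real assume R: "R > 0"
    have "moments (\<lambda>_. - R) R y = moments (\<lambda>_. - R) R y'"
      using moments_poly[OF R C xy(1)] moments_poly[OF R C xy(2)] by simp
    then have "moments (\<lambda>_. - R) R (y - y') = 0"
      by (simp add: linear_diff[OF bounded_linear.linear[OF bounded_linear_moments[OF R]]])
    then show "band_product (\<lambda>_. - R) R (\<lambda>_. 0) coords (y - y') = 0"
      using entry_moments_0[OF R, of "\<lambda>_. - R" "y - y'"] by simp
  qed
  then show "y = y'" by simp
qed

lemma admissible_symbol:
  assumes C: "\<And>\<eta>. admissible (C \<eta>)" shows "admissible (symbol d C b)"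
proof -
  have C': "bounded_linear (C \<eta>)" "C \<eta> (c *\<^sub>C x) = c *\<^sub>C C \<eta> x" "C \<eta> (T j t x) = T j t (C \<eta> x)" for \<eta> c x j t
    using C by (auto simp: admissible_def)
  have lT: "linear (T j t)" for j t by (rule bounded_linear.linear[OF T_linear])
  have "bounded_linear (symbol d C b)"
    unfolding symbol_def[abs_def]
    by (intro bounded_linear_sum bounded_linear_compose[OF bounded_linear_scaleR_right] C'(1))
  moreover have "symbol d C b (c *\<^sub>C x) = c *\<^sub>C symbol d C b x" for c x
    by (simp add: symbol_def C'(2) scaleC.sum_right scaleC.scaleR_right)
  moreover have "symbol d C b (T j t x) = T j t (symbol d C b x)" for j t x
    by (simp add: symbol_def C'(3) linear_sum[OF lT] linear_scale[OF lT])
  ultimately show ?thesis by (simp add: admissible_def)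
qed

text \<open>Near a point where the symbol is invertible, the polynomial in the shifts is a small perturbation of an
  invertible operator.\<close>

lemma shift_poly_invertible:
  assumes C: "\<And>\<eta>. admissible (C \<eta>)" and I: "admissible I"
    and inv: "\<And>x. I (symbol d C b x) = x" "\<And>x. symbol d C b (I x) = x"
  obtains \<delta> where "\<delta> > 0"
    "\<And>a r z. near b \<delta> a r \<Longrightarrow> norm z \<le> 2 * onorm I * norm (shift_poly d C a r z)"
    "\<And>a r w. near b \<delta> a r \<Longrightarrow> w \<in> joint a r \<Longrightarrow> \<exists>z\<in>joint a r. shift_poly d C a r z = w"
proof -
  let ?S = "entrywise (symbol d C b)" and ?I = "entrywise I"
  have aS: "admissible (symbol d C b)" by (rule admissible_symbol[OF C])
  have blS: "bounded_linear (symbol d C b)" and blI: "bounded_linear I" using aS I by (auto simp: admissible_def)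
  have linI: "linear ?I" and linP: "linear (shift_poly d C a r)" and linS: "linear ?S" for a r
    using bounded_linear_entrywise[OF blI] bounded_linear_shift_poly[OF C] bounded_linear_entrywise[OF blS]
    by (auto intro: bounded_linear.linear)
  have IS: "?I (?S z) = z" and SI: "?S (?I z) = z" for z
    by (rule family_eqI, simp add: entry_entrywise[OF blI] entry_entrywise[OF blS] inv)+
  obtain K where K1: "K \<ge> 0" and K2: "\<forall>\<delta> a r z. 0 < \<delta> \<and> \<delta> \<le> 1 \<and> near b \<delta> a r \<longrightarrow>
      norm (shift_poly d C a r z - ?S z) \<le> K * \<delta> * norm z"
    using shift_poly_close_to_symbol[where C = C and b = b and d = d, OF C] by (elim exE conjE)
  note K = K1 K2[rule_format, OF conjI, OF _ conjI]
  define \<kappa> where "\<kappa> = onorm I"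
  have \<kappa>: "\<kappa> \<ge> 0" unfolding \<kappa>_def by (rule onorm_pos_le[OF blI])
  \<comment> \<open>Chosen so that the perturbation, multiplied by the inverse \<open>I\<close> of the symbol, has norm at most \<open>1/2\<close>.\<close>
  define \<delta> where "\<delta> = min 1 (1 / (2 * (\<kappa> * K + 1)))"
  have \<kappa>K: "\<kappa> * K \<ge> 0" using \<kappa> K(1) by simp
  then have \<delta>: "0 < \<delta>" "\<delta> \<le> 1" unfolding \<delta>_def by auto
  have \<delta>K: "\<kappa> * (K * \<delta>) \<le> 1 / 2"
  proof -
    have "\<kappa> * (K * \<delta>) \<le> (\<kappa> * K) * (1 / (2 * (\<kappa> * K + 1)))"
      unfolding mult.assoc[symmetric] by (rule mult_left_mono) (use \<kappa>K in \<open>auto simp: \<delta>_def\<close>)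
    also have "\<dots> \<le> 1 / 2" using \<kappa>K by (simp add: field_simps)
    finally show ?thesis .
  qed
  have half: "norm (?I (shift_poly d C a r z - ?S z)) \<le> 1 / 2 * norm z" if "near b \<delta> a r" for a r z
  proof -
    have "norm (?I (shift_poly d C a r z - ?S z)) \<le> \<kappa> * (K * \<delta> * norm z)"
      unfolding \<kappa>_def
      by (rule order_trans[OF norm_entrywise_le[OF blI]]) (intro mult_left_mono K(2)[OF \<delta> that] onorm_pos_le[OF blI])
    also have "\<dots> \<le> 1 / 2 * norm z" using mult_right_mono[OF \<delta>K, of "norm z"] by (simp add: mult.assoc)
    finally show ?thesis .
  qed
  show ?thesis
  proof (rule that[OF \<delta>(1)])
    fix a r z assume n: "near b \<delta> a r"
    have "z = ?I (shift_poly d C a r z) - ?I (shift_poly d C a r z - ?S z)"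
      by (simp add: linear_diff[OF linI] IS)
    also have "norm \<dots> \<le> norm (?I (shift_poly d C a r z)) + norm (?I (shift_poly d C a r z - ?S z))"
      by (rule norm_triangle_ineq4)
    also have "\<dots> \<le> \<kappa> * norm (shift_poly d C a r z) + 1 / 2 * norm z"
      unfolding \<kappa>_def by (intro add_mono norm_entrywise_le[OF blI] half[OF n])
    finally show "norm z \<le> 2 * onorm I * norm (shift_poly d C a r z)" by (simp add: \<kappa>_def)
  next
    fix a r w assume n: "near b \<delta> a r" and w: "w \<in> joint a r"
    have r: "r > 0" using n by (simp add: near_def)
    \<comment> \<open>The Neumann iteration runs in the complete set \<open>joint a r\<close>.\<close>
    define F where "F z = ?I (w - (shift_poly d C a r z - ?S z))" for z
    have "\<exists>!z\<in>joint a r. F z = z"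
    proof (rule Banach_fix[where c = "1/2"])
      show "complete (joint a r)" by (simp add: complete_eq_closed closed_joint)
      show "joint a r \<noteq> {}" using w by blast
      show "F ` joint a r \<subseteq> joint a r"
        unfolding F_def by (auto intro!: joint_entrywise[OF I] joint_diff w joint_shift_poly[OF r C] joint_entrywise[OF aS])
      show "dist (F x) (F y) \<le> 1 / 2 * dist x y" for x y
      proof -
        have "F x - F y = ?I (shift_poly d C a r (y - x) - ?S (y - x))"
          by (simp add: F_def linear_diff[OF linI, symmetric] linear_diff[OF linP] linear_diff[OF linS] algebra_simps)
        then show "dist (F x) (F y) \<le> 1 / 2 * dist x y"
          using half[OF n, of "y - x"] by (simp add: dist_norm norm_minus_commute)
      qed
    qed auto
    then obtain z where z: "z \<in> joint a r" "F z = z" by blast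
    have "?S z = w - (shift_poly d C a r z - ?S z)" using z(2) SI[of "w - (shift_poly d C a r z - ?S z)"] by (simp add: F_def)
    then have "shift_poly d C a r z = w" by (simp add: algebra_simps)
    with z(1) show "\<exists>z\<in>joint a r. shift_poly d C a r z = w" by blast
  qed
qed

context
  fixes d :: nat and C1 C2 :: "('n \<Rightarrow> nat) \<Rightarrow> 'a \<Rightarrow> 'a"
  assumes C1: "\<And>\<eta>. admissible (C1 \<eta>)" and C2: "\<And>\<eta>. admissible (C2 \<eta>)"
    and inv: "\<And>b. \<exists>I. admissible I \<and> (\<forall>x. I (symbol d C2 b x) = x) \<and> (\<forall>x. symbol d C2 b (I x) = x)"
begin

abbreviation "Q1 \<equiv> closure (poly_graph d C1)"
abbreviation "Q2 \<equiv> closure (poly_graph d C2)"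

text \<open>The recursion \<open>P2 (Z (k + 1)) = P1 (Z k)\<close>, started at the moments of \<open>y\<close>, is solvable among the joint
  families with a geometric bound, and the entries at \<open>0\<close> solve it in the space itself.\<close>

lemma chain_vector_local:
  "\<exists>\<delta>>0. \<forall>a r. 0 < r \<and> (\<forall>j. \<bar>a j - b j\<bar> + 2 * r \<le> \<delta>) \<longrightarrow>
     band_product a r (\<lambda>_. 0) coords y \<in> {x. chain_vector Q1 Q2 x}"
proof -
  obtain I where I: "admissible I" "\<And>x. I (symbol d C2 b x) = x" "\<And>x. symbol d C2 b (I x) = x" using inv by blast
  obtain \<delta> where \<delta>: "\<delta> > 0"
    "\<And>a r z. near b \<delta> a r \<Longrightarrow> norm z \<le> 2 * onorm I * norm (shift_poly d C2 a r z)"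
    "\<And>a r w. near b \<delta> a r \<Longrightarrow> w \<in> joint a r \<Longrightarrow> \<exists>z\<in>joint a r. shift_poly d C2 a r z = w"
    using shift_poly_invertible[OF C2 I] by blast
  have "chain_vector Q1 Q2 (band_product a r (\<lambda>_. 0) coords y)" if n: "near b \<delta> a r" for a r
  proof -
    have r: "r > 0" using n by (simp add: near_def)
    let ?P1 = "shift_poly d C1 a r" and ?P2 = "shift_poly d C2 a r"
    have bl1: "bounded_linear ?P1" and bl2: "bounded_linear ?P2" by (intro bounded_linear_shift_poly C1 C2)+
    define step where "step z = (SOME z'. z' \<in> joint a r \<and> ?P2 z' = ?P1 z)" for z
    have nxt: "step z \<in> joint a r \<and> ?P2 (step z) = ?P1 z" if "z \<in> joint a r" for z
      using \<delta>(3)[OF n joint_shift_poly[OF r C1 that]] unfolding step_def Bex_def by (rule someI_ex)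
    define Z where "Z k = (step ^^ k) (moments a r y)" for k
    have Zj: "Z k \<in> joint a r" for k
      by (induction k) (use moments_joint[OF r] nxt in \<open>auto simp: Z_def\<close>)
    have ZS: "?P2 (Z (Suc k)) = ?P1 (Z k)" for k using nxt[OF Zj[of k]] by (simp add: Z_def)
    define c where "c = 2 * onorm I * onorm ?P1"
    have c: "c \<ge> 0" using I(1) bl1 by (auto simp: c_def admissible_def intro!: mult_nonneg_nonneg onorm_pos_le)
    have Zn: "norm (Z k) \<le> norm (Z 0) * c ^ k" for k
    proof (induction k)
      case (Suc k)
      have "norm (Z (Suc k)) \<le> 2 * onorm I * norm (?P1 (Z k))" using \<delta>(2)[OF n, of "Z (Suc k)"] ZS by simp
      also have "\<dots> \<le> 2 * onorm I * (onorm ?P1 * norm (Z k))"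
        using I(1) by (intro mult_left_mono onorm[OF bl1]) (auto simp: admissible_def intro: onorm_pos_le)
      also have "\<dots> = c * norm (Z k)" by (simp add: c_def)
      also have "\<dots> \<le> c * (norm (Z 0) * c ^ k)" using Suc c by (intro mult_left_mono) auto
      finally show ?case by (simp add: mult_ac)
    qed simp
    have gb: "geometrically_bounded (\<lambda>k. entry (L (Z k)) (\<lambda>_. 0))" if L: "bounded_linear L" for L
    proof -
      have "norm (entry (L (Z k)) (\<lambda>_. 0)) \<le> (onorm L * norm (Z 0)) * c ^ k" for k
      proof -
        have "norm (entry (L (Z k)) (\<lambda>_. 0)) \<le> onorm L * norm (Z k)"
          by (rule order_trans[OF norm_entry_le onorm[OF L]])
        also have "\<dots> \<le> onorm L * (norm (Z 0) * c ^ k)" by (intro mult_left_mono Zn onorm_pos_le[OF L])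
        finally show ?thesis by (simp add: mult.assoc)
      qed
      then show ?thesis unfolding geometrically_bounded_def
        using c onorm_pos_le[OF L] by (intro exI[of _ "onorm L * norm (Z 0)"] conjI exI[of _ c]) auto
    qed
    show ?thesis unfolding chain_vector_def
    proof (rule exI[of _ "\<lambda>k. entry (Z k) (\<lambda>_. 0)"], rule exI[of _ "\<lambda>k. entry (?P1 (Z k)) (\<lambda>_. 0)"],
        rule exI[of _ "\<lambda>k. entry (?P2 (Z k)) (\<lambda>_. 0)"], intro conjI allI)
      show "entry (Z 0) (\<lambda>_. 0) = band_product a r (\<lambda>_. 0) coords y"
        by (simp add: Z_def entry_moments_0[OF r])
      show "(entry (Z k) (\<lambda>_. 0), entry (?P1 (Z k)) (\<lambda>_. 0)) \<in> Q1" for k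
        by (rule subsetD[OF closure_subset entry_shift_poly_in_graph[OF C1 Zj]])
      show "(entry (Z k) (\<lambda>_. 0), entry (?P2 (Z k)) (\<lambda>_. 0)) \<in> Q2" for k
        by (rule subsetD[OF closure_subset entry_shift_poly_in_graph[OF C2 Zj]])
      show "entry (?P2 (Z (Suc k))) (\<lambda>_. 0) = entry (?P1 (Z k)) (\<lambda>_. 0)" for k by (simp add: ZS)
      show "geometrically_bounded (\<lambda>k. entry (Z k) (\<lambda>_. 0))" using gb[OF bounded_linear_ident] .
    qed (rule gb bl1 bl2)+
  qed
  then show ?thesis using \<delta>(1) by (auto simp: near_def)
qed

text \<open>By bisection the components in all boxes are chain vectors, and those in wide boxes approximate the
  identity.\<close>

lemma chain_vectors_dense: "closure {x. chain_vector Q1 Q2 x} = UNIV"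
proof -
  let ?E = "{x. chain_vector Q1 Q2 x}"
  have sub: "subspace ?E"
    by (intro subspace_chain_vector subspace_closure subspace_poly_graph C1 C2)
  have "y \<in> closure ?E" for y
  proof (rule Lim_in_closed_set[OF closed_closure])
    show "((\<lambda>R. (1 / hat_mass R) ^ length coords *\<^sub>R band_product (\<lambda>_. - R) R (\<lambda>_. 0) coords y) \<longlongrightarrow> y) at_top"
      by (rule band_product_approximates_identity[where Y = "\<lambda>_. y"]) simp
    have "(1 / hat_mass R) ^ length coords *\<^sub>R band_product (\<lambda>_. - R) R (\<lambda>_. 0) coords y \<in> ?E" if "R > 0" for R
      by (intro subspace_scale[OF sub] band_product_local_to_global[OF sub _ chain_vector_local that]) (simp add: coords_facts)
    then show "\<forall>\<^sub>F R in at_top. (1 / hat_mass R) ^ length coords *\<^sub>R band_product (\<lambda>_. - R) R (\<lambda>_. 0) coords y \<in> closure ?E"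
      using closure_subset[of ?E] by (intro eventually_mono[OF eventually_gt_at_top[of 0]]) blast
  qed simp
  then show ?thesis by blast
qed

text \<open>The difference \<open>w\<close> of two solutions is \<open>g\<^sub>\<alpha> * \<phi>\<close> with \<open>Q2 \<phi> = Q1 w\<close>. In a small box the moments turn this
  into an equation with bounded operators, of which the one on the left is invertible, so Gronwall's
  inequality makes the moments of \<open>w\<close> vanish. By bisection all components of \<open>w\<close> vanish.\<close>

lemma cauchy_solution_unique:
  assumes \<alpha>: "\<alpha> > 0" and v1: "cauchy_solution \<alpha> Q1 Q2 x v1" and v2: "cauchy_solution \<alpha> Q1 Q2 x v2" and t: "t \<ge> 0"
  shows "v1 t = v2 t"
proof -
  note sv1 = single_valued_closure_poly_graph[of C1 d, OF C1] and sv2 = single_valued_closure_poly_graph[of C2 d, OF C2]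
  have facts: "continuous_on {0..} v" "continuous_on {0..} (caputo \<alpha> v)"
    "\<And>t. t \<ge> 0 \<Longrightarrow> (v t, op_app Q1 (v t)) \<in> Q1"
    "\<And>t. t \<ge> 0 \<Longrightarrow> (caputo \<alpha> v t, op_app Q1 (v t)) \<in> Q2"
    "\<And>t. t \<ge> 0 \<Longrightarrow> v t - x = g_conv \<alpha> (caputo \<alpha> v) t"
    if v: "cauchy_solution \<alpha> Q1 Q2 x v" for v
  proof -
    have cd: "caputo_defined \<alpha> v" and v0: "v 0 = x" and nd: "\<And>j. j \<in> {1..nat \<lceil>\<alpha>\<rceil> - 1} \<Longrightarrow> nderiv j v 0 = 0"
      and dom: "\<And>t. t \<ge> 0 \<Longrightarrow> v t \<in> Domain Q1" "\<And>t. t \<ge> 0 \<Longrightarrow> caputo \<alpha> v t \<in> Domain Q2"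
      and eq: "\<And>t. t \<ge> 0 \<Longrightarrow> op_app Q2 (caputo \<alpha> v t) = op_app Q1 (v t)"
      using v unfolding cauchy_solution_def by simp_all
    show "continuous_on {0..} v" using v by (simp add: cauchy_solution_def)
    show "continuous_on {0..} (caputo \<alpha> v)"
      unfolding caputo_def using cd by (intro C_k_continuous[OF _ order.refl]) (simp add: caputo_defined_def)
    show "(v t, op_app Q1 (v t)) \<in> Q1" if "t \<ge> 0" for t
    proof -
      obtain y where "(v t, y) \<in> Q1" using dom(1)[OF \<open>t \<ge> 0\<close>] by (rule DomainE)
      then show ?thesis using op_app_eq[OF sv1] by metis
    qed
    show "(caputo \<alpha> v t, op_app Q1 (v t)) \<in> Q2" if "t \<ge> 0" for t
    proof -
      obtain y where "(caputo \<alpha> v t, y) \<in> Q2" using dom(2)[OF \<open>t \<ge> 0\<close>] by (rule DomainE)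
      then show ?thesis using op_app_eq[OF sv2] eq[OF \<open>t \<ge> 0\<close>] by metis
    qed
    show "v t - x = g_conv \<alpha> (caputo \<alpha> v) t" if "t \<ge> 0" for t
      using caputo_integral_equation[OF cd \<alpha> _ that] nd v0 by auto
  qed
  define w where "w t = v1 t - v2 t" for t
  define \<phi> where "\<phi> t = caputo \<alpha> v1 t - caputo \<alpha> v2 t" for t
  have contw: "continuous_on {0..} w" and cont\<phi>: "continuous_on {0..} \<phi>"
    unfolding w_def \<phi>_def by (intro continuous_intros facts v1 v2)+
  have w: "w t = g_conv \<alpha> \<phi> t" if "t \<ge> 0" for t
  proof -
    have "g_conv \<alpha> \<phi> t = g_conv \<alpha> (caputo \<alpha> v1) t - g_conv \<alpha> (caputo \<alpha> v2) t"
      unfolding \<phi>_def using \<alpha> that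
      by (intro g_conv_diff) (auto intro: continuous_on_subset[OF facts(2)[OF v1]] continuous_on_subset[OF facts(2)[OF v2]])
    also have "\<dots> = (v1 t - x) - (v2 t - x)" by (simp only: facts(5)[OF v1 that] facts(5)[OF v2 that])
    finally show ?thesis by (simp add: w_def)
  qed
  have loc: "\<exists>\<delta>>0. \<forall>a r. 0 < r \<and> (\<forall>j. \<bar>a j - b j\<bar> + 2 * r \<le> \<delta>) \<longrightarrow> band_product a r (\<lambda>_. 0) coords (w t) \<in> {0}" for b
  proof -
    obtain I where I: "admissible I" "\<And>x. I (symbol d C2 b x) = x" "\<And>x. symbol d C2 b (I x) = x" using inv by blast
    obtain \<delta> where \<delta>: "\<delta> > 0"
      "\<And>a r z. near b \<delta> a r \<Longrightarrow> norm z \<le> 2 * onorm I * norm (shift_poly d C2 a r z)"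
      by (rule shift_poly_invertible[where C = C2 and I = I and d = d and b = b]) (use C2 I in blast)+
    have "band_product a r (\<lambda>_. 0) coords (w t) = 0" if n: "near b \<delta> a r" for a r
    proof -
      have r: "r > 0" using n by (simp add: near_def)
      let ?m = "moments a r" and ?P1 = "shift_poly d C1 a r" and ?P2 = "shift_poly d C2 a r"
      have bm: "bounded_linear ?m" by (rule bounded_linear_moments[OF r])
      have bl1: "bounded_linear ?P1" by (intro bounded_linear_shift_poly C1)
      have lin: "linear ?m" "linear ?P1" "linear ?P2"
        using bm bl1 bounded_linear_shift_poly[OF C2] by (auto intro: bounded_linear.linear)
      have "?m (w t) = 0"
      proof (rule fractional_Gronwall[OF \<alpha> _ _ _ _ _ t])
        show "continuous_on {0..} (\<lambda>t. ?m (w t))" "continuous_on {0..} (\<lambda>t. ?m (\<phi> t))"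
          by (rule bounded_linear.continuous_on[OF bm contw] bounded_linear.continuous_on[OF bm cont\<phi>])+
        show "?m (w t) = g_conv \<alpha> (\<lambda>t. ?m (\<phi> t)) t" if "t \<ge> 0" for t
          using w[OF that] g_conv_bounded_linear[OF less_imp_le[OF \<alpha>] that continuous_on_subset[OF cont\<phi>] bm] by simp
        show "0 \<le> 2 * onorm I * onorm ?P1"
          using I(1) bl1 by (auto simp: admissible_def intro!: mult_nonneg_nonneg onorm_pos_le)
        show "norm (?m (\<phi> t)) \<le> 2 * onorm I * onorm ?P1 * norm (?m (w t))" if t: "t \<ge> 0" for t
        proof -
          have P: "?P2 (?m (caputo \<alpha> v t)) = ?P1 (?m (v t))" if v: "cauchy_solution \<alpha> Q1 Q2 x v" for v
            using moments_poly[OF r C2 facts(4)[OF v t]] moments_poly[OF r C1 facts(3)[OF v t]] by simp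
          have "?P2 (?m (\<phi> t)) = ?P1 (?m (w t))"
            by (simp add: \<phi>_def w_def linear_diff[OF lin(1)] linear_diff[OF lin(2)] linear_diff[OF lin(3)] P[OF v1] P[OF v2])
          then have "norm (?m (\<phi> t)) \<le> 2 * onorm I * norm (?P1 (?m (w t)))" using \<delta>(2)[OF n, of "?m (\<phi> t)"] by simp
          also have "\<dots> \<le> 2 * onorm I * (onorm ?P1 * norm (?m (w t)))"
            using I(1) by (intro mult_left_mono onorm[OF bl1]) (auto simp: admissible_def intro: onorm_pos_le)
          finally show ?thesis by (simp add: mult.assoc)
        qed
      qed
      then show ?thesis using entry_moments_0[OF r, of a "w t"] by simp
    qed
    then show ?thesis using \<delta>(1) by (auto simp: near_def)
  qed
  have "w t = 0"
    by (rule band_products_separate)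
       (use band_product_local_to_global[OF subspace_single_0 _ loc] coords_facts in auto)
  then show ?thesis by (simp add: w_def)
qed

theorem cauchy_problem:
  assumes \<alpha>: "\<alpha> > 0"
  shows "\<exists>E. closure E = UNIV \<and>
    (\<forall>x\<in>E. \<exists>u :: real \<Rightarrow> 'a.
       cauchy_solution \<alpha> Q1 Q2 x u \<and>
       (\<forall>v. cauchy_solution \<alpha> Q1 Q2 x v \<longrightarrow> (\<forall>t\<ge>0. v t = u t)) \<and>
       (\<exists>U :: complex \<Rightarrow> 'a.
          (\<forall>t\<ge>0. U (complex_of_real t) = u t) \<and>
          vec_holomorphic_on U (UNIV - complex_of_real ` {..0}) \<and>
          (\<alpha> \<in> \<nat> \<longrightarrow> vec_holomorphic_on U UNIV)))"
proof (intro exI[of _ "{x. chain_vector Q1 Q2 x}"] conjI ballI chain_vectors_dense)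
  fix x assume "x \<in> {x. chain_vector Q1 Q2 x}"
  then obtain X where X: "geometrically_bounded X" "cauchy_solution \<alpha> Q1 Q2 x (mittag_leffler \<alpha> 0 X)"
    using cauchy_solution_mittag_leffler[OF \<alpha>, of Q1 Q2 x] subspace_closure[OF subspace_poly_graph]
      single_valued_closure_poly_graph C1 C2 closed_closure by (metis (mono_tags) mem_Collect_eq)
  obtain U where "\<And>t. t \<ge> 0 \<Longrightarrow> U (complex_of_real t) = mittag_leffler \<alpha> 0 X t"
    "vec_holomorphic_on U (UNIV - complex_of_real ` {..0})" "\<alpha> \<in> \<nat> \<Longrightarrow> vec_holomorphic_on U UNIV"
    using mittag_leffler_extension[OF \<alpha> X(1)] by blast
  then show "\<exists>u. cauchy_solution \<alpha> Q1 Q2 x u \<and>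
       (\<forall>v. cauchy_solution \<alpha> Q1 Q2 x v \<longrightarrow> (\<forall>t\<ge>0. v t = u t)) \<and>
       (\<exists>U. (\<forall>t\<ge>0. U (complex_of_real t) = u t) \<and>
          vec_holomorphic_on U (UNIV - complex_of_real ` {..0}) \<and>
          (\<alpha> \<in> \<nat> \<longrightarrow> vec_holomorphic_on U UNIV))"
    using X(2) cauchy_solution_unique[OF \<alpha> _ X(2)] by blast
qed

end

end

section \<open>Componentwise action on \<open>X\<^sup>m\<close>\<close>

text \<open>The space \<open>X\<^sup>m\<close> carries the groups that act componentwise, with the componentwise generators. A
  polynomial matrix is a polynomial in these generators with complex matrices as coefficients.\<close>

definition vec_graph :: "('a \<times> 'b) set \<Rightarrow> (('a ^ 'm) \<times> ('b ^ 'm)) set" where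
  "vec_graph R = {(v, w). \<forall>k. (v $ k, w $ k) \<in> R}"

definition vec_map :: "('a \<Rightarrow> 'b) \<Rightarrow> 'a ^ 'm \<Rightarrow> 'b ^ 'm" where
  "vec_map f v = (\<chi> k. f (v $ k))"

lemma vec_graph_iff: "(v, w) \<in> vec_graph R \<longleftrightarrow> (\<forall>k. (v $ k, w $ k) \<in> R)"
  by (simp add: vec_graph_def)

lemma vec_graph_relcomp: "vec_graph (R O S) = vec_graph R O vec_graph S"
proof (intro set_eqI iffI; clarify)
  fix v w assume "(v, w) \<in> vec_graph (R O S)"
  then have "\<forall>k. \<exists>u. (v $ k, u) \<in> R \<and> (u, w $ k) \<in> S" by (auto simp: vec_graph_iff)
  then obtain u where "\<forall>k. (v $ k, u k) \<in> R \<and> (u k, w $ k) \<in> S" by metis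
  then have "(v, \<chi> k. u k) \<in> vec_graph R" "(\<chi> k. u k, w) \<in> vec_graph S" by (auto simp: vec_graph_iff)
  then show "(v, w) \<in> vec_graph R O vec_graph S" by blast
next
  fix v u w assume "(v, u) \<in> vec_graph R" "(u, w) \<in> vec_graph S"
  then show "(v, w) \<in> vec_graph (R O S)" by (auto simp: vec_graph_iff)
qed

lemma vec_graph_Id: "vec_graph Id = Id"
  by (auto simp: vec_graph_def vec_eq_iff)

lemma vec_graph_relpow:
  fixes R :: "('a \<times> 'a) set"
  shows "vec_graph (R ^^ k) = (vec_graph R ^^ k :: (('a ^ 'm) \<times> ('a ^ 'm)) set)"
  by (induction k) (simp_all add: vec_graph_Id vec_graph_relcomp)

lemma vec_graph_op_monomial:
  "(vec_graph (op_monomial A \<eta>) :: (('a ^ 'm) \<times> ('a ^ 'm)) set) = op_monomial (\<lambda>j. vec_graph (A j)) \<eta>"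
proof -
  have "vec_graph (fold (\<lambda>j R. (A j ^^ \<eta> j) O R) js R)
      = fold (\<lambda>j R. (vec_graph (A j) ^^ \<eta> j) O R) js (vec_graph R :: (('a ^ 'm) \<times> ('a ^ 'm)) set)" for js and R :: "('a \<times> 'a) set"
    by (induction js arbitrary: R) (simp_all add: vec_graph_relcomp vec_graph_relpow)
  then show ?thesis by (simp add: op_monomial_def vec_graph_Id)
qed

lemma op_scaleC_i_iff': "(x, z) \<in> op_scaleC \<i> S \<longleftrightarrow> (x, (- \<i>) *\<^sub>C z) \<in> S"
proof -
  have "z = \<i> *\<^sub>C (- \<i>) *\<^sub>C z" using scaleC_of_real[of 1 z] by (simp add: scaleC_scaleC)
  then show ?thesis using op_scaleC_i_iff[of x "(- \<i>) *\<^sub>C z" S] by simp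
qed

lemma vec_graph_op_scaleC_i: "vec_graph (op_scaleC \<i> S) = op_scaleC \<i> (vec_graph S)"
  by (auto simp: vec_graph_iff op_scaleC_i_iff' scaleC_vec_def)

lemma vec_graph_group_generator: "vec_graph (group_generator T) = group_generator (\<lambda>t. vec_map (T t))"
proof (intro set_eqI iffI; clarify)
  fix v w :: "'a ^ 'm"
  assume "(v, w) \<in> vec_graph (group_generator T)"
  then show "(v, w) \<in> group_generator (\<lambda>t. vec_map (T t))"
    unfolding group_generator_def vec_graph_def
    by (auto intro!: vec_tendstoI simp: vec_map_def)
next
  fix v w :: "'a ^ 'm"
  assume "(v, w) \<in> group_generator (\<lambda>t. vec_map (T t))"
  then have "((\<lambda>h. (vec_map (T h) v - v) /\<^sub>R h) \<longlongrightarrow> w) (at 0)" by (simp add: group_generator_def)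
  from tendsto_vec_nth[OF this] show "(v, w) \<in> vec_graph (group_generator T)"
    by (auto simp: group_generator_def vec_graph_def vec_map_def)
qed

lemma norm_vec_map_le:
  assumes M: "M \<ge> 0" and T: "\<And>x. norm (T x) \<le> M * norm x"
  shows "norm (vec_map T v) \<le> M * norm v"
proof -
  have "L2_set (\<lambda>k. norm (T (v $ k))) UNIV \<le> L2_set (\<lambda>k. M * norm (v $ k)) UNIV"
    by (rule L2_set_mono) (auto intro: T)
  then show ?thesis using M by (simp add: norm_vec_def vec_map_def L2_set_right_distrib)
qed

lemma bounded_group_vec:
  assumes "bounded_group T M" shows "bounded_group (\<lambda>t. vec_map (T t) :: 'a::complex_banach ^ 'm \<Rightarrow> 'a ^ 'm) M"
proof -
  interpret bounded_group T M by (rule assms)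
  have lin: "linear (T t)" for t by (rule bounded_linear.linear[OF T_linear])
  have b: "norm (vec_map (T t) v) \<le> M * norm v" for t and v :: "'a ^ 'm"
    by (rule norm_vec_map_le[OF M bound])
  show ?thesis
  proof
    show "bounded_C0_group (\<lambda>t. vec_map (T t) :: 'a ^ 'm \<Rightarrow> 'a ^ 'm)"
      unfolding bounded_C0_group_def
    proof (intro conjI allI)
      show "bounded_linear (vec_map (T t) :: 'a ^ 'm \<Rightarrow> 'a ^ 'm)" for t
      proof (rule bounded_linear_intro)
        show "norm (vec_map (T t) v) \<le> norm v * M" for v :: "'a ^ 'm" using b[of t v] by (simp add: mult.commute)
      qed (simp_all add: vec_map_def vec_eq_iff linear_add[OF lin] linear_scale[OF lin])
      show "((\<lambda>t. vec_map (T t) v) \<longlongrightarrow> v) (at 0)" for v :: "'a ^ 'm"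
        by (rule vec_tendstoI) (simp add: vec_map_def T_tendsto)
      show "\<exists>M. \<forall>t (v::'a ^ 'm). norm (vec_map (T t) v) \<le> M * norm v" using b by blast
    qed (simp_all add: vec_map_def vec_eq_iff scaleC_vec_def T_scaleC T_0 T_add)
  qed (use M b in auto)
qed

lemma commuting_groups_vec:
  assumes "commuting_groups A T M"
  shows "commuting_groups (\<lambda>j. vec_graph (A j) :: (('a::complex_banach ^ 'm) \<times> ('a ^ 'm)) set) (\<lambda>j t. vec_map (T j t)) M"
proof -
  interpret commuting_groups A T M by (rule assms)
  show ?thesis
  proof (rule commuting_groups.intro)
    show "bounded_group (\<lambda>t. vec_map (T j t) :: 'a ^ 'm \<Rightarrow> 'a ^ 'm) M" for j by (rule bounded_group_vec[OF groups])
    show "op_scaleC \<i> (vec_graph (A j) :: (('a ^ 'm) \<times> ('a ^ 'm)) set) = group_generator (\<lambda>t. vec_map (T j t))" for j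
      by (simp flip: vec_graph_op_scaleC_i vec_graph_group_generator add: generators)
    show "vec_map (T j s) (vec_map (T k t) v) = vec_map (T k t) (vec_map (T j s) v)" for j k s t and v :: "'a ^ 'm"
      using commute by (simp add: vec_map_def)
  qed
qed

lemma bounded_linear_matrix_app: "bounded_linear (matrix_app N :: 'a::complex_banach ^ 'm \<Rightarrow> 'a ^ 'm)"
proof (rule bounded_linear_intro)
  show "norm (matrix_app N v) \<le> norm v * (\<Sum>i\<in>UNIV. \<Sum>k\<in>UNIV. norm (N $ i $ k))" for v :: "'a ^ 'm"
  proof -
    have "norm (matrix_app N v) \<le> (\<Sum>i\<in>UNIV. norm (matrix_app N v $ i))"
      unfolding norm_vec_def by (rule L2_set_le_sum) auto
    also have "\<dots> \<le> (\<Sum>i\<in>UNIV. \<Sum>k\<in>UNIV. norm (N $ i $ k) * norm v)"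
      unfolding matrix_app_def vec_lambda_beta
      by (intro sum_mono sum_norm_le) (auto simp: norm_scaleC intro!: mult_left_mono Finite_Cartesian_Product.norm_nth_le)
    finally show ?thesis by (simp add: sum_distrib_left mult.commute)
  qed
qed (simp_all add: matrix_app_def vec_eq_iff scaleC_add_right sum.distrib scaleC.scaleR_right scaleR_sum_right)

lemma matrix_app_scaleC: "matrix_app N (c *\<^sub>C v) = c *\<^sub>C matrix_app N v"
  by (simp add: matrix_app_def vec_eq_iff scaleC_vec_def scaleC_scaleC scaleC.sum_right mult.commute)

lemma matrix_app_mult: "matrix_app (N ** L) v = matrix_app N (matrix_app L v)"
proof -
  have "(\<Sum>k\<in>UNIV. (\<Sum>j\<in>UNIV. N $ i $ j * L $ j $ k) *\<^sub>C (v $ k))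
      = (\<Sum>j\<in>UNIV. N $ i $ j *\<^sub>C (\<Sum>k\<in>UNIV. L $ j $ k *\<^sub>C (v $ k)))" for i
    unfolding scaleC.sum_left scaleC.sum_right scaleC_scaleC by (rule sum.swap)
  then show ?thesis by (simp add: matrix_app_def matrix_matrix_mult_def)
qed

lemma matrix_app_1: "matrix_app (mat 1) v = v"
proof -
  have "(\<Sum>k\<in>UNIV. (if i = k then 1 else 0) *\<^sub>C (v $ k)) = v $ i" for i
  proof -
    have "(\<Sum>k\<in>UNIV. (if i = k then 1 else 0) *\<^sub>C (v $ k)) = (\<Sum>k\<in>UNIV. if i = k then v $ k else 0)"
      using scaleC_of_real[of 1] by (intro sum.cong) (auto simp: scaleC.zero_left)
    then show ?thesis by simp
  qed
  then show ?thesis by (simp add: matrix_app_def mat_def vec_eq_iff)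
qed

theorem theorem2p6:
  fixes A :: "'n::{finite,linorder} \<Rightarrow> ('a::complex_banach \<times> 'a) set"
    and P\<^sub>1 P\<^sub>2 :: "('n \<Rightarrow> nat) \<Rightarrow> complex ^ 'm::finite ^ 'm"
    and \<alpha> :: real and d :: nat
  assumes "commuting_bounded_group_generators (\<lambda>j. op_scaleC \<i> (A j))"
    and "\<alpha> > 0"
    and "d \<ge> 1"
    and "\<And>x :: real ^ 'n::{finite,linorder}. invertible (poly_matrix d P\<^sub>2 x)"
  shows "\<exists>X\<^sub>\<alpha> :: ('a ^ 'm) set. closure X\<^sub>\<alpha> = UNIV \<and>
    (\<forall>x\<in>X\<^sub>\<alpha>. \<exists>u :: real \<Rightarrow> 'a ^ 'm.
       cauchy_solution \<alpha> (closure (op_poly d P\<^sub>1 A)) (closure (op_poly d P\<^sub>2 A)) x u \<and>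
       (\<forall>v. cauchy_solution \<alpha> (closure (op_poly d P\<^sub>1 A)) (closure (op_poly d P\<^sub>2 A)) x v \<longrightarrow>
            (\<forall>t\<ge>0. v t = u t)) \<and>
       (\<exists>U :: complex \<Rightarrow> 'a ^ 'm.
          (\<forall>t\<ge>0. U (complex_of_real t) = u t) \<and>
          vec_holomorphic_on U (UNIV - complex_of_real ` {..0}) \<and>
          (\<alpha> \<in> \<nat> \<longrightarrow> vec_holomorphic_on U UNIV)))"
proof -
  obtain T where T: "\<And>j. bounded_C0_group (T j)" "\<And>j. op_scaleC \<i> (A j) = group_generator (T j)"
    "\<And>j k s t x. T j s (T k t x) = T k t (T j s x)"
    using assms(1) unfolding commuting_bounded_group_generators_def by blast
  have "\<exists>M. \<forall>t x. norm (T j t x) \<le> M * norm x" for j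
    using T(1)[of j] by (simp add: bounded_C0_group_def)
  then obtain B where B: "\<And>j t x. norm (T j t x) \<le> B j * norm x" by metis
  define M where "M = (\<Sum>j\<in>UNIV. \<bar>B j\<bar>)"
  have "commuting_groups A T M"
  proof (rule commuting_groups.intro)
    fix j
    show "bounded_group (T j) M"
    proof
      show "norm (T j t x) \<le> M * norm x" for t x
      proof (rule order_trans[OF B mult_right_mono])
        have "\<bar>B j\<bar> \<le> M" unfolding M_def by (rule member_le_sum) auto
        then show "B j \<le> M" by linarith
      qed simp
    qed (use T(1) in \<open>auto simp: M_def sum_nonneg\<close>)
  qed (rule T)+
  then interpret V: commuting_groups "\<lambda>j. vec_graph (A j) :: (('a ^ 'm) \<times> ('a ^ 'm)) set" "\<lambda>j t. vec_map (T j t)" M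
    by (rule commuting_groups_vec)
  have adm: "V.admissible (matrix_app N)" for N
  proof -
    have lT: "linear (T j t)" and cT: "T j t (c *\<^sub>C x) = c *\<^sub>C T j t x" for j t c x
      using T(1)[of j] by (auto simp: bounded_C0_group_def bounded_linear.linear)
    have "matrix_app N (vec_map (T j t) v) = vec_map (T j t) (matrix_app N v)" for j t v
      by (simp add: matrix_app_def vec_map_def vec_eq_iff linear_sum[OF lT] cT)
    then show ?thesis
      by (simp add: V.admissible_def bounded_linear_matrix_app matrix_app_scaleC)
  qed
  have graph: "op_poly d P A = V.poly_graph d (\<lambda>\<eta>. matrix_app (P \<eta>))" for P
    unfolding op_poly_def V.poly_graph_def vec_graph_op_monomial[symmetric] vec_graph_iff ..
  have symbol: "V.symbol d (\<lambda>\<eta>. matrix_app (P \<eta>)) b v = matrix_app (poly_matrix d P (\<chi> j. b j)) v" for P b v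
    by (simp add: V.symbol_def poly_matrix_def matrix_app_def vec_eq_iff scaleC.sum_left scaleR_sum_right
        scaleC.scaleR_left sum.swap[of _ "UNIV :: 'm set"])
  have inv: "\<exists>I. V.admissible I \<and> (\<forall>v. I (V.symbol d (\<lambda>\<eta>. matrix_app (P\<^sub>2 \<eta>)) b v) = v) \<and>
      (\<forall>v. V.symbol d (\<lambda>\<eta>. matrix_app (P\<^sub>2 \<eta>)) b (I v) = v)" for b
  proof -
    obtain N where N: "poly_matrix d P\<^sub>2 (\<chi> j. b j) ** N = mat 1" "N ** poly_matrix d P\<^sub>2 (\<chi> j. b j) = mat 1"
      using assms(4) unfolding invertible_def by blast
    show ?thesis
      by (rule exI[of _ "matrix_app N"]) (simp add: adm symbol matrix_app_1 N flip: matrix_app_mult)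
  qed
  show ?thesis unfolding graph by (rule V.cauchy_problem[OF adm adm inv assms(2)])
qed

end
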